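(* Let $\mathcal{R}$ be the simple root system of type $\mathrm{G}_2$, realized as $$\mathcal{R}=\{\pm(e_i-e_j)\mid1\leq i<j\leq3\}\cup\{\pm(2e_i-e_j-e_k)\mid(i,j,k)\in\mathbf{S}_3\}\subset\mathbb{R}^3,$$ and set $$\mathcal{Q}^4_1=\{e_1-e_3,\ 2e_1-e_2-e_3,\ e_1+e_3-2e_2\},\quad \mathcal{Q}^4_2=\{e_1-e_3,\ 2e_1-e_2-e_3,\ e_1+e_2-2e_3\},$$ $$\mathcal{Q}^4_0=\{e_1-e_3,\ 2e_1-e_2-e_3\}.$$ Then: (1) Any maximal $\mathcal{Q}\in\mathfrak{Q}(\mathcal{R})$ is isomorphic either to $\mathcal{Q}^4_1$ or to $\mathcal{Q}^4_2$. (2) $\mathcal{Q}^4_1\in\mathfrak{Q}_s(\mathcal{R})$, and $\mathcal{Q}^4_2\notin\mathfrak{Q}_s(\mathcal{R})$. (3) $\mathfrak{Q}_\Upsilon(\mathcal{R})=\mathfrak{Q}_0(\mathcal{R})$, and all $\mathcal{Q}\in\mathfrak{Q}_\Upsilon(\mathcal{R})$ are isomorphic to $\mathcal{Q}^4_0$.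
   Context: Let $\mathfrak{g}$ be the complex simple Lie algebra with root system $\mathcal{R}$ with respect to a Cartan subalgebra $\mathfrak{h}$, where $\mathfrak{h}$ is the complexification of a Cartan subalgebra $\mathfrak{t}_0$ of a compact real form $\mathfrak{u}_0$ of $\mathfrak{g}$. Bars denote conjugation with respect to $\mathfrak{u}_0$; $\mathfrak{g}^\alpha$ is the root space of $\alpha$. $\mathfrak{Q}(\mathcal{R})$ is the collection of subsets $\mathcal{Q}\subset\mathcal{R}$ such that: $\alpha\in\mathcal{Q}\Rightarrow-\alpha\notin\mathcal{Q}$; $\alpha,\beta\in\mathcal{Q}\Rightarrow\alpha+\beta\notin\mathcal{R}$; and $\mathcal{R}\subset\mathbb{Z}[\mathcal{Q}]$ (the additive group generated by $\mathcal{Q}$). Maximal means maximal for inclusion in $\mathfrak{Q}(\mathcal{R})$. Two subsets of $\mathcal{R}$ are isomorphic if an automorphism of $\mathcal{R}$ transforms one into the other. To $\mathcal{Q}\in\mathfrak{Q}(\mathcal{R})$ associate $\mathfrak{q}=\mathfrak{h}\oplus\sum_{\alpha\in\mathcal{Q}}\mathfrak{g}^\alpha$; then $\mathfrak{q}\cap\mathfrak{u}_0=\mathfrak{t}_0$, $\mathfrak{q}\cap\bar{\mathfrak{q}}=\mathfrak{h}$. Let $\mathfrak{V}_0=\{\mathrm{Re}\,Z\mid Z\in\mathfrak{q}\}\subset\mathfrak{u}_0$. $\mathfrak{Q}_s(\mathcal{R})$, $\mathfrak{Q}_\Upsilon(\mathcal{R})$, $\mathfrak{Q}_0(\mathcal{R})$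 are the sets of $\mathcal{Q}\in\mathfrak{Q}(\mathcal{R})$ for which $(\mathfrak{u}_0,\mathfrak{q})$ is respectively $CR$-symmetric, has the weak-$J$-property, has the $J$-property, where: - $CR$-symmetric: there is an involution $\lambda$ of the Lie algebra $\mathfrak{g}$ with $\lambda(\mathfrak{u}_0)=\mathfrak{u}_0$, $\ker(\mathrm{Id}-\lambda)$ contained in the Lie subalgebra generated by $\mathfrak{q}+\bar{\mathfrak{q}}$, $\lambda(\mathfrak{q})=\mathfrak{q}$, and $Z+\lambda(Z)\in\mathfrak{q}\cap\bar{\mathfrak{q}}$ for all $Z\in\mathfrak{q}$ (the general definition also requires $\mathfrak{q}\cap\mathfrak{u}_0$ to be almost compact in $\mathfrak u_0$, which is automatic here since the Killing form of $\mathfrak{u}_0$ is negative definite); - weak-$J$-property: there is $J\in\mathrm{Der}(\mathfrak{u}_0)$ such that $\Upsilon=\exp(\pi J/2)$ satisfies $\Upsilon(\mathfrak{t}_0)=\mathfrak{t}_0$ and $X+i\Upsilon(X)\in\mathfrak{q}$ for all $X\in\mathfrak{V}_0$; - $J$-property: there is $J\in\mathrm{Der}(\mathfrak{u}_0)$ with $J(\mathfrak{t}_0)\subset\mathfrak{t}_0$ and $X+iJ(X)\in\mathfrak{q}$ for all $X\in\mathfrak{V}_0$. *)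

theory Defs
  imports "HOL-Analysis.Analysis" "HOL-Computational_Algebra.Group_Closure"
begin

section \<open>Subsets of a root system\<close>

definition admissible_sets :: "'v::real_vector set \<Rightarrow> 'v set set"
  where "admissible_sets R = {Q. Q \<subseteq> R \<and> (\<forall>\<alpha>\<in>Q. - \<alpha> \<notin> Q) \<and> (\<forall>\<alpha>\<in>Q. \<forall>\<beta>\<in>Q. \<alpha> + \<beta> \<notin> R)
     \<and> R \<subseteq> group_closure Q}"

definition maximal_admissible :: "'v::real_vector set \<Rightarrow> 'v set \<Rightarrow> bool"
  where "maximal_admissible R Q \<longleftrightarrow>
     Q \<in> admissible_sets R \<and> (\<forall>Q'\<in>admissible_sets R. Q \<subseteq> Q' \<longrightarrow> Q' = Q)"

text \<open>An automorphism of a root system \<open>R\<close> is a linear automorphism of \<open>span R\<close> mapping \<open>R\<close> onto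
  itself (Cartan integers are then preserved automatically); it is represented here by any linear
  extension to the ambient space.\<close>

definition root_automorphism :: "'v::real_vector set \<Rightarrow> ('v \<Rightarrow> 'v) \<Rightarrow> bool"
  where "root_automorphism R f \<longleftrightarrow> linear f \<and> inj_on f (span R) \<and> f ` R = R"

definition isomorphic_subsets :: "'v::real_vector set \<Rightarrow> 'v set \<Rightarrow> 'v set \<Rightarrow> bool"
  where "isomorphic_subsets R Q Q' \<longleftrightarrow> (\<exists>f. root_automorphism R f \<and> f ` Q = Q')"

abbreviation ee :: "3 \<Rightarrow> real^3"
  where "ee i \<equiv> axis i 1"

text \<open>The index type \<open>3\<close> has the elements \<open>1\<close>, \<open>2\<close> and \<open>3 = 0\<close>; since its order is therefore
  not \<open>1 < 2 < 3\<close>, the differences of two basis vectors are indexed by \<open>i \<noteq> j\<close>.\<close>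

definition G2 :: "(real^3) set"
  where "G2 = {ee i - ee j | i j. i \<noteq> j}
     \<union> {s *\<^sub>R (2 *\<^sub>R ee i - ee j - ee k) | s i j k. s \<in> {1, - 1} \<and> i \<noteq> j \<and> j \<noteq> k \<and> i \<noteq> k}"

definition Q41 :: "(real^3) set"
  where "Q41 = {ee 1 - ee 3, 2 *\<^sub>R ee 1 - ee 2 - ee 3, ee 1 + ee 3 - 2 *\<^sub>R ee 2}"

definition Q42 :: "(real^3) set"
  where "Q42 = {ee 1 - ee 3, 2 *\<^sub>R ee 1 - ee 2 - ee 3, ee 1 + ee 2 - 2 *\<^sub>R ee 3}"

definition Q40 :: "(real^3) set"
  where "Q40 = {ee 1 - ee 3, 2 *\<^sub>R ee 1 - ee 2 - ee 3}"


section \<open>Complex Lie algebras and compact real forms\<close>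

text \<open>A finite-dimensional complex Lie algebra is given by a bracket on \<open>complex^'n\<close>, that is, a
  basis of the underlying vector space has been chosen; none of the notions below depends on it.\<close>

locale complex_lie_algebra =
  fixes br :: "complex^'n \<Rightarrow> complex^'n \<Rightarrow> complex^'n"
  assumes linear_left: "Vector_Spaces.linear (*s) (*s) (\<lambda>x. br x y)"
    and linear_right: "Vector_Spaces.linear (*s) (*s) (\<lambda>y. br x y)"
    and alternating: "br x x = 0"
    and jacobi: "br x (br y z) + br y (br z x) + br z (br x y) = 0"

definition real_lie_subalgebra :: "(complex^'n \<Rightarrow> complex^'n \<Rightarrow> complex^'n) \<Rightarrow> (complex^'n) set \<Rightarrow> bool"
  where "real_lie_subalgebra br S \<longleftrightarrow> subspace S \<and> (\<forall>x\<in>S. \<forall>y\<in>S. br x y \<in> S)"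

definition complex_lie_subalgebra :: "(complex^'n \<Rightarrow> complex^'n \<Rightarrow> complex^'n) \<Rightarrow> (complex^'n) set \<Rightarrow> bool"
  where "complex_lie_subalgebra br S \<longleftrightarrow> vec.subspace S \<and> (\<forall>x\<in>S. \<forall>y\<in>S. br x y \<in> S)"

definition simple_lie :: "(complex^'n \<Rightarrow> complex^'n \<Rightarrow> complex^'n) \<Rightarrow> bool"
  where "simple_lie br \<longleftrightarrow> (\<exists>x y. br x y \<noteq> 0) \<and>
     (\<forall>I. vec.subspace I \<and> (\<forall>x. \<forall>y\<in>I. br x y \<in> I) \<longrightarrow> I = {0} \<or> I = UNIV)"

definition killing_form :: "(complex^'n \<Rightarrow> complex^'n \<Rightarrow> complex^'n) \<Rightarrow> complex^'n \<Rightarrow> complex^'n \<Rightarrow> complex"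
  where "killing_form br x y = trace (matrix (\<lambda>z. br x (br y z)))"

text \<open>The real span in the following definition is also the complex span of the brackets when \<open>S\<close>
  is a complex subspace, so the definition serves both real and complex subalgebras.\<close>

primrec lower_central ::
    "(complex^'n \<Rightarrow> complex^'n \<Rightarrow> complex^'n) \<Rightarrow> (complex^'n) set \<Rightarrow> nat \<Rightarrow> (complex^'n) set"
  where
    "lower_central br S 0 = S"
  | "lower_central br S (Suc k) = span {br x y | x y. x \<in> S \<and> y \<in> lower_central br S k}"

text \<open>A Cartan subalgebra \<open>T\<close> of \<open>L\<close>: a nilpotent subalgebra equal to its own normalizer in \<open>L\<close>.\<close>

definition cartan_subalgebra ::
    "(complex^'n \<Rightarrow> complex^'n \<Rightarrow> complex^'n) \<Rightarrow> (complex^'n) set \<Rightarrow> (complex^'n) set \<Rightarrow> bool"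
  where "cartan_subalgebra br L T \<longleftrightarrow> real_lie_subalgebra br T \<and> T \<subseteq> L
     \<and> (\<exists>k. lower_central br T k = {0})
     \<and> {x \<in> L. \<forall>y\<in>T. br x y \<in> T} = T"

definition complexification :: "(complex^'n) set \<Rightarrow> (complex^'n) set"
  where "complexification S = {x + \<i> *s y | x y. x \<in> S \<and> y \<in> S}"

definition real_form :: "(complex^'n \<Rightarrow> complex^'n \<Rightarrow> complex^'n) \<Rightarrow> (complex^'n) set \<Rightarrow> bool"
  where "real_form br u0 \<longleftrightarrow> real_lie_subalgebra br u0 \<and> complexification u0 = UNIV
     \<and> u0 \<inter> (*s) \<i> ` u0 = {0}"

text \<open>The Killing form of a real form is the restriction of the Killing form of the complex algebra,
  which is real-valued there.\<close>

definition compact_real_form :: "(complex^'n \<Rightarrow> complex^'n \<Rightarrow> complex^'n) \<Rightarrow> (complex^'n) set \<Rightarrow> bool"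
  where "compact_real_form br u0 \<longleftrightarrow> real_form br u0 \<and>
     (\<forall>x\<in>u0. x \<noteq> 0 \<longrightarrow> Re (killing_form br x x) < 0)"

definition re_part :: "(complex^'n) set \<Rightarrow> complex^'n \<Rightarrow> complex^'n"
  where "re_part u0 z = (THE x. x \<in> u0 \<and> (\<exists>y\<in>u0. z = x + \<i> *s y))"

definition im_part :: "(complex^'n) set \<Rightarrow> complex^'n \<Rightarrow> complex^'n"
  where "im_part u0 z = (THE y. y \<in> u0 \<and> (\<exists>x\<in>u0. z = x + \<i> *s y))"

definition conj_form :: "(complex^'n) set \<Rightarrow> complex^'n \<Rightarrow> complex^'n"
  where "conj_form u0 z = re_part u0 z - \<i> *s im_part u0 z"


section \<open>Roots\<close>

definition root_space ::
    "(complex^'n \<Rightarrow> complex^'n \<Rightarrow> complex^'n) \<Rightarrow> (complex^'n) set \<Rightarrow> (complex^'n \<Rightarrow> complex) \<Rightarrow> (complex^'n) set"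
  where "root_space br h \<alpha> = {z. \<forall>x\<in>h. br x z = \<alpha> x *s z}"

text \<open>Linear functionals on \<open>h\<close> are represented as functions that are \<open>undefined\<close> outside \<open>h\<close>.\<close>

definition dual_space :: "(complex^'n) set \<Rightarrow> (complex^'n \<Rightarrow> complex) set"
  where "dual_space h = {\<alpha> \<in> extensional h. \<forall>x\<in>h. \<forall>y\<in>h. \<forall>a b. \<alpha> (a *s x + b *s y) = a * \<alpha> x + b * \<alpha> y}"

definition roots ::
    "(complex^'n \<Rightarrow> complex^'n \<Rightarrow> complex^'n) \<Rightarrow> (complex^'n) set \<Rightarrow> (complex^'n \<Rightarrow> complex) set"
  where "roots br h = {\<alpha> \<in> dual_space h. (\<exists>x\<in>h. \<alpha> x \<noteq> 0) \<and> root_space br h \<alpha> \<noteq> {0}}"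

text \<open>An isomorphism \<open>\<rho>\<close> of an abstract root system \<open>R\<close> with the roots of \<open>h\<close>: an injective
  real-linear map from \<open>span R\<close> into the dual of \<open>h\<close> carrying \<open>R\<close> onto the set of roots.\<close>

definition root_identification ::
    "(complex^'n \<Rightarrow> complex^'n \<Rightarrow> complex^'n) \<Rightarrow> (complex^'n) set \<Rightarrow> 'v::real_vector set
      \<Rightarrow> ('v \<Rightarrow> complex^'n \<Rightarrow> complex) \<Rightarrow> bool"
  where "root_identification br h R \<rho> \<longleftrightarrow>
     \<rho> \<in> span R \<rightarrow> dual_space h
   \<and> (\<forall>u\<in>span R. \<forall>v\<in>span R. \<forall>a b. \<forall>x\<in>h.
        \<rho> (a *\<^sub>R u + b *\<^sub>R v) x = of_real a * \<rho> u x + of_real b * \<rho> v x)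
   \<and> inj_on \<rho> (span R)
   \<and> \<rho> ` R = roots br h"

text \<open>A complex simple Lie algebra with root system \<open>R\<close> with respect to the Cartan subalgebra
  \<open>complexification t0\<close>, where \<open>t0\<close> is a Cartan subalgebra of the compact real form \<open>u0\<close>.\<close>

locale simple_lie_with_roots = complex_lie_algebra br
  for br :: "complex^'n \<Rightarrow> complex^'n \<Rightarrow> complex^'n" +
  fixes u0 t0 :: "(complex^'n) set"
    and R :: "'v::real_vector set"
    and \<rho> :: "'v \<Rightarrow> complex^'n \<Rightarrow> complex"
  assumes simple: "simple_lie br"
    and compact: "compact_real_form br u0"
    and cartan_t0: "cartan_subalgebra br u0 t0"
    and cartan_h: "cartan_subalgebra br UNIV (complexification t0)"
    and root_identification: "root_identification br (complexification t0) R \<rho>"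


section \<open>CR structures on the compact form\<close>

definition q_of ::
    "(complex^'n \<Rightarrow> complex^'n \<Rightarrow> complex^'n) \<Rightarrow> (complex^'n) set
      \<Rightarrow> ('v::real_vector \<Rightarrow> complex^'n \<Rightarrow> complex) \<Rightarrow> 'v set \<Rightarrow> (complex^'n) set"
  where "q_of br t0 \<rho> Q = {x + (\<Sum>\<alpha>\<in>Q. z \<alpha>) | x z.
     x \<in> complexification t0 \<and> (\<forall>\<alpha>\<in>Q. z \<alpha> \<in> root_space br (complexification t0) (\<rho> \<alpha>))}"

text \<open>The further requirement on a CR-symmetric pair that \<open>q \<inter> u0\<close> be almost compact in \<open>u0\<close> holds
  automatically, since the Killing form is negative definite on \<open>u0\<close>.\<close>

definition CR_symmetric ::
    "(complex^'n \<Rightarrow> complex^'n \<Rightarrow> complex^'n) \<Rightarrow> (complex^'n) set \<Rightarrow> (complex^'n) set \<Rightarrow> bool"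
  where "CR_symmetric br u0 q \<longleftrightarrow> (\<exists>l.
     Vector_Spaces.linear (*s) (*s) l \<and> (\<forall>x y. l (br x y) = br (l x) (l y)) \<and> l \<circ> l = id
   \<and> l ` u0 = u0
   \<and> {z. l z = z} \<subseteq> complex_lie_subalgebra br hull {z + conj_form u0 w | z w. z \<in> q \<and> w \<in> q}
   \<and> l ` q = q
   \<and> (\<forall>z\<in>q. z + l z \<in> q \<inter> conj_form u0 ` q))"

definition derivation ::
    "(complex^'n \<Rightarrow> complex^'n \<Rightarrow> complex^'n) \<Rightarrow> (complex^'n) set \<Rightarrow> (complex^'n \<Rightarrow> complex^'n) \<Rightarrow> bool"
  where "derivation br u0 J \<longleftrightarrow> J \<in> u0 \<rightarrow> u0
   \<and> (\<forall>x\<in>u0. \<forall>y\<in>u0. \<forall>a b. J (a *\<^sub>R x + b *\<^sub>R y) = a *\<^sub>R J x + b *\<^sub>R J y)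
   \<and> (\<forall>x\<in>u0. \<forall>y\<in>u0. J (br x y) = br (J x) y + br x (J y))"

definition exp_map :: "('a::real_normed_vector \<Rightarrow> 'a) \<Rightarrow> 'a \<Rightarrow> 'a"
  where "exp_map A x = (\<Sum>n. (A ^^ n) x /\<^sub>R fact n)"

definition weak_J_property ::
    "(complex^'n \<Rightarrow> complex^'n \<Rightarrow> complex^'n) \<Rightarrow> (complex^'n) set \<Rightarrow> (complex^'n) set
      \<Rightarrow> (complex^'n) set \<Rightarrow> bool"
  where "weak_J_property br u0 t0 q \<longleftrightarrow> (\<exists>J. derivation br u0 J \<and>
     (let \<Upsilon> = exp_map (\<lambda>x. (pi / 2) *\<^sub>R J x) in
        \<Upsilon> ` t0 = t0 \<and> (\<forall>x \<in> re_part u0 ` q. x + \<i> *s \<Upsilon> x \<in> q)))"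

definition J_property ::
    "(complex^'n \<Rightarrow> complex^'n \<Rightarrow> complex^'n) \<Rightarrow> (complex^'n) set \<Rightarrow> (complex^'n) set
      \<Rightarrow> (complex^'n) set \<Rightarrow> bool"
  where "J_property br u0 t0 q \<longleftrightarrow> (\<exists>J. derivation br u0 J \<and>
     J ` t0 \<subseteq> t0 \<and> (\<forall>x \<in> re_part u0 ` q. x + \<i> *s J x \<in> q))"

definition Q_sym ::
    "(complex^'n \<Rightarrow> complex^'n \<Rightarrow> complex^'n) \<Rightarrow> (complex^'n) set \<Rightarrow> (complex^'n) set
      \<Rightarrow> 'v::real_vector set \<Rightarrow> ('v \<Rightarrow> complex^'n \<Rightarrow> complex) \<Rightarrow> 'v set set"
  where "Q_sym br u0 t0 R \<rho> = {Q \<in> admissible_sets R. CR_symmetric br u0 (q_of br t0 \<rho> Q)}"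

definition Q_weak_J ::
    "(complex^'n \<Rightarrow> complex^'n \<Rightarrow> complex^'n) \<Rightarrow> (complex^'n) set \<Rightarrow> (complex^'n) set
      \<Rightarrow> 'v::real_vector set \<Rightarrow> ('v \<Rightarrow> complex^'n \<Rightarrow> complex) \<Rightarrow> 'v set set"
  where "Q_weak_J br u0 t0 R \<rho> = {Q \<in> admissible_sets R. weak_J_property br u0 t0 (q_of br t0 \<rho> Q)}"

definition Q_J ::
    "(complex^'n \<Rightarrow> complex^'n \<Rightarrow> complex^'n) \<Rightarrow> (complex^'n) set \<Rightarrow> (complex^'n) set
      \<Rightarrow> 'v::real_vector set \<Rightarrow> ('v \<Rightarrow> complex^'n \<Rightarrow> complex) \<Rightarrow> 'v set set"
  where "Q_J br u0 t0 R \<rho> = {Q \<in> admissible_sets R. J_property br u0 t0 (q_of br t0 \<rho> Q)}"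

end

theory Submission
  imports Defs "HOL-Computational_Algebra.Fundamental_Theorem_Algebra"
begin

text \<open>
  Every \<open>Q\<close> in \<open>admissible_sets G2\<close> has the form \<open>{a, b}\<close>, \<open>{a, b, 2b - 3a}\<close> or \<open>{a, b, 3a - b}\<close>, where \<open>a\<close> is a
  short and \<open>b\<close> a long root at an angle of 30 degrees, and any two such pairs \<open>(a, b)\<close> are conjugate
  under an automorphism of the root system. Since the Killing form is negative definite on the compact
  form, the operators \<open>ad x\<close> with \<open>x\<close> in \<open>t0\<close> are simultaneously diagonalizable, and \<open>sl2\<close> arguments
  show that \<open>h\<close> and the root spaces of \<open>a\<close>, \<open>- a\<close>, \<open>b\<close>, \<open>- b\<close> generate the whole algebra. An automorphism that is
  the identity on \<open>h\<close> is therefore determined by its eigenvalues on the root spaces of \<open>a\<close> and \<open>b\<close>.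
  A CR symmetry has to be the identity on \<open>h\<close> and \<open>- 1\<close> on all root spaces in \<open>q\<close>, and \<open>exp (\<pi>J/2)\<close> has
  to be the identity on \<open>h\<close> and \<open>- \<i>\<close> on all root spaces in \<open>q\<close>. On the root spaces of \<open>2b - 3a\<close> and \<open>3a - b\<close>
  the eigenvalue \<open>- 1\<close> forces \<open>- 1\<close> and \<open>1\<close>, and the eigenvalue \<open>- \<i>\<close> forces \<open>\<i>\<close> and \<open>- 1\<close>, respectively.
\<close>

section \<open>Commuting skew operators\<close>

text \<open>The identification \<open>\<rho>\<close> is only real-linear, so independence of
  \<open>a\<close> and \<open>b\<close> does not by itself make \<open>\<rho> a\<close> and
  \<open>\<rho> b\<close> independent over the complex numbers. This is one reason for computing
  root strings: their lengths 3 and 1 give a Cartan matrix of determinant 1, and with it elements of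
  \<open>h\<close> on which \<open>\<rho> a\<close> and \<open>\<rho> b\<close> take prescribed
  values. Automorphisms are compared with \<open>exp (ad t)\<close> for such \<open>t\<close> in
  \<open>t0\<close>; commuting with conjugation settles the root spaces of \<open>- a\<close> and
  \<open>- b\<close>. The eigenvalue \<open>- \<i>\<close> belongs to \<open>J\<close> as well as to
  \<open>exp (\<pi>J/2)\<close> because \<open>exp (- \<i>\<pi>/2) = - \<i>\<close>. On the
  combinatorial side, the long roots lie in a sublattice of index 3 and the roots with even second
  coordinate in one of index 2; a generating set must escape both, which forces a short root and
  then a long root at 30 degrees to it.\<close>

abbreviation complex_linear :: "(complex^'n \<Rightarrow> complex^'n) \<Rightarrow> bool"
  where "complex_linear f \<equiv> Vector_Spaces.linear (*s) (*s) f"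

lemma complex_linearI:
  assumes "\<And>x y. f (x + y) = f x + f y" "\<And>c x. f (c *s x) = c *s f x"
  shows "complex_linear f"
  using assms by (auto simp: Vector_Spaces.linear_iff vec.vector_space_axioms)

lemma scaleR_eq_scale: "r *\<^sub>R x = complex_of_real r *s (x :: complex^'n)"
  by (simp add: vec_eq_iff scaleR_conv_of_real[where 'a = complex])

section \<open>Polynomials in an operator and eigenvectors\<close>

definition poly_op :: "complex poly \<Rightarrow> (complex^'n \<Rightarrow> complex^'n) \<Rightarrow> complex^'n \<Rightarrow> complex^'n"
  where "poly_op p T v = (\<Sum>i\<le>degree p. coeff p i *s (T ^^ i) v)"

lemma poly_op_bound:
  assumes "degree p \<le> n"
  shows "poly_op p T v = (\<Sum>i\<le>n. coeff p i *s (T ^^ i) v)"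
  unfolding poly_op_def
  by (rule sum.mono_neutral_left) (use assms in \<open>auto simp: coeff_eq_0\<close>)

lemma poly_op_linear_factor:
  assumes T: "complex_linear T"
  shows "poly_op ([:- c, 1:] * q) T v = T (poly_op q T v) - c *s poly_op q T v"
proof -
  let ?n = "degree q"
  have "degree ([:- c, 1:] * q) \<le> Suc ?n"
    by (rule order.trans[OF degree_mult_le]) simp
  then have "poly_op ([:- c, 1:] * q) T v = (\<Sum>i\<le>Suc ?n. coeff ([:- c, 1:] * q) i *s (T ^^ i) v)"
    by (rule poly_op_bound)
  also have "\<dots> = (\<Sum>i\<le>Suc ?n. coeff (pCons 0 q) i *s (T ^^ i) v - c *s (coeff q i *s (T ^^ i) v))"
    by (intro sum.cong) (auto simp: vec.scale_left_diff_distrib vec.scale_left_distrib)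
  also have "\<dots> = (\<Sum>i\<le>Suc ?n. coeff (pCons 0 q) i *s (T ^^ i) v)
      - c *s (\<Sum>i\<le>Suc ?n. coeff q i *s (T ^^ i) v)"
    by (simp only: sum_subtractf vec.scale_sum_right)
  also have "(\<Sum>i\<le>Suc ?n. coeff q i *s (T ^^ i) v) = poly_op q T v"
    by (rule poly_op_bound[symmetric]) simp
  also have "(\<Sum>i\<le>Suc ?n. coeff (pCons 0 q) i *s (T ^^ i) v) = (\<Sum>i\<le>?n. coeff q i *s T ((T ^^ i) v))"
    by (subst sum.atMost_Suc_shift) simp
  also have "\<dots> = T (poly_op q T v)"
    using T by (simp add: poly_op_def vec.linear_sum vec.linear_scale)
  finally show ?thesis .
qed

lemma subspace_funpow:
  assumes "\<And>w. w \<in> W \<Longrightarrow> T w \<in> W" "v \<in> W"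
  shows "(T ^^ i) v \<in> W"
  using assms by (induction i) auto

lemma subspace_poly_op:
  assumes "vec.subspace W" "\<And>w. w \<in> W \<Longrightarrow> T w \<in> W" "v \<in> W"
  shows "poly_op p T v \<in> W"
  unfolding poly_op_def using assms
  by (intro vec.subspace_sum vec.subspace_scale subspace_funpow) auto

text \<open>The \<open>CARD('n) + 1\<close> iterates of \<open>v\<close> exceed the dimension, so
  they are linearly dependent. Dependence is a property of sets and does not see a repetition among
  the iterates; that case is settled by the difference of two monomials.\<close>

lemma annihilating_poly:
  fixes T :: "complex^'n \<Rightarrow> complex^'n"
  shows "\<exists>p. p \<noteq> 0 \<and> poly_op p T v = 0"
proof (cases "inj_on (\<lambda>i. (T ^^ i) v) {..CARD('n)}")
  case False
  then obtain i j where ij: "(T ^^ i) v = (T ^^ j) v" "i < j"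
    unfolding inj_on_def by (metis linorder_neqE_nat)
  define p :: "complex poly" where "p = monom 1 i - monom 1 j"
  have "coeff p i = 1"
    using ij by (simp add: p_def)
  then have "p \<noteq> 0" by auto
  moreover have "degree p \<le> i + j"
    unfolding p_def by (intro degree_diff_le) (auto intro: order_trans[OF degree_monom_le])
  then have "poly_op p T v = (\<Sum>k\<le>i + j. (if i = k then (T ^^ k) v else 0) - (if j = k then (T ^^ k) v else 0))"
    unfolding poly_op_bound[OF \<open>degree p \<le> i + j\<close>]
    by (intro sum.cong) (auto simp: p_def)
  then have "poly_op p T v = 0"
    using ij by (simp add: sum_subtractf)
  ultimately show ?thesis by blast
next
  case True
  let ?f = "\<lambda>i. (T ^^ i) v" and ?n = "CARD('n)"
  have "card (?f ` {..?n}) > vec.dim (?f ` {..?n})"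
    using card_image[OF True] dim_subset_UNIV_cart_gen[of "?f ` {..?n}"] by simp
  then have "vec.dependent (?f ` {..?n})"
    using vec.dim_eq_card_independent by fastforce
  then obtain u k where u: "k \<le> ?n" "u (?f k) \<noteq> 0" "(\<Sum>x\<in>?f ` {..?n}. u x *s x) = 0"
    by (auto simp: vec.dependent_finite)
  define p where "p = Poly (map (\<lambda>i. u (?f i)) [0..<Suc ?n])"
  have coeff_p: "coeff p i = u (?f i)" if "i \<le> ?n" for i
    using that unfolding p_def coeff_Poly_eq
    by (subst nth_default_nth) (auto simp del: upt_Suc)
  have "degree p \<le> ?n"
    unfolding p_def using degree_Poly[of "map (\<lambda>i. u (?f i)) [0..<Suc ?n]"]
    by (intro degree_le) (auto simp: coeff_Poly_eq nth_default_beyond simp del: upt_Suc)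
  then have "poly_op p T v = (\<Sum>i\<le>?n. u (?f i) *s ?f i)"
    unfolding poly_op_bound[OF \<open>degree p \<le> ?n\<close>] by (intro sum.cong) (auto simp: coeff_p)
  also have "\<dots> = 0"
    using u(3) by (simp add: sum.reindex[OF True])
  finally show ?thesis
    using u(1,2) coeff_p[of k] by (metis coeff_0)
qed

text \<open>Split a linear factor \<open>[:- c, 1:]\<close> off an annihilating polynomial: the
  cofactor either annihilates \<open>v\<close> as well, with smaller degree, or maps
  \<open>v\<close> to an eigenvector for \<open>c\<close>. That vector stays in \<open>W\<close>,
  being a combination of iterates of \<open>v\<close>.\<close>

lemma eigenvector_exists:
  fixes T :: "complex^'n \<Rightarrow> complex^'n"
  assumes T: "complex_linear T" and W: "vec.subspace W" and inv: "\<And>w. w \<in> W \<Longrightarrow> T w \<in> W"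
    and ne: "W \<noteq> {0}"
  shows "\<exists>v\<in>W. \<exists>c. v \<noteq> 0 \<and> T v = c *s v"
proof -
  obtain v where v: "v \<in> W" "v \<noteq> 0"
    using ne vec.subspace_0[OF W] by auto
  obtain p where "p \<noteq> 0" "poly_op p T v = 0"
    using annihilating_poly by blast
  then show ?thesis
  proof (induction "degree p" arbitrary: p)
    case 0
    then obtain a where "p = [:a:]" "a \<noteq> 0"
      by (metis degree_eq_zeroE pCons_0_0)
    then show ?case
      using 0 v by (simp add: poly_op_def)
  next
    case (Suc n)
    then have "\<not> constant (poly p)"
      by (simp add: constant_degree)
    then obtain c where "poly p c = 0"
      using fundamental_theorem_of_algebra by blast
    then obtain q where q: "p = [:- c, 1:] * q"
      by (metis dvdE poly_eq_0_iff_dvd)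
    have "q \<noteq> 0" using q Suc.prems by auto
    then have deg: "degree p = Suc (degree q)"
      unfolding q by (subst degree_mult_eq) auto
    have eq: "T (poly_op q T v) = c *s poly_op q T v"
      using Suc.prems(2) unfolding q poly_op_linear_factor[OF T] by simp
    show ?case
    proof (cases "poly_op q T v = 0")
      case True
      then show ?thesis
        using Suc.hyps deg \<open>q \<noteq> 0\<close> by auto
    next
      case False
      then show ?thesis
        using eq subspace_poly_op[of W T, OF W inv v(1)] by blast
    qed
  qed
qed

text \<open>If some operator of the family is not a scalar on \<open>W\<close>, one of its
  eigenspaces is a proper nonzero subspace, preserved by the whole family because the operators
  commute; otherwise every nonzero vector of \<open>W\<close> is a common eigenvector. The descent
  is on the dimension, so infinite families such as \<open>br\<close> applied to \<open>t0\<close>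
  are covered.\<close>

lemma common_eigenvector_exists:
  fixes W :: "(complex^'n) set"
  assumes "vec.subspace W" "W \<noteq> {0}"
    and "\<And>T. T \<in> F \<Longrightarrow> complex_linear T"
    and "\<And>T w. T \<in> F \<Longrightarrow> w \<in> W \<Longrightarrow> T w \<in> W"
    and "\<And>S T x. S \<in> F \<Longrightarrow> T \<in> F \<Longrightarrow> S (T x) = T (S x)"
  shows "\<exists>v\<in>W. v \<noteq> 0 \<and> (\<forall>T\<in>F. \<exists>c. T v = c *s v)"
  using assms
proof (induction "vec.dim W" arbitrary: W rule: less_induct)
  case less
  let ?E = "\<lambda>T c. {w \<in> W. T w = c *s w}"
  have sub: "vec.subspace (?E T c)" if "T \<in> F" for T c
    using less.prems(1) less.prems(3)[OF that]
    by (auto simp: vec.subspace_def vec.linear_add vec.linear_scale vec.linear_0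
        vec.scale_right_distrib mult.commute)
  show ?case
  proof (cases "\<exists>T\<in>F. \<exists>c. ?E T c \<noteq> {0} \<and> ?E T c \<noteq> W")
    case True
    then obtain T c where T: "T \<in> F" "?E T c \<noteq> {0}" "?E T c \<noteq> W" by blast
    have "vec.dim (?E T c) < vec.dim W"
    proof -
      have "vec.span (?E T c) = ?E T c" "vec.span W = W"
        using sub[OF T(1)] less.prems(1) by (simp_all only: vec.span_eq_iff)
      then show ?thesis
        using T(3) by (intro vec.dim_psubset) blast
    qed
    moreover have "S w \<in> ?E T c" if "S \<in> F" "w \<in> ?E T c" for S w
      using that less.prems(3)[OF that(1)] less.prems(4)[OF that(1)] less.prems(5)[OF T(1) that(1)]
      by (simp add: vec.linear_scale)
    ultimately have "\<exists>v\<in>?E T c. v \<noteq> 0 \<and> (\<forall>T\<in>F. \<exists>c. T v = c *s v)"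
      using sub T less.prems by (intro less.hyps) auto
    then show ?thesis by blast
  next
    case False
    obtain v where v: "v \<in> W" "v \<noteq> 0"
      using less.prems(1,2) vec.subspace_0 by fastforce
    have "\<exists>c. T v = c *s v" if T: "T \<in> F" for T
    proof -
      obtain w c where "w \<in> W" "w \<noteq> 0" "T w = c *s w"
        using eigenvector_exists[of T W] less.prems T by blast
      then have "?E T c \<noteq> {0}" by blast
      then have "?E T c = W" using False T by blast
      then show ?thesis using v by blast
    qed
    then show ?thesis using v by blast
  qed
qed

text \<open>Definiteness is expressed without a sign, so that the negative definite form
  \<open>\<kappa> x (cj y)\<close> fits as it stands.\<close>

locale definite_sesquilinear =
  fixes B :: "complex^'n \<Rightarrow> complex^'n \<Rightarrow> complex"
  assumes add_left: "B (x + y) z = B x z + B y z"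
    and scale_left: "B (c *s x) z = c * B x z"
    and add_right: "B x (y + z) = B x y + B x z"
    and scale_right: "B x (c *s y) = cnj c * B x y"
    and definite: "B x x = 0 \<Longrightarrow> x = 0"
begin

lemma diff_left: "B (x - y) z = B x z - B y z"
  using add_left[of "x - y" y z] by simp

lemma orthogonal_span:
  assumes "\<And>e. e \<in> E \<Longrightarrow> B v e = 0" "w \<in> vec.span E"
  shows "B v w = 0"
  using assms(2)
proof (induction w rule: vec.span_induct_alt)
  case base
  then show ?case
    using scale_right[of v 0 0] by simp
next
  case (step c x y)
  then show ?case
    using assms(1) by (simp add: add_right scale_right)
qed

text \<open>Gram-Schmidt, one vector at a time: the new generator \<open>a\<close> is first made
  orthogonal to the span of \<open>E\<close>, and it contributes only if the remainder
  \<open>a'\<close> is nonzero.\<close>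

lemma projection_exists:
  assumes "finite E"
  shows "\<exists>e\<in>vec.span E. \<forall>w\<in>vec.span E. B (v - e) w = 0"
  using assms
proof (induction E arbitrary: v rule: finite_induct)
  case empty
  then show ?case
    using scale_right[of _ 0 0] by auto
next
  case (insert a E)
  obtain e where e: "e \<in> vec.span E" "\<forall>w\<in>vec.span E. B (v - e) w = 0"
    using insert.IH by blast
  obtain e' where e': "e' \<in> vec.span E" "\<forall>w\<in>vec.span E. B (a - e') w = 0"
    using insert.IH by blast
  define a' where "a' = a - e'"
  have mono: "vec.span E \<subseteq> vec.span (insert a E)"
    by (rule vec.span_mono) blast
  have a_in: "a \<in> vec.span (insert a E)"
    by (rule vec.span_base) simp
  show ?case
  proof (cases "a' = 0")
    case True
    then have "a \<in> vec.span E" using e' a'_def by simp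
    then have "vec.span (insert a E) = vec.span E"
      by (rule vec.span_redundant)
    then show ?thesis using e by auto
  next
    case False
    define c where "c = B (v - e) a' / B a' a'"
    let ?f = "e + c *s a'"
    have B0: "B a' a' \<noteq> 0" using definite False by blast
    have in_span: "?f \<in> vec.span (insert a E)"
      unfolding a'_def using e e' mono a_in
      by (intro vec.span_add vec.span_scale vec.span_diff) auto
    have orthE: "B (v - ?f) w = 0" if "w \<in> vec.span E" for w
      using e e' that by (simp add: diff_left add_left scale_left a'_def[symmetric] algebra_simps)
    have "B (v - ?f) a' = 0"
      using B0 by (simp add: diff_left add_left scale_left c_def)
    moreover have "B (v - ?f) e' = 0"
      using orthE e' by blast
    ultimately have "B (v - ?f) a = 0"
      using add_right[of "v - ?f" a' e'] by (simp add: a'_def)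
    then have "B (v - ?f) w = 0" if "w \<in> insert a E" for w
      using that orthE vec.span_base by blast
    then have "\<forall>w\<in>vec.span (insert a E). B (v - ?f) w = 0"
      using orthogonal_span by blast
    then show ?thesis using in_span by blast
  qed
qed

lemma eq_UNIV_if_orthogonal_trivial:
  assumes "vec.subspace E" "\<And>v. (\<forall>w\<in>E. B v w = 0) \<Longrightarrow> v = 0"
  shows "E = UNIV"
proof -
  obtain b where b: "b \<subseteq> E" "vec.independent b" "E \<subseteq> vec.span b"
    using vec.maximal_independent_subset[of E] .
  have sp: "vec.span b = E"
    using b assms(1) vec.span_minimal by blast
  have "finite b" using b(2) vec.finiteI_independent by blast
  have "v \<in> E" for v
    using projection_exists[OF \<open>finite b\<close>, of v] assms(2) unfolding sp by force
  then show ?thesis by blast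
qed

text \<open>By skewness, the orthogonal complement of the common eigenvectors is invariant under the
  family. If it were nonzero it would contain a common eigenvector, which would be orthogonal to
  itself.\<close>

lemma commuting_skew_diagonalizable:
  assumes lin: "\<And>T. T \<in> F \<Longrightarrow> complex_linear T"
    and skew: "\<And>T x y. T \<in> F \<Longrightarrow> B (T x) y = - B x (T y)"
    and comm: "\<And>S T x. S \<in> F \<Longrightarrow> T \<in> F \<Longrightarrow> S (T x) = T (S x)"
  shows "vec.span {v. \<forall>T\<in>F. \<exists>c. T v = c *s v} = UNIV" (is "vec.span ?E = _")
proof (rule eq_UNIV_if_orthogonal_trivial)
  fix v assume v: "\<forall>w\<in>vec.span ?E. B v w = 0"
  define W where "W = {v. \<forall>w\<in>vec.span ?E. B v w = 0}"
  have B0: "B 0 w = 0" for w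
    using scale_left[of 0 0 w] by simp
  have subW: "vec.subspace W"
    unfolding W_def by (rule vec.subspaceI) (auto simp: add_left scale_left B0)
  have inv: "T w \<in> W" if T: "T \<in> F" and w: "w \<in> W" for T w
  proof -
    have "B (T w) e = 0" if e: "e \<in> ?E" for e
    proof -
      obtain c where "T e = c *s e" using e T by blast
      then show ?thesis
        using skew[OF T, of w e] w e by (auto simp: W_def scale_right intro: vec.span_base)
    qed
    then show ?thesis
      unfolding W_def using orthogonal_span by blast
  qed
  have "W = {0}"
  proof (rule ccontr)
    assume "W \<noteq> {0}"
    then obtain u where u: "u \<in> W" "u \<noteq> 0" "\<forall>T\<in>F. \<exists>c. T u = c *s u"
      using common_eigenvector_exists[OF subW, of F] lin inv comm by blast
    then have "u \<in> vec.span ?E" by (intro vec.span_base) blast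
    then have "B u u = 0" using u(1) by (auto simp: W_def)
    then show False using definite u(2) by blast
  qed
  then show "v = 0" using v unfolding W_def by blast
qed (rule vec.subspace_span)

lemma skew_eigenvalue_imaginary:
  assumes "\<And>x y. B (T x) y = - B x (T y)" "T v = c *s v" "v \<noteq> 0"
  shows "cnj c = - c"
proof -
  have "c * B v v = - (cnj c * B v v)"
    using assms(1)[of v v] assms(2) by (simp add: scale_left scale_right)
  moreover have "B v v \<noteq> 0" using definite assms(3) by blast
  ultimately show ?thesis
    by (metis mult_cancel_right mult_minus_left minus_minus)
qed

end

section \<open>Compact real forms\<close>

lemma trace_matrix_commute:
  assumes "complex_linear f" "complex_linear g"
  shows "trace (matrix (\<lambda>z. f (g z))) = trace (matrix (\<lambda>z. g (f z)))"
  using matrix_compose_gen[OF assms] matrix_compose_gen[OF assms(2,1)] trace_mul_sym[of "matrix f" "matrix g"]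
  unfolding comp_def by simp

lemma trace_matrix_add: "trace (matrix (\<lambda>z. f z + g z)) = trace (matrix f) + trace (matrix g)"
  for f g :: "complex^'n \<Rightarrow> complex^'n"
  by (simp add: trace_def matrix_def sum.distrib)

lemma trace_matrix_diff: "trace (matrix (\<lambda>z. f z - g z)) = trace (matrix f) - trace (matrix g)"
  for f g :: "complex^'n \<Rightarrow> complex^'n"
  by (simp add: trace_def matrix_def sum_subtractf)

lemma trace_matrix_scale: "trace (matrix (\<lambda>z. c *s f z)) = c * trace (matrix f)"
  for f :: "complex^'n \<Rightarrow> complex^'n"
  by (simp add: trace_def matrix_def sum_distrib_left)

lemma trace_matrix_zero: "trace (matrix (\<lambda>_. 0 :: complex^'n)) = 0"
  using trace_matrix_scale[of 0 "\<lambda>_. 0 :: complex^'n"]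
  by (simp only: vector_smult_lzero mult_zero_left)

context complex_lie_algebra
begin

lemma br_add_left: "br (x + y) z = br x z + br y z"
  and br_diff_left: "br (x - y) z = br x z - br y z"
  and br_scale_left: "br (c *s x) z = c *s br x z"
  and br_minus_left: "br (- x) z = - br x z"
  and br_zero_left: "br 0 z = 0"
  by (rule vec.linear_add[OF linear_left]
    vec.linear_diff[OF linear_left]
    vec.linear_scale[OF linear_left]
    vec.linear_neg[OF linear_left]
    vec.linear_0[OF linear_left])+

lemma br_add_right: "br z (x + y) = br z x + br z y"
  and br_diff_right: "br z (x - y) = br z x - br z y"
  and br_scale_right: "br z (c *s x) = c *s br z x"
  and br_minus_right: "br z (- x) = - br z x"
  and br_zero_right: "br z 0 = 0"
  and br_sum_right: "br z (sum f A) = (\<Sum>a\<in>A. br z (f a))"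
  by (rule vec.linear_add[OF linear_right]
    vec.linear_diff[OF linear_right]
    vec.linear_scale[OF linear_right]
    vec.linear_neg[OF linear_right]
    vec.linear_0[OF linear_right]
    vec.linear_sum[OF linear_right])+

lemmas br_simps =
  br_add_left br_diff_left br_scale_left br_minus_left br_zero_left
  br_add_right br_diff_right br_scale_right br_minus_right br_zero_right

lemma br_anticommute: "br x y = - br y x"
  using alternating[of "x + y"] alternating[of x] alternating[of y]
  by (simp add: br_simps eq_neg_iff_add_eq_0 add.commute)

lemma jacobi': "br (br x y) z = br x (br y z) - br y (br x z)"
  using jacobi[of x y z] br_anticommute[of "br x y" z] br_anticommute[of x z]
  by (simp add: br_simps neg_eq_iff_add_eq_0 ac_simps)

abbreviation "\<kappa> \<equiv> killing_form br"

lemma killing_commute: "\<kappa> x y = \<kappa> y x"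
  unfolding killing_form_def by (rule trace_matrix_commute) (rule linear_right)+

lemma killing_add_left: "\<kappa> (x + y) z = \<kappa> x z + \<kappa> y z"
  and killing_diff_left: "\<kappa> (x - y) z = \<kappa> x z - \<kappa> y z"
  and killing_scale_left: "\<kappa> (c *s x) z = c * \<kappa> x z"
  unfolding killing_form_def
  by (simp_all add: br_simps trace_matrix_add trace_matrix_diff trace_matrix_scale)

lemma killing_add_right: "\<kappa> z (x + y) = \<kappa> z x + \<kappa> z y"
  and killing_diff_right: "\<kappa> z (x - y) = \<kappa> z x - \<kappa> z y"
  and killing_scale_right: "\<kappa> z (c *s x) = c * \<kappa> z x"
  by (simp_all add: killing_commute[of z] killing_add_left killing_diff_left killing_scale_left)

text \<open>\<open>ad (D x) ad y + ad x ad (D y)\<close> is the commutator of \<open>D\<close> with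
  \<open>ad x ad y\<close>, so its trace vanishes. The general form serves both \<open>ad u\<close>
  and the complex extension of a derivation \<open>J\<close> of the compact form.\<close>

lemma killing_derivation:
  assumes D: "complex_linear D" and der: "\<And>x y. D (br x y) = br (D x) y + br x (D y)"
  shows "\<kappa> (D x) y = - \<kappa> x (D y)"
proof -
  let ?T = "\<lambda>f. trace (matrix f)"
  have lin: "complex_linear (\<lambda>z. br x (br y z))" for x y
    using Vector_Spaces.linear_compose[OF linear_right linear_right] by (simp add: o_def)
  have add: "D (u + v) = D u + D v" for u v using D by (simp add: vec.linear_add)
  have "\<kappa> (D x) y + \<kappa> x (D y) = ?T (\<lambda>z. br (D x) (br y z) + br x (br (D y) z))"
    by (simp add: killing_form_def trace_matrix_add)
  also have "(\<lambda>z. br (D x) (br y z) + br x (br (D y) z)) = (\<lambda>z. D (br x (br y z)) - br x (br y (D z)))"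
    by (simp add: der add br_simps)
  also have "?T \<dots> = ?T (\<lambda>z. D (br x (br y z))) - ?T (\<lambda>z. br x (br y (D z)))"
    by (rule trace_matrix_diff)
  also have "\<dots> = 0"
    using trace_matrix_commute[OF D lin] by simp
  finally show ?thesis by (simp add: eq_neg_iff_add_eq_0)
qed

lemma killing_invariant: "\<kappa> (br u x) y = - \<kappa> x (br u y)"
  by (rule killing_derivation) (simp_all add: linear_right jacobi')

text \<open>Bilinearity extends the identity from a spanning set, one slot at a time. The spanning
  sets in use consist of eigenvectors of \<open>f\<close>, where the identity says that eigenvalues
  multiply.\<close>

lemma bracket_preserving_if_spanning:
  assumes f: "complex_linear f" and B: "vec.span B = UNIV"
    and pres: "\<And>x y. x \<in> B \<Longrightarrow> y \<in> B \<Longrightarrow> f (br x y) = br (f x) (f y)"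
  shows "f (br x y) = br (f x) (f y)"
proof -
  note lin = vec.linear_add[OF f] vec.linear_scale[OF f] vec.linear_0[OF f]
  have 1: "B \<subseteq> P \<Longrightarrow> vec.subspace P \<Longrightarrow> z \<in> P" for P z
    using vec.span_minimal[of B P] B by auto
  have 2: "y \<in> {y. f (br x y) = br (f x) (f y)}" if "x \<in> B" for x y
    by (rule 1) (use that in \<open>auto simp: pres lin br_simps intro!: vec.subspaceI\<close>)
  have "x \<in> {x. \<forall>y. f (br x y) = br (f x) (f y)}"
    by (rule 1) (use 2 in \<open>auto simp: lin br_simps intro!: vec.subspaceI\<close>)
  then show ?thesis by simp
qed

text \<open>With this, two bracket-preserving maps that agree on generators of the algebra agree
  everywhere.\<close>

lemma complex_subalgebra_equalizer:
  assumes f: "complex_linear f" "\<And>x y. f (br x y) = br (f x) (f y)"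
    and g: "complex_linear g" "\<And>x y. g (br x y) = br (g x) (g y)"
  shows "complex_lie_subalgebra br {z. f z = g z}"
  unfolding complex_lie_subalgebra_def
proof
  show "vec.subspace {z. f z = g z}"
    using f(1) g(1) by (intro vec.subspaceI) (simp_all add: vec.linear_add vec.linear_scale vec.linear_0)
  show "\<forall>x\<in>{z. f z = g z}. \<forall>y\<in>{z. f z = g z}. br x y \<in> {z. f z = g z}"
    by (simp add: f(2) g(2))
qed

end

section \<open>Conjugation with respect to a compact real form\<close>

locale compact_lie = complex_lie_algebra br
  for br :: "complex^'n \<Rightarrow> complex^'n \<Rightarrow> complex^'n" +
  fixes u0 :: "(complex^'n) set"
  assumes compact_form: "compact_real_form br u0"
begin

abbreviation "cj \<equiv> conj_form u0"
abbreviation "re \<equiv> re_part u0"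
abbreviation "im \<equiv> im_part u0"

lemma u0_subspace: "subspace u0"
  and u0_br: "x \<in> u0 \<Longrightarrow> y \<in> u0 \<Longrightarrow> br x y \<in> u0"
  and u0_total: "complexification u0 = UNIV"
  and u0_totally_real: "u0 \<inter> (*s) \<i> ` u0 = {0}"
  using compact_form
  by (auto simp: compact_real_form_def real_form_def real_lie_subalgebra_def)

lemma u0_zero: "0 \<in> u0"
  and u0_add: "x \<in> u0 \<Longrightarrow> y \<in> u0 \<Longrightarrow> x + y \<in> u0"
  and u0_diff: "x \<in> u0 \<Longrightarrow> y \<in> u0 \<Longrightarrow> x - y \<in> u0"
  and u0_minus: "x \<in> u0 \<Longrightarrow> - x \<in> u0"
  and u0_scaleR: "x \<in> u0 \<Longrightarrow> r *\<^sub>R x \<in> u0"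
  and u0_scale: "x \<in> u0 \<Longrightarrow> of_real r *s x \<in> u0"
  using u0_subspace
  by (simp_all add: subspace_0 subspace_add subspace_diff subspace_neg subspace_scale
      flip: scaleR_eq_scale)

lemma re_im_exist:
  obtains x y where "x \<in> u0" "y \<in> u0" "z = x + \<i> *s y"
proof -
  have "z \<in> complexification u0" using u0_total by simp
  then show ?thesis using that unfolding complexification_def by blast
qed

lemma re_im_unique:
  assumes "x \<in> u0" "y \<in> u0" "x' \<in> u0" "y' \<in> u0" "x + \<i> *s y = x' + \<i> *s y'"
  shows "x = x'" "y = y'"
proof -
  have eq: "x - x' = \<i> *s (y' - y)"
    using assms(5) by (simp add: vec.scale_right_diff_distrib algebra_simps)
  have "x - x' \<in> (*s) \<i> ` u0"
    unfolding eq using assms by (intro imageI u0_diff)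
  moreover have "x - x' \<in> u0"
    using assms by (intro u0_diff)
  ultimately have "x - x' \<in> u0 \<inter> (*s) \<i> ` u0" by blast
  then have "x - x' = 0" using u0_totally_real by blast
  then show "x = x'" "y = y'" using eq by simp_all
qed

lemma re_eq: "x \<in> u0 \<Longrightarrow> y \<in> u0 \<Longrightarrow> re (x + \<i> *s y) = x"
  unfolding re_part_def by (rule the_equality) (use re_im_unique in blast)+

lemma im_eq: "x \<in> u0 \<Longrightarrow> y \<in> u0 \<Longrightarrow> im (x + \<i> *s y) = y"
  unfolding im_part_def by (rule the_equality) (use re_im_unique in blast)+

lemma re_in [simp]: "re z \<in> u0" and im_in [simp]: "im z \<in> u0" and re_im: "re z + \<i> *s im z = z"
  by (rule re_im_exist[of z]; simp add: re_eq im_eq)+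

lemma cj_eq: "x \<in> u0 \<Longrightarrow> y \<in> u0 \<Longrightarrow> cj (x + \<i> *s y) = x - \<i> *s y"
  by (simp add: conj_form_def re_eq im_eq)

lemma re_add: "re (z + w) = re z + re w" and im_add: "im (z + w) = im z + im w"
proof -
  have "z + w = (re z + re w) + \<i> *s (im z + im w)"
    by (subst (1) re_im[of z, symmetric], subst (1) re_im[of w, symmetric])
       (simp add: vec.scale_right_distrib algebra_simps)
  then show "re (z + w) = re z + re w" "im (z + w) = im z + im w"
    using re_eq im_eq u0_add re_in im_in by metis+
qed

lemma re_scale: "re (c *s z) = of_real (Re c) *s re z - of_real (Im c) *s im z"
  and im_scale: "im (c *s z) = of_real (Im c) *s re z + of_real (Re c) *s im z"
proof -
  have "c *s z = (of_real (Re c) + \<i> * of_real (Im c)) *s (re z + \<i> *s im z)"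
    by (simp add: re_im complex_eq[symmetric])
  also have "\<dots> = (of_real (Re c) *s re z - of_real (Im c) *s im z)
      + \<i> *s (of_real (Im c) *s re z + of_real (Re c) *s im z)"
    by (simp add: vec.scale_right_distrib vec.scale_left_distrib distrib_left mult.commute)
  finally show "re (c *s z) = of_real (Re c) *s re z - of_real (Im c) *s im z"
    "im (c *s z) = of_real (Im c) *s re z + of_real (Re c) *s im z"
    by (metis re_eq im_eq u0_add u0_diff u0_scale re_in im_in)+
qed

lemma cj_add: "cj (z + w) = cj z + cj w"
  by (simp add: conj_form_def re_add im_add vec.scale_right_distrib)

lemma cj_scale: "cj (c *s z) = cnj c *s cj z"
proof -
  have "cnj c = of_real (Re c) - \<i> * of_real (Im c)"
    by (simp add: complex_eq_iff)
  then show ?thesis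
    unfolding conj_form_def re_scale im_scale
    by (simp add: vec.scale_right_distrib vec.scale_right_diff_distrib vec.scale_left_diff_distrib
        right_diff_distrib mult.commute)
qed

lemma cj_zero [simp]: "cj 0 = 0"
  using cj_scale[of 0 0] by simp

lemma cj_minus: "cj (- z) = - cj z"
  using cj_scale[of "-1" z] by simp

lemma cj_cj [simp]: "cj (cj z) = z"
  using cj_eq[of "re z" "- im z"] by (simp add: conj_form_def[of _ z] re_im u0_minus)

lemma cj_u0: "x \<in> u0 \<Longrightarrow> cj x = x"
  using cj_eq[of x 0] by (simp add: u0_zero)

lemma re_u0: "x \<in> u0 \<Longrightarrow> re x = x"
  using re_eq[of x 0] by (simp add: u0_zero)

lemma re_eq_cj: "re z = (1/2) *s (z + cj z)"
proof -
  have "z + cj z = (re z + \<i> *s im z) + (re z - \<i> *s im z)"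
    by (simp only: re_im conj_form_def)
  also have "\<dots> = (1 + 1) *s re z"
    by (simp only: vec.scale_left_distrib vec.scale_one) (simp add: algebra_simps)
  finally show ?thesis by simp
qed

lemma u0_iff_cj: "z \<in> u0 \<longleftrightarrow> cj z = z"
proof
  assume "cj z = z"
  then have "re z = (1/2 + 1/2) *s z"
    using re_eq_cj[of z] by (simp only: vec.scale_left_distrib vec.scale_right_distrib)
  then show "z \<in> u0" using re_in[of z] by simp
qed (rule cj_u0)

lemma cj_br: "cj (br z w) = br (cj z) (cj w)"
proof -
  have "br z w = br (re z + \<i> *s im z) (re w + \<i> *s im w)"
    by (simp add: re_im)
  also have "\<dots> = (br (re z) (re w) - br (im z) (im w)) + \<i> *s (br (re z) (im w) + br (im z) (re w))"
    by (simp add: br_simps vec.scale_right_distrib algebra_simps)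
  finally have "cj (br z w) = (br (re z) (re w) - br (im z) (im w)) - \<i> *s (br (re z) (im w) + br (im z) (re w))"
    by (simp only: cj_eq[OF u0_diff[OF u0_br u0_br] u0_add[OF u0_br u0_br]] re_in im_in)
  then show ?thesis
    by (simp add: conj_form_def[of _ z] conj_form_def[of _ w] br_simps vec.scale_right_distrib algebra_simps)
qed

lemma hermitian_definite: "definite_sesquilinear (\<lambda>x y. \<kappa> x (cj y))"
proof
  fix x y z :: "complex^'n" and c :: complex
  show "\<kappa> (x + y) (cj z) = \<kappa> x (cj z) + \<kappa> y (cj z)"
    by (rule killing_add_left)
  show "\<kappa> (c *s x) (cj z) = c * \<kappa> x (cj z)"
    by (rule killing_scale_left)
  show "\<kappa> x (cj (y + z)) = \<kappa> x (cj y) + \<kappa> x (cj z)"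
    by (simp only: cj_add killing_add_right)
  show "\<kappa> x (cj (c *s y)) = cnj c * \<kappa> x (cj y)"
    by (simp only: cj_scale killing_scale_right)
  assume "\<kappa> x (cj x) = 0"
  moreover have "\<kappa> x (cj x) = \<kappa> (re x + \<i> *s im x) (re x - \<i> *s im x)"
    by (simp add: re_im conj_form_def[of _ x])
  \<comment> \<open>The mixed terms cancel by symmetry of \<open>\<kappa>\<close>. The two remaining
    terms have negative real part unless their argument is zero, so they cannot cancel each
    other.\<close>
  then have "\<kappa> x (cj x) = \<kappa> (re x) (re x) + \<kappa> (im x) (im x)"
    by (simp add: killing_add_left killing_scale_left killing_diff_right killing_scale_right
        killing_commute[of "im x" "re x"] algebra_simps)
  ultimately have sum: "Re (\<kappa> (re x) (re x)) + Re (\<kappa> (im x) (im x)) = 0"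
    by (metis plus_complex.simps(1) zero_complex.simps(1))
  have neg: "Re (\<kappa> u u) < 0 \<or> u = 0" if "u \<in> u0" for u
    using compact_form that unfolding compact_real_form_def by blast
  have zero: "\<kappa> 0 0 = 0"
    using killing_scale_left[of 0 0 0] by simp
  have "re x = 0" "im x = 0"
    using sum neg[OF re_in, of x] neg[OF im_in, of x] by (auto simp: zero)
  then show "x = 0" using re_im[of x] by simp
qed

sublocale herm: definite_sesquilinear "\<lambda>x y. \<kappa> x (cj y)"
  by (rule hermitian_definite)

lemma ad_skew: "u \<in> u0 \<Longrightarrow> \<kappa> (br u x) (cj y) = - \<kappa> x (cj (br u y))"
  by (simp add: killing_invariant cj_br cj_u0)

text \<open>If \<open>ad z = 0\<close>, then the operator whose trace is
  \<open>\<kappa> z (cj z)\<close> is zero, and definiteness applies.\<close>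

lemma centre_trivial:
  assumes "\<And>y. br z y = 0"
  shows "z = 0"
proof -
  have "\<kappa> z (cj z) = 0"
    unfolding killing_form_def by (subst assms) (rule trace_matrix_zero)
  then show ?thesis by (rule herm.definite)
qed

text \<open>\<open>J\<close> is specified on \<open>u0\<close> only, whereas eigenvectors call for
  an operator on the complex space. The extension is
  \<open>J (re z) + \<i> J (im z)\<close>.\<close>

lemma derivation_extend:
  assumes "derivation br u0 J"
  obtains D where "complex_linear D" "\<And>x. x \<in> u0 \<Longrightarrow> D x = J x" "\<And>z. cj (D z) = D (cj z)"
    "\<And>x y. D (br x y) = br (D x) y + br x (D y)"
proof -
  have J_in: "J x \<in> u0" if "x \<in> u0" for x
    using assms that by (auto simp: derivation_def)
  have J_lin: "J (a *\<^sub>R x + b *\<^sub>R y) = a *\<^sub>R J x + b *\<^sub>R J y" if "x \<in> u0" "y \<in> u0" for a b x y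
    using assms that by (auto simp: derivation_def)
  have J_br: "J (br x y) = br (J x) y + br x (J y)" if "x \<in> u0" "y \<in> u0" for x y
    using assms that by (auto simp: derivation_def)
  have J_add: "J (x + y) = J x + J y" and J_diff: "J (x - y) = J x - J y" if "x \<in> u0" "y \<in> u0" for x y
    using J_lin[OF that, of 1 1] J_lin[OF that, of 1 "-1"] by simp_all
  have J_scale: "J (of_real a *s x) = of_real a *s J x" if "x \<in> u0" for a x
    using J_lin[OF that that, of a 0] by (simp add: scaleR_eq_scale)
  have J0: "J 0 = 0"
    using J_scale[OF u0_zero, of 0] by simp
  define D where "D z = J (re z) + \<i> *s J (im z)" for z
  have D_lin: "complex_linear D"
  proof (rule complex_linearI)
    show "D (x + y) = D x + D y" for x y
      by (simp add: D_def re_add im_add J_add vec.scale_right_distrib algebra_simps)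
    fix c x
    have c: "c = of_real (Re c) + \<i> * of_real (Im c)"
      by (simp add: complex_eq[symmetric])
    have "D (c *s x) = (of_real (Re c) + \<i> * of_real (Im c)) *s (J (re x) + \<i> *s J (im x))"
      unfolding D_def re_scale im_scale
      by (simp add: J_add J_diff J_scale u0_scale vec.scale_right_distrib vec.scale_left_distrib
          distrib_left mult.commute)
    then show "D (c *s x) = c *s D x"
      unfolding D_def c[symmetric] .
  qed
  have D_u0: "D x = J x" if "x \<in> u0" for x
    using re_eq[OF that u0_zero] im_eq[OF that u0_zero] by (simp add: D_def J0)
  have D_cj: "cj (D z) = D (cj z)" for z
  proof -
    have "D (cj z) = D (re z) - \<i> *s D (im z)"
      using D_lin by (simp add: conj_form_def vec.linear_diff vec.linear_scale)
    then show ?thesis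
      unfolding D_def[of z] by (simp add: cj_eq J_in D_u0)
  qed
  have "D (br x y) = br (D x) y + br x (D y)" for x y
  proof -
    have real: "D (br x y) = br (D x) y + br x (D y)" if "x \<in> u0" "y \<in> u0" for x y
      using that by (simp add: D_u0 u0_br J_br)
    have "D (br (re x + \<i> *s im x) (re y + \<i> *s im y)) = br (D (re x + \<i> *s im x)) (re y + \<i> *s im y)
        + br (re x + \<i> *s im x) (D (re y + \<i> *s im y))"
      using D_lin
      by (simp add: br_simps vec.linear_add vec.linear_diff vec.linear_scale real
          vec.scale_right_distrib algebra_simps)
    then show ?thesis by (simp add: re_im)
  qed
  then show ?thesis using that D_lin D_u0 D_cj by blast
qed

end

section \<open>The root space decomposition\<close>

locale finite_root_data = simple_lie_with_roots br u0 t0 R \<rho>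
  for br :: "complex^'n \<Rightarrow> complex^'n \<Rightarrow> complex^'n" and u0 t0
    and R :: "'v::real_vector set" and \<rho> +
  assumes finite_roots: "finite R"
begin

sublocale compact_lie br u0
  by unfold_locales (rule compact)

abbreviation "h \<equiv> complexification t0"
abbreviation "gs v \<equiv> root_space br h (\<rho> v)"
text \<open>Counting 0 as a weight makes \<open>h\<close> one more weight space, so that all
  decompositions are sums over a single finite set.\<close>

abbreviation "W \<equiv> insert 0 R"

lemma t0_subspace: "subspace t0"
  and t0_u0: "t0 \<subseteq> u0"
  and t0_nilpotent: "\<exists>k. lower_central br t0 k = {0}"
  using cartan_t0 by (auto simp: cartan_subalgebra_def real_lie_subalgebra_def)

lemma t0_in_u0: "x \<in> t0 \<Longrightarrow> x \<in> u0"
  using t0_u0 by blast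

text \<open>A skew operator has no nilpotent part: if \<open>br x (br x u) = 0\<close>, moving one
  \<open>br x\<close> across the form shows that \<open>br x u\<close> is orthogonal to itself. So
  the exponent can be lowered down to 1.\<close>

lemma ad_nilpotent_zero:
  assumes x: "x \<in> u0"
  shows "((br x) ^^ k) w = 0 \<Longrightarrow> k > 0 \<Longrightarrow> br x w = 0"
proof (induction k)
  case (Suc k)
  have step: "br x u = 0" if "br x (br x u) = 0" for u
    using herm.definite[of "br x u"] ad_skew[OF x, of u "br x u"] that
      killing_scale_right[of u 0 0] by simp
  show ?case
  proof (cases k)
    case 0
    then show ?thesis using Suc.prems by simp
  next
    case (Suc j)
    then show ?thesis using Suc.IH Suc.prems step by simp
  qed
qed simp

lemma t0_abelian:
  assumes "x \<in> t0" "y \<in> t0"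
  shows "br x y = 0"
proof -
  obtain k where k: "lower_central br t0 k = {0}" using t0_nilpotent by blast
  have "((br x) ^^ j) y \<in> lower_central br t0 j" for j
  proof (induction j)
    case (Suc j)
    then show ?case
      using assms(1) by (auto intro!: span_base)
  qed (simp add: assms)
  from this[of k] have "((br x) ^^ k) y = 0" using k by simp
  \<comment> \<open>\<open>k\<close> may be 0, namely when \<open>t0\<close> is zero, and the lemma
    on nilpotent operators requires a positive exponent.\<close>
  then have "((br x) ^^ Suc k) y = 0" by (simp add: br_simps)
  then show ?thesis
    using ad_nilpotent_zero[of x "Suc k" y] assms t0_in_u0 by blast
qed

lemma h_iff: "z \<in> h \<longleftrightarrow> re z \<in> t0 \<and> im z \<in> t0"
proof
  assume "z \<in> h"
  then obtain x y where "x \<in> t0" "y \<in> t0" "z = x + \<i> *s y"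
    by (auto simp: complexification_def)
  then show "re z \<in> t0 \<and> im z \<in> t0"
    by (simp add: re_eq im_eq t0_in_u0)
next
  assume "re z \<in> t0 \<and> im z \<in> t0"
  then show "z \<in> h"
    unfolding complexification_def using re_im[of z] by (metis (mono_tags, lifting) mem_Collect_eq)
qed

lemma t0_h: "x \<in> t0 \<Longrightarrow> x \<in> h"
  using re_eq[of x 0] im_eq[of x 0] t0_subspace by (simp add: h_iff t0_in_u0 u0_zero subspace_0)

lemma t0_scale: "x \<in> t0 \<Longrightarrow> of_real r *s x \<in> t0"
  using t0_subspace by (simp add: subspace_scale flip: scaleR_eq_scale)

lemma h_subspace: "vec.subspace h"
  by (intro vec.subspaceI)
    (auto simp: h_iff re_add im_add re_scale im_scale t0_scale subspace_add[OF t0_subspace]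
      subspace_diff[OF t0_subspace] re_u0 im_eq[of 0 0, simplified] u0_zero subspace_0[OF t0_subspace])

lemmas h_closed = vec.subspace_0[OF h_subspace] vec.subspace_add[OF h_subspace]
  vec.subspace_diff[OF h_subspace] vec.subspace_scale[OF h_subspace] vec.subspace_neg[OF h_subspace]

lemma re_h: "z \<in> h \<Longrightarrow> re z \<in> t0" and im_h: "z \<in> h \<Longrightarrow> im z \<in> t0"
  using h_iff by blast+

lemma cj_h: "z \<in> h \<Longrightarrow> cj z \<in> h"
  unfolding conj_form_def by (intro h_closed(3,4) t0_h[OF re_h] t0_h[OF im_h])

lemma h_abelian:
  assumes "x \<in> h" "y \<in> h"
  shows "br x y = 0"
proof -
  have "br (re x + \<i> *s im x) (re y + \<i> *s im y) = 0"
    using assms by (simp add: br_simps t0_abelian re_h im_h)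
  then show ?thesis by (simp add: re_im)
qed

text \<open>The centralizer of \<open>h\<close> is contained in its normalizer, which is
  \<open>h\<close> for a Cartan subalgebra.\<close>

lemma h_self_centralizing:
  assumes "\<And>y. y \<in> h \<Longrightarrow> br x y = 0"
  shows "x \<in> h"
  using assms cartan_h h_closed(1) unfolding cartan_subalgebra_def by auto

lemma \<rho>_dual: "v \<in> span R \<Longrightarrow> \<rho> v \<in> dual_space h"
  and \<rho>_linear: "u \<in> span R \<Longrightarrow> v \<in> span R \<Longrightarrow> x \<in> h
     \<Longrightarrow> \<rho> (a *\<^sub>R u + b *\<^sub>R v) x = of_real a * \<rho> u x + of_real b * \<rho> v x"
  and \<rho>_inj: "inj_on \<rho> (span R)"
  and \<rho>_image: "\<rho> ` R = roots br h"
  using root_identification by (auto simp: root_identification_def)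

lemma \<rho>_add: "u \<in> span R \<Longrightarrow> v \<in> span R \<Longrightarrow> x \<in> h \<Longrightarrow> \<rho> (u + v) x = \<rho> u x + \<rho> v x"
  and \<rho>_diff: "u \<in> span R \<Longrightarrow> v \<in> span R \<Longrightarrow> x \<in> h \<Longrightarrow> \<rho> (u - v) x = \<rho> u x - \<rho> v x"
  using \<rho>_linear[of u v x 1 1] \<rho>_linear[of u v x 1 "-1"] by simp_all

lemma \<rho>_scale: "v \<in> span R \<Longrightarrow> x \<in> h \<Longrightarrow> \<rho> (a *\<^sub>R v) x = of_real a * \<rho> v x"
  using \<rho>_linear[of v v x a 0] by simp

lemma \<rho>_zero: "x \<in> h \<Longrightarrow> \<rho> 0 x = 0"
  using \<rho>_scale[of 0 x 0] by (simp add: span_zero)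

lemma \<rho>_minus: "v \<in> span R \<Longrightarrow> x \<in> h \<Longrightarrow> \<rho> (- v) x = - \<rho> v x"
  using \<rho>_scale[of v x "-1"] by simp

lemma \<rho>_arg_linear:
  assumes "v \<in> span R" "x \<in> h" "y \<in> h"
  shows "\<rho> v (a *s x + b *s y) = a * \<rho> v x + b * \<rho> v y"
  using \<rho>_dual[OF assms(1)] assms(2,3) by (simp add: dual_space_def)

lemma \<rho>_arg_add: "v \<in> span R \<Longrightarrow> x \<in> h \<Longrightarrow> y \<in> h \<Longrightarrow> \<rho> v (x + y) = \<rho> v x + \<rho> v y"
  and \<rho>_arg_scale: "v \<in> span R \<Longrightarrow> x \<in> h \<Longrightarrow> \<rho> v (a *s x) = a * \<rho> v x"
  and \<rho>_arg_diff: "v \<in> span R \<Longrightarrow> x \<in> h \<Longrightarrow> y \<in> h \<Longrightarrow> \<rho> v (x - y) = \<rho> v x - \<rho> v y"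
  using \<rho>_arg_linear[of v x y 1 1] \<rho>_arg_linear[of v x x a 0] \<rho>_arg_linear[of v x y 1 "-1"]
  by simp_all

lemma \<rho>_separates:
  assumes "v \<in> span R" "w \<in> span R" "v \<noteq> w"
  shows "\<exists>H\<in>h. \<rho> v H \<noteq> \<rho> w H"
proof (rule ccontr)
  assume "\<not> ?thesis"
  moreover have "\<rho> v \<in> extensional h" "\<rho> w \<in> extensional h"
    using \<rho>_dual assms by (auto simp: dual_space_def)
  ultimately have "\<rho> v = \<rho> w"
    by (intro extensionalityI[of _ h]) auto
  then show False
    using \<rho>_inj assms by (auto simp: inj_on_def)
qed

lemma gs_iff: "z \<in> gs v \<longleftrightarrow> (\<forall>H\<in>h. br H z = \<rho> v H *s z)"
  by (simp add: root_space_def)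

lemma gs_subspace: "vec.subspace (gs v)"
  by (intro vec.subspaceI) (auto simp: gs_iff br_simps vec.scale_right_distrib mult.commute)

lemmas gs_closed = vec.subspace_0[OF gs_subspace] vec.subspace_add[OF gs_subspace]
  vec.subspace_diff[OF gs_subspace] vec.subspace_scale[OF gs_subspace] vec.subspace_neg[OF gs_subspace]

lemma gs_zero: "gs 0 = h"
proof -
  have "z \<in> h \<longleftrightarrow> (\<forall>H\<in>h. br H z = 0)" for z
    using h_abelian h_self_centralizing[of z] br_anticommute[of z] by auto
  moreover have "z \<in> gs 0 \<longleftrightarrow> (\<forall>H\<in>h. br H z = 0)" for z
    by (simp add: gs_iff \<rho>_zero)
  ultimately show ?thesis by blast
qed

lemma gs_br:
  assumes "v \<in> span R" "w \<in> span R" "x \<in> gs v" "y \<in> gs w"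
  shows "br x y \<in> gs (v + w)"
  unfolding gs_iff
proof
  fix H assume H: "H \<in> h"
  have "br H (br x y) = br (br H x) y + br x (br H y)"
    using jacobi'[of H x y] by simp
  then show "br H (br x y) = \<rho> (v + w) H *s br x y"
    using assms H by (simp add: gs_iff \<rho>_add br_simps vec.scale_left_distrib)
qed

text \<open>This links the abstract root system to the algebra: a bracket whose weight lies outside
  \<open>W\<close> must vanish. Since \<open>\<rho>\<close> is injective on all of
  \<open>span R\<close>, a vector of the span with a nonzero root space is itself in
  \<open>R\<close>, not merely equal to a root after applying \<open>\<rho>\<close>.\<close>

lemma roots_iff: "v \<in> R \<longleftrightarrow> v \<in> span R \<and> v \<noteq> 0 \<and> gs v \<noteq> {0}"
proof
  assume v: "v \<in> R"
  then have "\<rho> v \<in> roots br h" using \<rho>_image by blast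
  then show "v \<in> span R \<and> v \<noteq> 0 \<and> gs v \<noteq> {0}"
    using v \<rho>_zero by (auto simp: roots_def span_base)
next
  assume v: "v \<in> span R \<and> v \<noteq> 0 \<and> gs v \<noteq> {0}"
  then obtain H where "H \<in> h" "\<rho> v H \<noteq> 0"
    using \<rho>_separates[of v 0] \<rho>_zero span_zero by fastforce
  then have "\<rho> v \<in> \<rho> ` R"
    unfolding \<rho>_image roots_def using v \<rho>_dual by blast
  then obtain w where "w \<in> R" "\<rho> v = \<rho> w" by blast
  moreover have "v = w"
    using inj_onD[OF \<rho>_inj] calculation v span_base by metis
  ultimately show "v \<in> R" by simp
qed

lemma gs_trivial: "v \<in> span R \<Longrightarrow> v \<notin> W \<Longrightarrow> x \<in> gs v \<Longrightarrow> x = 0"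
  using roots_iff[of v] by auto

lemma W_span: "v \<in> W \<Longrightarrow> v \<in> span R"
  by (auto simp: span_base span_zero)

text \<open>For a root this is the eigenvalue of a skew operator \<open>ad H\<close>; the property
  survives real combinations and so extends from \<open>R\<close> to \<open>span R\<close>.\<close>

lemma \<rho>_imaginary:
  assumes "v \<in> span R" "H \<in> t0"
  shows "cnj (\<rho> v H) = - \<rho> v H"
proof -
  have H: "H \<in> h" "H \<in> u0" using assms(2) by (simp_all add: t0_h t0_in_u0)
  let ?P = "{v \<in> span R. cnj (\<rho> v H) = - \<rho> v H}"
  have "R \<subseteq> ?P"
  proof
    fix v assume v: "v \<in> R"
    then obtain z where "z \<in> gs v" "z \<noteq> 0"
      using roots_iff[of v] gs_closed(1)[of v] by auto
    then show "v \<in> ?P"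
      using herm.skew_eigenvalue_imaginary[of "br H" z "\<rho> v H"] ad_skew[OF H(2)] H v
      by (simp add: gs_iff span_base)
  qed
  moreover have "subspace ?P"
    using H by (intro subspaceI) (auto simp: \<rho>_zero \<rho>_add \<rho>_scale span_zero span_add span_scale)
  ultimately have "span R \<subseteq> ?P" by (rule span_minimal)
  then show ?thesis using assms(1) by blast
qed

lemma \<rho>_cj:
  assumes "v \<in> span R" "H \<in> h"
  shows "\<rho> v (cj H) = - cnj (\<rho> v H)"
proof -
  have "\<rho> v H = \<rho> v (re H) + \<i> * \<rho> v (im H)"
    using \<rho>_arg_linear[of v "re H" "im H" 1 \<i>] assms by (simp add: re_im t0_h re_h im_h)
  moreover have "\<rho> v (cj H) = \<rho> v (re H) - \<i> * \<rho> v (im H)"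
    using \<rho>_arg_linear[of v "re H" "im H" 1 "- \<i>"] assms
    by (simp add: conj_form_def t0_h re_h im_h)
  ultimately show ?thesis
    using assms by (simp add: \<rho>_imaginary re_h im_h)
qed

lemma gs_cj:
  assumes "v \<in> span R" "z \<in> gs v"
  shows "cj z \<in> gs (- v)"
  unfolding gs_iff
proof
  fix H assume H: "H \<in> h"
  have "br H (cj z) = cj (br (cj H) z)"
    by (simp add: cj_br)
  also have "\<dots> = cnj (\<rho> v (cj H)) *s cj z"
    using assms H cj_h by (simp add: gs_iff cj_scale)
  finally show "br H (cj z) = \<rho> (- v) H *s cj z"
    using assms H by (simp add: \<rho>_cj \<rho>_minus)
qed

lemma eigenvector_in_gs:
  assumes "\<And>x. x \<in> t0 \<Longrightarrow> \<exists>c. br x z = c *s z"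
  shows "\<exists>v\<in>W. z \<in> gs v"
proof (cases "z = 0")
  case True
  then show ?thesis using gs_closed by blast
next
  case False
  have "\<exists>c. br H z = c *s z" if H: "H \<in> h" for H
  proof -
    obtain a b where "br (re H) z = a *s z" "br (im H) z = b *s z"
      using assms H re_h im_h by meson
    then have "br (re H + \<i> *s im H) z = (a + \<i> * b) *s z"
      by (simp add: br_simps vec.scale_left_distrib)
    then show ?thesis unfolding re_im ..
  qed
  then obtain \<mu> where \<mu>: "\<And>H. H \<in> h \<Longrightarrow> br H z = \<mu> H *s z" by metis
  \<comment> \<open>Elements of \<open>dual_space h\<close> are extensional, so the eigenvalue
    function has to be cut down to \<open>h\<close> before it can count as a root.\<close>
  define \<alpha> where "\<alpha> = restrict \<mu> h"
  have \<alpha>: "br H z = \<alpha> H *s z" if "H \<in> h" for H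
    using \<mu> that by (simp add: \<alpha>_def)
  have "\<alpha> \<in> dual_space h"
    unfolding dual_space_def
  proof (intro CollectI conjI ballI allI)
    show "\<alpha> \<in> extensional h" by (simp add: \<alpha>_def)
    fix x y a b assume xy: "x \<in> h" "y \<in> h"
    have "\<alpha> (a *s x + b *s y) *s z = br (a *s x + b *s y) z"
      using xy by (simp add: \<alpha> h_closed)
    also have "\<dots> = (a * \<alpha> x + b * \<alpha> y) *s z"
      using xy by (simp add: br_simps \<alpha> vec.scale_left_distrib)
    finally show "\<alpha> (a *s x + b *s y) = a * \<alpha> x + b * \<alpha> y"
      using False by (simp only: vec.scale_cancel_right) simp
  qed
  show ?thesis
  proof (cases "\<exists>x\<in>h. \<alpha> x \<noteq> 0")
    case True
    then have "\<alpha> \<in> \<rho> ` R"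
      using \<open>\<alpha> \<in> dual_space h\<close> False \<alpha> unfolding \<rho>_image roots_def root_space_def by blast
    then show ?thesis using \<alpha> by (auto simp: gs_iff)
  next
    case False
    then show ?thesis using \<alpha> by (auto simp: gs_iff \<rho>_zero)
  qed
qed

lemma weight_spaces_span: "vec.span (\<Union>v\<in>W. gs v) = UNIV"
proof -
  let ?F = "br ` t0"
  have "vec.span {v. \<forall>T\<in>?F. \<exists>c. T v = c *s v} = UNIV"
  proof (rule herm.commuting_skew_diagonalizable)
    fix S T x assume "S \<in> ?F" "T \<in> ?F"
    then obtain s t where st: "S = br s" "T = br t" "s \<in> t0" "t \<in> t0" by blast
    have "br (br s t) x = br s (br t x) - br t (br s x)" by (rule jacobi')
    then show "S (T x) = T (S x)" using st by (simp add: t0_abelian br_simps)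
  next
    fix T x y assume "T \<in> ?F"
    then show "\<kappa> (T x) (cj y) = - \<kappa> x (cj (T y))"
      using ad_skew t0_in_u0 by auto
  qed (auto intro: linear_right)
  moreover have "{v. \<forall>T\<in>?F. \<exists>c. T v = c *s v} \<subseteq> (\<Union>v\<in>W. gs v)"
    using eigenvector_in_gs by auto
  ultimately show ?thesis using vec.span_mono by blast
qed

lemma weight_induct:
  assumes "vec.subspace P" "\<And>v. v \<in> W \<Longrightarrow> gs v \<subseteq> P"
  shows "z \<in> P"
proof -
  have "vec.span (\<Union>v\<in>W. gs v) \<subseteq> P"
    using assms by (intro vec.span_minimal) auto
  then show ?thesis using weight_spaces_span by auto
qed

text \<open>Applying \<open>ad H - \<rho> w H\<close>, with \<open>H\<close> separating
  \<open>v\<close> from \<open>w\<close>, removes the \<open>w\<close> term and multiplies the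
  \<open>v\<close> term by a nonzero scalar, so the induction hypothesis applies to the shorter
  relation.\<close>

lemma weight_independent:
  assumes "finite A" "A \<subseteq> span R" "\<And>v. v \<in> A \<Longrightarrow> c v \<in> gs v" "sum c A = 0" "v \<in> A"
  shows "c v = 0"
  using assms
proof (induction A arbitrary: c v rule: finite_induct)
  case (insert w A)
  have others: "c v = 0" if v: "v \<in> A" for v
  proof -
    have "v \<noteq> w" using v insert by blast
    then obtain H where H: "H \<in> h" "\<rho> v H \<noteq> \<rho> w H"
      using \<rho>_separates[of v w] v insert.prems(1) by blast
    let ?c = "\<lambda>u. (\<rho> u H - \<rho> w H) *s c u"
    have "br H (sum c (insert w A)) - \<rho> w H *s sum c (insert w A) = 0"
      using insert.prems(3) by (simp add: br_simps)
    moreover have "br H (sum c (insert w A)) = (\<Sum>u\<in>insert w A. \<rho> u H *s c u)"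
      unfolding br_sum_right using insert.prems(2) H by (intro sum.cong) (auto simp: gs_iff)
    moreover have "\<rho> w H *s sum c (insert w A) = (\<Sum>u\<in>insert w A. \<rho> w H *s c u)"
      by (rule vec.scale_sum_right)
    ultimately have "(\<Sum>u\<in>insert w A. ?c u) = 0"
      by (simp only: vec.scale_left_diff_distrib sum_subtractf)
    then have "sum ?c A = 0"
      using insert.hyps by simp
    then have "?c v = 0"
      using insert.IH[of ?c v] insert.prems v by (auto intro: gs_closed)
    then show ?thesis using H by simp
  qed
  then have "c w = 0"
    using insert.prems(3) insert.hyps by simp
  then show ?case using others insert.prems by auto
qed simp

section \<open>Projections to the weight spaces\<close>

lemma weight_decomposition: "\<exists>c. (\<forall>v\<in>W. c v \<in> gs v) \<and> z = sum c W"
proof -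
  let ?P = "{z. \<exists>c. (\<forall>v\<in>W. c v \<in> gs v) \<and> z = sum c W}"
  have "z \<in> ?P"
  proof (rule weight_induct)
    show "vec.subspace ?P"
    proof (rule vec.subspaceI)
      show "0 \<in> ?P"
        by (intro CollectI exI[of _ "\<lambda>_. 0"]) (auto intro: gs_closed)
      fix x y assume "x \<in> ?P" "y \<in> ?P"
      then obtain c d where "\<forall>v\<in>W. c v \<in> gs v" "x = sum c W" "\<forall>v\<in>W. d v \<in> gs v" "y = sum d W"
        by blast
      then show "x + y \<in> ?P"
        by (intro CollectI exI[of _ "\<lambda>v. c v + d v"]) (auto intro: gs_closed simp: sum.distrib)
    next
      fix a x assume "x \<in> ?P"
      then obtain c where "\<forall>v\<in>W. c v \<in> gs v" "x = sum c W" by blast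
      then show "a *s x \<in> ?P"
        by (intro CollectI exI[of _ "\<lambda>v. a *s c v"]) (auto intro: gs_closed simp: vec.scale_sum_right)
    qed
    fix v assume v: "v \<in> W"
    show "gs v \<subseteq> ?P"
    proof
      fix z assume z: "z \<in> gs v"
      have "sum (\<lambda>w. if w = v then z else 0) W = z"
        using v finite_roots by (subst sum.delta) auto
      then show "z \<in> ?P"
        using z by (intro CollectI exI[of _ "\<lambda>w. if w = v then z else 0"]) (auto intro: gs_closed)
    qed
  qed
  then show ?thesis by simp
qed

text \<open>Independence of the weight spaces makes the choice immaterial. The value 0 off
  \<open>W\<close> makes linearity and the rule for brackets with \<open>h\<close> hold for every
  \<open>v\<close>.\<close>

definition component :: "'v \<Rightarrow> complex^'n \<Rightarrow> complex^'n"
  where "component v z = (if v \<in> W then (SOME c. (\<forall>v\<in>W. c v \<in> gs v) \<and> z = sum c W) v else 0)"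

lemma component_in: "component v z \<in> gs v"
  and component_sum: "(\<Sum>v\<in>W. component v z) = z"
proof -
  let ?c = "SOME c. (\<forall>v\<in>W. c v \<in> gs v) \<and> z = sum c W"
  have c: "(\<forall>v\<in>W. ?c v \<in> gs v) \<and> z = sum ?c W"
    by (rule someI_ex[OF weight_decomposition[of z]])
  then show "component v z \<in> gs v"
    by (simp add: component_def gs_closed)
  have "(\<Sum>v\<in>W. component v z) = sum ?c W"
    by (intro sum.cong) (auto simp: component_def)
  then show "(\<Sum>v\<in>W. component v z) = z" using c by metis
qed

lemma component_eqI:
  assumes "\<And>v. v \<in> W \<Longrightarrow> c v \<in> gs v" "z = sum c W" "v \<in> W"
  shows "component v z = c v"
proof -
  have "(\<Sum>w\<in>W. component w z - c w) = 0"
    using assms(2) by (simp add: sum_subtractf component_sum)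
  then have "component v z - c v = 0"
    using weight_independent[of W "\<lambda>w. component w z - c w" v] finite_roots W_span assms
    by (auto intro!: gs_closed component_in)
  then show ?thesis by simp
qed

lemma component_outside: "v \<notin> W \<Longrightarrow> component v z = 0"
  by (simp add: component_def)

lemma component_add: "component v (x + y) = component v x + component v y"
proof (cases "v \<in> W")
  case True
  then show ?thesis
    by (intro component_eqI) (auto intro!: gs_closed component_in simp: sum.distrib component_sum)
qed (simp add: component_outside)

lemma component_scale: "component v (a *s x) = a *s component v x"
proof (cases "v \<in> W")
  case True
  then show ?thesis
    by (intro component_eqI)
      (auto intro!: gs_closed component_in simp: component_sum simp flip: vec.scale_sum_right)
qed (simp add: component_outside)

lemma component_zero [simp]: "component v 0 = 0"
  using component_scale[of v 0 0] by simp

lemma component_diff: "component v (x - y) = component v x - component v y"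
  using component_add[of v "x - y" y] by simp

lemma component_sum_arg: "component v (sum f A) = (\<Sum>a\<in>A. component v (f a))"
  by (induction A rule: infinite_finite_induct) (simp_all add: component_add)

lemma component_gs:
  assumes "v \<in> span R" "z \<in> gs v"
  shows "component w z = (if w = v then z else 0)"
proof (cases "v \<in> W \<and> w \<in> W")
  case True
  have "sum (\<lambda>w. if w = v then z else 0) W = z"
    using True finite_roots by (subst sum.delta) auto
  then show ?thesis
    using True assms(2) component_eqI[of "\<lambda>w. if w = v then z else 0" z w] gs_closed(1) by auto
next
  case False
  then have "z = 0 \<or> w \<notin> W" using assms gs_trivial by blast
  then show ?thesis
    using False assms gs_trivial by (auto simp: component_outside)
qed

lemma component_br:
  assumes "H \<in> h"
  shows "component v (br H z) = \<rho> v H *s component v z"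
proof -
  let ?P = "{z. component v (br H z) = \<rho> v H *s component v z}"
  have "z \<in> ?P"
  proof (rule weight_induct)
    show "vec.subspace ?P"
      by (intro vec.subspaceI)
        (auto simp: br_simps component_add component_scale vec.scale_right_distrib mult.commute)
    fix w assume "w \<in> W"
    then show "gs w \<subseteq> ?P"
      using assms by (auto simp: gs_iff component_scale component_gs[of w, OF W_span] root_space_def)
  qed
  then show ?thesis by simp
qed

lemma zero_if_roots_vanish:
  assumes "H \<in> h" "\<And>v. v \<in> R \<Longrightarrow> \<rho> v H = 0"
  shows "H = 0"
proof (rule centre_trivial)
  fix y
  have "y \<in> {y. br H y = 0}"
  proof (rule weight_induct)
    show "vec.subspace {y. br H y = 0}"
      by (intro vec.subspaceI) (auto simp: br_simps)
  qed (use assms \<rho>_zero in \<open>auto simp: gs_iff\<close>)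
  then show "br H y = 0" by simp
qed

lemma killing_nondegenerate_h:
  assumes "H \<in> h" "\<And>K. K \<in> h \<Longrightarrow> \<kappa> H K = 0"
  shows "H = 0"
  using herm.definite[of H] assms cj_h by blast

text \<open>For \<open>t\<close> in \<open>h\<close> this is \<open>exp (ad t)\<close>, given by its
  eigenvalues on the weight spaces so that no series is involved.\<close>

definition torus :: "complex^'n \<Rightarrow> complex^'n \<Rightarrow> complex^'n"
  where "torus t z = (\<Sum>v\<in>W. exp (\<rho> v t) *s component v z)"

lemma torus_linear: "complex_linear (torus t)"
  by (intro complex_linearI) (auto simp: torus_def component_add component_scale
      vec.scale_right_distrib sum.distrib vec.scale_sum_right mult.commute
      simp del: sum.insert intro!: sum.cong)

lemma torus_gs:
  assumes "v \<in> span R" "z \<in> gs v"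
  shows "torus t z = exp (\<rho> v t) *s z"
proof (cases "v \<in> W")
  case True
  have "torus t z = (\<Sum>w\<in>W. if w = v then exp (\<rho> v t) *s z else 0)"
    unfolding torus_def using assms by (intro sum.cong) (auto simp: component_gs)
  also have "\<dots> = exp (\<rho> v t) *s z"
    using True finite_roots by (subst sum.delta) auto
  finally show ?thesis .
next
  case False
  then have "z = 0" using assms gs_trivial by blast
  then show ?thesis by (simp add: torus_def)
qed

lemma torus_br:
  assumes "t \<in> h"
  shows "torus t (br x y) = br (torus t x) (torus t y)"
proof (rule bracket_preserving_if_spanning[OF torus_linear weight_spaces_span])
  fix x y assume "x \<in> (\<Union>v\<in>W. gs v)" "y \<in> (\<Union>v\<in>W. gs v)"
  then obtain v w where vw: "v \<in> W" "w \<in> W" "x \<in> gs v" "y \<in> gs w" by blast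
  then have "torus t (br x y) = exp (\<rho> (v + w) t) *s br x y"
    by (intro torus_gs gs_br W_span span_add)
  moreover have "v \<in> span R" "w \<in> span R"
    using vw W_span by blast+
  ultimately show "torus t (br x y) = br (torus t x) (torus t y)"
    using vw assms by (simp add: torus_gs \<rho>_add exp_add br_simps mult.commute)
qed

end

section \<open>Root strings\<close>

context finite_root_data
begin

text \<open>The relations \<open>[H, e] = 2e\<close> and \<open>[H, f] = - 2f\<close> are implicit:
  \<open>e\<close> and \<open>f\<close> have weights \<open>a\<close> and \<open>- a\<close>, and
  \<open>\<rho> a H = 2\<close>.\<close>

definition sl2_triple :: "'v \<Rightarrow> complex^'n \<Rightarrow> complex^'n \<Rightarrow> complex^'n \<Rightarrow> bool"
  where "sl2_triple a e f H \<longleftrightarrow> a \<in> span R \<and> e \<in> gs a \<and> f \<in> gs (- a) \<and> H \<in> h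
     \<and> br e f = H \<and> \<rho> a H = 2"

lemma sl2_triple_flip: "sl2_triple a e f H \<Longrightarrow> sl2_triple (- a) f e (- H)"
  using \<rho>_arg_scale[of a H "-1"] br_anticommute[of f e]
  by (auto simp: sl2_triple_def span_neg h_closed \<rho>_minus)

lemma killing_br_cartan:
  assumes "x \<in> gs a" "H \<in> h"
  shows "\<kappa> (br x y) H = \<rho> a H * \<kappa> x y"
proof -
  have "\<kappa> (br x y) H = - \<kappa> y (br x H)"
    by (rule killing_invariant)
  also have "br x H = - (\<rho> a H *s x)"
    using assms br_anticommute[of x H] by (simp add: gs_iff)
  also have "- \<kappa> y (- (\<rho> a H *s x)) = \<rho> a H * \<kappa> x y"
    using killing_scale_right[of y "- \<rho> a H" x] killing_commute[of y x] by simp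
  finally show ?thesis .
qed

text \<open>Up to scaling, \<open>f\<close> is \<open>cj e\<close>. The element
  \<open>K = [e, cj e]\<close> satisfies \<open>cj K = - K\<close>, so \<open>\<kappa> K K\<close>
  is nonzero by definiteness, and with it \<open>\<rho> a K\<close>. For the dimension of the root
  space, let \<open>y\<close> be the part of \<open>x\<close> that is Killing-orthogonal to
  \<open>cj e\<close>. Then \<open>[y, cj e]\<close> lies in \<open>h\<close> and is orthogonal to
  \<open>h\<close>, hence zero, and \<open>[e, y]\<close> has weight \<open>2a\<close>, hence is
  zero too. So \<open>K\<close> annihilates \<open>y\<close> while acting on it by
  \<open>\<rho> a K\<close>, and \<open>y = 0\<close>.\<close>

lemma sl2_triple_exists:
  assumes a: "a \<in> R" and double: "2 *\<^sub>R a \<notin> R"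
  obtains e f H where "sl2_triple a e f H" "\<And>x. x \<in> gs a \<Longrightarrow> \<exists>c. x = c *s e"
proof -
  have sp: "a \<in> span R" and a0: "a \<noteq> 0"
    using a roots_iff by blast+
  obtain e where e: "e \<in> gs a" "e \<noteq> 0"
    using a roots_iff gs_closed(1) by blast
  define K where "K = br e (cj e)"
  have ce: "cj e \<in> gs (- a)"
    using gs_cj sp e by blast
  have K: "K \<in> h"
    using gs_br[OF sp span_neg[OF sp] e(1) ce] gs_zero by (simp add: K_def)
  have nz: "\<kappa> e (cj e) \<noteq> 0"
    using herm.definite e(2) by blast
  have \<kappa>K: "\<kappa> K H = \<rho> a H * \<kappa> e (cj e)" if "H \<in> h" for H
    unfolding K_def by (rule killing_br_cartan[OF e(1) that])
  obtain H0 where "H0 \<in> h" "\<rho> a H0 \<noteq> 0"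
    using \<rho>_separates[OF sp span_zero a0] \<rho>_zero by auto
  then have "K \<noteq> 0"
    using \<kappa>K[of H0] nz killing_scale_left[of 0 0 H0] by auto
  moreover have "cj K = - K"
    unfolding K_def cj_br using br_anticommute[of e "cj e"] by simp
  ultimately have "\<kappa> K K \<noteq> 0"
    using herm.definite[of K] killing_scale_right[of K "-1" K] by auto
  then have aK: "\<rho> a K \<noteq> 0"
    using \<kappa>K[OF K] by auto
  define c where "c = 2 / \<rho> a K"
  have "sl2_triple a e (c *s cj e) (c *s K)"
    using sp e ce K aK by (auto simp: sl2_triple_def gs_closed h_closed br_simps K_def[symmetric]
        \<rho>_arg_scale c_def)
  moreover have "\<exists>d. x = d *s e" if x: "x \<in> gs a" for x
  proof -
    define d where "d = \<kappa> x (cj e) / \<kappa> e (cj e)"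
    define y where "y = x - d *s e"
    have y: "y \<in> gs a"
      unfolding y_def using x e by (intro gs_closed)
    have "\<kappa> y (cj e) = 0"
      using nz by (simp add: y_def d_def killing_diff_left killing_scale_left)
    then have "\<kappa> (br y (cj e)) H = 0" if "H \<in> h" for H
      using killing_br_cartan[OF y that] by simp
    moreover have "br y (cj e) \<in> h"
      using gs_br[OF sp span_neg[OF sp] y ce] gs_zero by simp
    ultimately have ye: "br y (cj e) = 0"
      using killing_nondegenerate_h by blast
    have "br e y \<in> gs (a + a)" "a + a \<in> span R" "a + a \<notin> W"
      using gs_br[OF sp sp e(1) y] sp a0 double by (auto simp: span_scale simp flip: scaleR_2)
    then have ey: "br e y = 0"
      using gs_trivial by blast
    have "br K y = br e (br (cj e) y) - br (cj e) (br e y)"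
      unfolding K_def by (rule jacobi')
    also have "\<dots> = 0"
      using ye ey br_anticommute[of "cj e" y] by (simp add: br_simps)
    finally have "\<rho> a K *s y = 0"
      using y K by (simp add: gs_iff)
    then have "y = 0" using aK by simp
    then show ?thesis by (auto simp: y_def)
  qed
  ultimately show ?thesis using that by blast
qed

lemma lowering_weight:
  assumes "sl2_triple a e f H" "v \<in> span R" "x \<in> gs v"
  shows "((br f) ^^ k) x \<in> gs (v - real k *\<^sub>R a)"
proof (induction k)
  case (Suc k)
  have "br f (((br f) ^^ k) x) \<in> gs (- a + (v - real k *\<^sub>R a))"
    using assms Suc by (intro gs_br) (auto simp: sl2_triple_def span_neg span_diff span_scale)
  moreover have "- a + (v - real k *\<^sub>R a) = v - real (Suc k) *\<^sub>R a"
    by (simp add: algebra_simps)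
  ultimately show ?case
    by (simp only: funpow.simps comp_apply)
qed (simp add: assms)

text \<open>Moving \<open>e\<close> past each \<open>f\<close> adds up the weights
  \<open>\<rho> v H - 2 j\<close> for \<open>j = 0, ..., k\<close>; their sum is the product in the
  statement.\<close>

lemma raising_lowering:
  assumes tr: "sl2_triple a e f H" and v: "v \<in> span R" "x \<in> gs v" and top: "br e x = 0"
  shows "br e (((br f) ^^ Suc k) x) = (of_nat (Suc k) * (\<rho> v H - of_nat k)) *s ((br f) ^^ k) x"
proof (induction k)
  case 0
  have "br e (br f x) = br (br e f) x + br f (br e x)"
    by (simp add: jacobi')
  then show ?case
    using tr v top by (simp add: sl2_triple_def gs_iff br_simps)
next
  case (Suc k)
  let ?y = "((br f) ^^ Suc k) x"
  have "?y \<in> gs (v - real (Suc k) *\<^sub>R a)"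
    by (rule lowering_weight[OF tr v])
  moreover have "\<rho> (v - real (Suc k) *\<^sub>R a) H = \<rho> v H - 2 * of_nat (Suc k)"
    using tr v by (simp add: sl2_triple_def \<rho>_diff \<rho>_scale span_scale)
  ultimately have H: "br H ?y = (\<rho> v H - 2 * of_nat (Suc k)) *s ?y"
    using tr by (simp add: gs_iff sl2_triple_def)
  have "br e (br f ?y) = br (br e f) ?y + br f (br e ?y)"
    by (simp only: jacobi') simp
  also have "br (br e f) ?y = (\<rho> v H - 2 * of_nat (Suc k)) *s ?y"
    using tr H by (simp add: sl2_triple_def)
  also have "br f (br e ?y) = (of_nat (Suc k) * (\<rho> v H - of_nat k)) *s ?y"
    unfolding Suc.IH by (simp add: br_simps)
  also have "(\<rho> v H - 2 * of_nat (Suc k)) *s ?y + (of_nat (Suc k) * (\<rho> v H - of_nat k)) *s ?y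
      = (of_nat (Suc (Suc k)) * (\<rho> v H - of_nat (Suc k))) *s ?y"
    by (simp only: vec.scale_left_distrib[symmetric]) (simp add: algebra_simps)
  finally show ?case by simp
qed

text \<open>Let \<open>k + 1\<close> be the first power of \<open>f\<close> that annihilates
  \<open>x\<close>. The formula for \<open>e f^(k+1) x\<close> then has left side zero and a nonzero
  vector \<open>f^k x\<close> on the right, so the factor \<open>\<rho> v H - k\<close>
  vanishes.\<close>

lemma highest_weight_natural:
  assumes tr: "sl2_triple a e f H" and v: "v \<in> span R" "x \<in> gs v" "x \<noteq> 0"
    and top: "v + a \<notin> W" and bottom: "v - real (Suc N) *\<^sub>R a \<notin> W"
  obtains k where "k \<le> N" "\<rho> v H = of_nat k" "\<And>j. j \<le> k \<Longrightarrow> ((br f) ^^ j) x \<noteq> 0"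
proof -
  have a: "a \<in> span R" using tr by (simp add: sl2_triple_def)
  have "br e x \<in> gs (a + v)"
    using tr v by (intro gs_br) (auto simp: sl2_triple_def)
  then have ex: "br e x = 0"
    using gs_trivial[of "a + v"] top a v by (simp add: span_add add.commute)
  have "((br f) ^^ Suc N) x = 0"
    using lowering_weight[OF tr v(1,2), of "Suc N"] bottom a v
    by (intro gs_trivial[of "v - real (Suc N) *\<^sub>R a"]) (auto simp: span_diff span_scale)
  define j where "j = (LEAST j. ((br f) ^^ j) x = 0)"
  have j0: "((br f) ^^ j) x = 0"
    unfolding j_def by (rule LeastI) (rule \<open>((br f) ^^ Suc N) x = 0\<close>)
  have least: "((br f) ^^ i) x \<noteq> 0" if "i < j" for i
    using not_less_Least that unfolding j_def by blast
  have "j \<le> Suc N"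
    unfolding j_def by (rule Least_le) (rule \<open>((br f) ^^ Suc N) x = 0\<close>)
  obtain k where k: "j = Suc k"
    using j0 v(3) by (cases j) auto
  have "(of_nat (Suc k) * (\<rho> v H - of_nat k)) *s ((br f) ^^ k) x = 0"
    using raising_lowering[OF tr v(1,2) ex, of k] j0 k br_zero_right[of e] by simp
  moreover have "((br f) ^^ k) x \<noteq> 0"
    using least k by simp
  ultimately have "of_nat (Suc k) * (\<rho> v H - of_nat k) = 0"
    by (simp only: vec.scale_eq_0_iff) simp
  then have "\<rho> v H = of_nat k"
    by (simp only: mult_eq_0_iff of_nat_eq_0_iff) simp
  then show ?thesis
    using that[of k] least k \<open>j \<le> Suc N\<close> by auto
qed

text \<open>The weight at the top of a string is at most its length \<open>N\<close>; seen from the bottom, with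
  the roles of \<open>e\<close> and \<open>f\<close> exchanged, it is at least \<open>N\<close>.\<close>

lemma root_string:
  assumes tr: "sl2_triple a e f H" and v: "v \<in> span R" "x \<in> gs v" "x \<noteq> 0"
    and top: "v + a \<notin> W" and low: "v - real N *\<^sub>R a \<in> R" and bottom: "v - real (Suc N) *\<^sub>R a \<notin> W"
  shows "\<rho> v H = of_nat N" "k \<le> N \<Longrightarrow> ((br f) ^^ k) x \<noteq> 0"
proof -
  have a: "a \<in> span R" "H \<in> h" "\<rho> a H = 2" using tr by (simp_all add: sl2_triple_def)
  obtain m where m: "m \<le> N" "\<rho> v H = of_nat m" "\<And>j. j \<le> m \<Longrightarrow> ((br f) ^^ j) x \<noteq> 0"
    using highest_weight_natural[OF tr v top bottom] by blast
  let ?w = "v - real N *\<^sub>R a"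
  obtain y where y: "y \<in> gs ?w" "y \<noteq> 0"
    using low roots_iff[of ?w] gs_closed(1)[of ?w] by blast
  have w: "?w \<in> span R" using low by (simp add: span_base)
  have "?w + - a \<notin> W" "?w - real (Suc N) *\<^sub>R (- a) \<notin> W"
    using top bottom by (simp_all add: algebra_simps)
  then obtain l where l: "l \<le> N" "\<rho> ?w (- H) = of_nat l"
    using highest_weight_natural[OF sl2_triple_flip[OF tr] w y] by blast
  have "\<rho> ?w (- H) = - \<rho> ?w H"
    using \<rho>_arg_scale[OF w a(2), of "-1"] by simp
  also have "\<rho> ?w H = of_nat m - 2 * of_nat N"
    using a v m by (simp add: \<rho>_diff \<rho>_scale span_scale)
  finally have "(of_nat l :: complex) + of_nat m = of_nat (2 * N)"
    using l(2) by (simp add: algebra_simps)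
  then have "l + m = 2 * N"
    by (simp only: of_nat_add[symmetric] of_nat_eq_iff)
  then have "m = N" using l m by simp
  then show "\<rho> v H = of_nat N" "k \<le> N \<Longrightarrow> ((br f) ^^ k) x \<noteq> 0"
    using m by simp_all
qed

text \<open>The vector \<open>f^k x\<close> is nonzero, so it spans the one-dimensional root space
  of \<open>v - k a\<close>; being obtained from \<open>x\<close> by brackets with \<open>f\<close>,
  it lies in \<open>s\<close>.\<close>

lemma subalgebra_contains_string:
  assumes s: "complex_lie_subalgebra br s" and "gs (- a) \<subseteq> s" "gs v \<subseteq> s"
    and a: "a \<in> R" "2 *\<^sub>R a \<notin> R" and v: "v \<in> R" and top: "v + a \<notin> W"
    and low: "v - real N *\<^sub>R a \<in> R" and bottom: "v - real (Suc N) *\<^sub>R a \<notin> W"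
    and k: "k \<le> N" "v - real k *\<^sub>R a \<in> R" "2 *\<^sub>R (v - real k *\<^sub>R a) \<notin> R"
  shows "gs (v - real k *\<^sub>R a) \<subseteq> s"
proof
  fix z assume z: "z \<in> gs (v - real k *\<^sub>R a)"
  obtain e f H where tr: "sl2_triple a e f H"
    using sl2_triple_exists[OF a] by blast
  obtain x where x: "x \<in> gs v" "x \<noteq> 0"
    using v roots_iff[of v] gs_closed(1)[of v] by blast
  let ?y = "((br f) ^^ k) x"
  have y: "?y \<noteq> 0" "?y \<in> gs (v - real k *\<^sub>R a)"
    using root_string(2)[OF tr span_base[OF v] x top low bottom k(1)]
      lowering_weight[OF tr span_base[OF v] x(1)] by blast+
  obtain u where u: "\<And>x. x \<in> gs (v - real k *\<^sub>R a) \<Longrightarrow> \<exists>c. x = c *s u"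
    using sl2_triple_exists[OF k(2,3)] by blast
  obtain c d where "?y = c *s u" "z = d *s u"
    using u y z by meson
  moreover from this y have "c \<noteq> 0" by auto
  ultimately have "z = (d / c) *s ?y" by simp
  moreover have "f \<in> s"
    using tr assms(2) by (auto simp: sl2_triple_def)
  then have "((br f) ^^ j) x \<in> s" for j
    using s x assms(3) by (induction j) (auto simp: complex_lie_subalgebra_def)
  ultimately show "z \<in> s"
    using s vec.subspace_scale by (auto simp: complex_lie_subalgebra_def)
qed

end

section \<open>Bases of the root system \<open>G2\<close>\<close>

text \<open>Integer coordinates with respect to a base turn questions about sums and multiples of
  roots into checks on finitely many pairs.\<close>

definition lattice_point :: "'v::real_vector \<Rightarrow> 'v \<Rightarrow> int \<Rightarrow> int \<Rightarrow> 'v"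
  where "lattice_point a b m n = of_int m *\<^sub>R a + of_int n *\<^sub>R b"

text \<open>The second row lists the negatives of the first. The long roots are the six pairs whose
  first entry is divisible by 3.\<close>

definition G2_coords :: "(int \<times> int) set"
  where "G2_coords = {(1, 0), (0, 1), (-1, 1), (-2, 1), (-3, 1), (-3, 2),
    (-1, 0), (0, -1), (1, -1), (2, -1), (3, -1), (3, -2)}"

text \<open>The base consists of a short root \<open>a\<close> and a long root \<open>b\<close> that form an angle of 30 degrees.
  This is the position of the two common elements of the sets in the statement; the corresponding
  simple system is \<open>{a, - b}\<close>.\<close>

definition G2_base :: "'v::real_vector set \<Rightarrow> 'v \<Rightarrow> 'v \<Rightarrow> bool"
  where "G2_base R a b \<longleftrightarrow> a \<noteq> b \<and> independent {a, b} \<and> R = (\<lambda>(m, n). lattice_point a b m n) ` G2_coords"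

lemma lattice_point_add: "lattice_point a b m n + lattice_point a b m' n' = lattice_point a b (m + m') (n + n')"
  and lattice_point_diff: "lattice_point a b m n - lattice_point a b m' n' = lattice_point a b (m - m') (n - n')"
  and lattice_point_minus: "- lattice_point a b m n = lattice_point a b (- m) (- n)"
  and lattice_point_scale: "of_int k *\<^sub>R lattice_point a b m n = lattice_point a b (k * m) (k * n)"
  by (simp_all add: lattice_point_def algebra_simps)

lemma lattice_point_0_0: "lattice_point a b 0 0 = 0"
  and lattice_point_1_0: "lattice_point a b 1 0 = a"
  and lattice_point_0_1: "lattice_point a b 0 1 = b"
  by (simp_all add: lattice_point_def)

lemma lattice_point_lattice_point:
  "lattice_point (lattice_point a b p q) (lattice_point a b r s) m n
    = lattice_point a b (m * p + n * r) (m * q + n * s)"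
  by (simp add: lattice_point_def algebra_simps)

lemma combination_zero_imp:
  assumes "independent {a, b}" "a \<noteq> b" "x *\<^sub>R a + y *\<^sub>R b = 0"
  shows "x = 0" "y = 0"
proof -
  let ?u = "\<lambda>v. if v = a then x else y"
  have "(\<Sum>v\<in>{a, b}. ?u v *\<^sub>R v) = 0"
    using assms(2,3) by simp
  then have "?u v = 0" if "v \<in> {a, b}" for v
    using that by (intro independentD[OF assms(1), of "{a, b}"]) auto
  from this[of a] this[of b] show "x = 0" "y = 0" using assms(2) by auto
qed

lemma independent_pair:
  fixes a b :: "'v::real_vector"
  assumes "a \<noteq> b" "\<And>x y. x *\<^sub>R a + y *\<^sub>R b = 0 \<Longrightarrow> x = 0 \<and> y = 0"
  shows "independent {a, b}"
proof (rule independent_if_scalars_zero)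
  fix f v assume f: "(\<Sum>v\<in>{a, b}. f v *\<^sub>R v) = 0" and v: "v \<in> {a, b}"
  have "f a *\<^sub>R a + f b *\<^sub>R b = 0"
    using f assms(1) by simp
  then show "f v = 0" using assms(2) v by blast
qed simp

lemma lattice_point_eq_iff:
  assumes "independent {a, b}" "a \<noteq> b"
  shows "lattice_point a b m n = lattice_point a b m' n' \<longleftrightarrow> m = m' \<and> n = n'"
proof
  assume "lattice_point a b m n = lattice_point a b m' n'"
  then have "of_int (m - m') *\<^sub>R a + of_int (n - n') *\<^sub>R b = 0"
    using lattice_point_diff[of a b m n m' n'] by (simp add: lattice_point_def)
  from combination_zero_imp[OF assms this] show "m = m' \<and> n = n'" by simp
qed auto

lemma G2_base_in_iff:
  assumes "G2_base R a b"
  shows "lattice_point a b m n \<in> R \<longleftrightarrow> (m, n) \<in> G2_coords"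
proof -
  have "inj (\<lambda>(m, n). lattice_point a b m n)"
    using assms lattice_point_eq_iff[of a b] by (auto simp: G2_base_def inj_on_def)
  from inj_image_mem_iff[OF this, of "(m, n)" G2_coords] show ?thesis
    using assms by (simp add: G2_base_def)
qed

lemma G2_base_cases:
  assumes "G2_base R a b" "v \<in> R"
  obtains m n where "v = lattice_point a b m n" "(m, n) \<in> G2_coords"
  using assms by (auto simp: G2_base_def)

lemma G2_base_change:
  assumes base: "G2_base R a b" and det: "p * s - q * r \<noteq> 0"
    and perm: "(\<lambda>(m, n). (m * p + n * r, m * q + n * s)) ` G2_coords = G2_coords"
  shows "G2_base R (lattice_point a b p q) (lattice_point a b r s)" (is "G2_base R ?a ?b")
  unfolding G2_base_def
proof (intro conjI)
  have ab: "independent {a, b}" "a \<noteq> b" using base by (simp_all add: G2_base_def)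
  show ne: "?a \<noteq> ?b"
    using det by (auto simp: lattice_point_eq_iff[OF ab])
  show "independent {?a, ?b}"
  proof (rule independent_pair[OF ne])
    fix x y :: real assume xy: "x *\<^sub>R ?a + y *\<^sub>R ?b = 0"
    have "x *\<^sub>R ?a + y *\<^sub>R ?b = (x * of_int p + y * of_int r) *\<^sub>R a + (x * of_int q + y * of_int s) *\<^sub>R b"
      by (simp add: lattice_point_def algebra_simps)
    then have 1: "x * of_int p + y * of_int r = 0" and 2: "x * of_int q + y * of_int s = 0"
      using combination_zero_imp[OF ab] xy by metis+
    \<comment> \<open>Cramer's rule for the two coefficient equations.\<close>
    have "x * of_int (p * s - q * r) = (x * of_int p + y * of_int r) * of_int s - (x * of_int q + y * of_int s) * of_int r"
      "y * of_int (p * s - q * r) = (x * of_int q + y * of_int s) * of_int p - (x * of_int p + y * of_int r) * of_int q"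
      by (simp_all add: algebra_simps)
    then have "x * of_int (p * s - q * r) = 0" "y * of_int (p * s - q * r) = 0"
      unfolding 1 2 by simp_all
    then show "x = 0 \<and> y = 0" using det by (simp only: mult_eq_0_iff of_int_eq_0_iff) simp
  qed
  have "R = (\<lambda>(m, n). lattice_point a b m n) ` (\<lambda>(m, n). (m * p + n * r, m * q + n * s)) ` G2_coords"
    using base perm by (simp add: G2_base_def)
  also have "\<dots> = (\<lambda>(m, n). lattice_point ?a ?b m n) ` G2_coords"
    by (auto simp: image_image lattice_point_lattice_point split_def)
  finally show "R = (\<lambda>(m, n). lattice_point ?a ?b m n) ` G2_coords" .
qed

text \<open>The long roots at 30 degrees to \<open>a\<close> are \<open>b\<close> and
  \<open>3a - b\<close>; the reflection that fixes \<open>a\<close> exchanges them.\<close>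

lemma G2_base_reflect:
  assumes "G2_base R a b"
  shows "G2_base R a (3 *\<^sub>R a - b)"
proof -
  have "G2_base R (lattice_point a b 1 0) (lattice_point a b 3 (-1))"
    by (rule G2_base_change[OF assms]) (simp, auto simp: G2_coords_def)
  then show ?thesis by (simp add: lattice_point_def)
qed

text \<open>The six short roots are the images of \<open>a\<close> under rotation by multiples of 60
  degrees, and the second members of the pairs are the correspondingly rotated
  \<open>b\<close>.\<close>

lemma short_root_in_base:
  assumes base: "G2_base R a b" and "(m, n) \<in> {(1, 0), (-1, 1), (-2, 1), (-1, 0), (1, -1), (2, -1)}"
  shows "\<exists>b'. G2_base R (lattice_point a b m n) b'"
proof -
  have "G2_base R (lattice_point a b 1 0) b"
    using base by (simp add: lattice_point_1_0)
  moreover have "G2_base R (lattice_point a b (-1) 1) (lattice_point a b (-3) 2)"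
    by (rule G2_base_change[OF base]) (simp, auto simp: G2_coords_def)
  moreover have "G2_base R (lattice_point a b (-2) 1) (lattice_point a b (-3) 1)"
    by (rule G2_base_change[OF base]) (simp, auto simp: G2_coords_def)
  moreover have "G2_base R (lattice_point a b (-1) 0) (lattice_point a b 0 (-1))"
    by (rule G2_base_change[OF base]) (simp, auto simp: G2_coords_def)
  moreover have "G2_base R (lattice_point a b 1 (-1)) (lattice_point a b 3 (-2))"
    by (rule G2_base_change[OF base]) (simp, auto simp: G2_coords_def)
  moreover have "G2_base R (lattice_point a b 2 (-1)) (lattice_point a b 3 (-1))"
    by (rule G2_base_change[OF base]) (simp, auto simp: G2_coords_def)
  ultimately show ?thesis
    using assms(2) by auto
qed

section \<open>Admissible sets and the sublattices they have to escape\<close>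

lemma group_closure_lattice:
  assumes "\<And>v. v \<in> Q \<Longrightarrow> v \<in> L" "0 \<in> L" "\<And>x y. x \<in> L \<Longrightarrow> y \<in> L \<Longrightarrow> x - y \<in> L"
  shows "group_closure Q \<subseteq> L"
proof
  fix x assume "x \<in> group_closure Q"
  then show "x \<in> L"
    by (induction rule: group_closure.induct) (use assms in auto)
qed

text \<open>Long roots lie in the sublattice of points whose first coordinate is divisible by 3, and
  \<open>a\<close> does not.\<close>

lemma admissible_contains_short:
  assumes base: "G2_base R a b" and Q: "Q \<in> admissible_sets R"
  shows "\<exists>(m, n) \<in> {(1, 0), (-1, 1), (-2, 1), (-1, 0), (1, -1), (2, -1)}. lattice_point a b m n \<in> Q"
proof (rule ccontr)
  assume short: "\<not> ?thesis"
  have ab: "independent {a, b}" "a \<noteq> b" using base by (simp_all add: G2_base_def)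
  let ?L = "{lattice_point a b (3 * m) n | m n. True}"
  have "group_closure Q \<subseteq> ?L"
  proof (rule group_closure_lattice)
    fix v assume v: "v \<in> Q"
    then have "v \<in> R" using Q by (auto simp: admissible_sets_def)
    then obtain m n where mn: "v = lattice_point a b m n" "(m, n) \<in> G2_coords"
      by (rule G2_base_cases[OF base])
    then have "3 dvd m"
      using short v by (auto simp: G2_coords_def)
    then show "v \<in> ?L" using mn by (auto elim!: dvdE)
  next
    show "0 \<in> ?L"
      by (intro CollectI exI[of _ 0]) (simp add: lattice_point_0_0)
    fix x y assume "x \<in> ?L" "y \<in> ?L"
    then show "x - y \<in> ?L"
      by (clarsimp simp: lattice_point_diff) (metis right_diff_distrib)
  qed
  moreover have "lattice_point a b 1 0 \<in> R"
    unfolding G2_base_in_iff[OF base] by (simp add: G2_coords_def)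
  ultimately have "lattice_point a b 1 0 \<in> ?L"
    using Q by (auto simp: admissible_sets_def)
  then obtain m :: int where "1 = 3 * m"
    by (auto simp: lattice_point_eq_iff[OF ab])
  then show False by presburger
qed

text \<open>Fix a short root \<open>a\<close> of \<open>Q\<close>. The sum condition against
  \<open>a\<close> leaves five candidates, generation forces \<open>b\<close> or
  \<open>3a - b\<close> among them, and the sum conditions between the others allow at most one
  further root. The reflection fixing \<open>a\<close> reduces the case of \<open>b\<close> outside
  \<open>Q\<close> to the same normal form.\<close>

lemma admissible_shape:
  assumes base0: "G2_base R a0 b0" and Q: "Q \<in> admissible_sets R"
  obtains a b where "G2_base R a b" "Q = {a, b} \<or> Q = {a, b, 3 *\<^sub>R a - b} \<or> Q = {a, b, 2 *\<^sub>R b - 3 *\<^sub>R a}"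
proof -
  obtain a b where base: "G2_base R a b" and aQ: "a \<in> Q"
    using admissible_contains_short[OF assms] short_root_in_base[OF base0] by blast
  have ab: "independent {a, b}" "a \<noteq> b" using base by (simp_all add: G2_base_def)
  let ?p = "lattice_point a b"
  have QR: "Q \<subseteq> R" and neg: "v \<in> Q \<Longrightarrow> - v \<notin> Q" and sum: "v \<in> Q \<Longrightarrow> w \<in> Q \<Longrightarrow> v + w \<notin> R"
    and gen: "R \<subseteq> group_closure Q" for v w
    using Q by (auto simp: admissible_sets_def)
  \<comment> \<open>Adding \<open>(0, 0)\<close> to the forbidden sums merges the two conditions
    that \<open>Q\<close> contains no opposite roots and no two roots whose sum is a root.\<close>
  have sum': "?p m n \<in> Q \<Longrightarrow> ?p m' n' \<in> Q \<Longrightarrow> (m + m', n + n') \<notin> insert (0, 0) G2_coords" for m n m' n'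
    using sum[of "?p m n" "?p m' n'"] neg[of "?p m n"]
    by (auto simp: lattice_point_add G2_base_in_iff[OF base] lattice_point_minus lattice_point_eq_iff[OF ab]
      add_eq_0_iff)
  have aQ': "?p 1 0 \<in> Q" using aQ by (simp add: lattice_point_1_0)
  have cases: "\<exists>m n. v = ?p m n \<and> (m, n) \<in> {(1, 0), (0, 1), (3, -1), (-3, 2), (3, -2)}" if v: "v \<in> Q" for v
  proof -
    obtain m n where mn: "v = ?p m n" "(m, n) \<in> G2_coords"
      using G2_base_cases[OF base] v QR by blast
    then have "(m + 1, n) \<notin> insert (0, 0) G2_coords"
      using sum'[of m n 1 0] aQ' v by simp
    then have "(m, n) \<in> {(1, 0), (0, 1), (3, -1), (-3, 2), (3, -2)}"
      using mn(2) unfolding G2_coords_def by (elim insertE) simp_all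
    then show ?thesis using mn by blast
  qed
  have sub: "Q \<subseteq> {?p 1 0, ?p 0 1, ?p 3 (-1), ?p (-3) 2, ?p 3 (-2)}"
    using cases by blast
  have long: "?p 0 1 \<in> Q \<or> ?p 3 (-1) \<in> Q"
  proof (rule ccontr)
    assume no: "\<not> ?thesis"
    \<comment> \<open>Of the five candidates only \<open>b\<close> and \<open>3a - b\<close> have
      odd second coordinate; without them \<open>Q\<close> would generate no more than this lattice,
      which misses \<open>b\<close>.\<close>
    let ?L = "{?p m (2 * n) | m n. True}"
    have "group_closure Q \<subseteq> ?L"
    proof (rule group_closure_lattice)
      fix v assume v: "v \<in> Q"
      then obtain m n where mn: "v = ?p m n" "(m, n) \<in> {(1, 0), (0, 1), (3, -1), (-3, 2), (3, -2)}"
        using cases by blast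
      then have "2 dvd n" using no v by auto
      then show "v \<in> ?L" using mn by (auto elim!: dvdE)
    next
      show "0 \<in> ?L"
        by (intro CollectI exI[of _ 0]) (simp add: lattice_point_0_0)
      fix x y assume "x \<in> ?L" "y \<in> ?L"
      then show "x - y \<in> ?L"
        by (clarsimp simp: lattice_point_diff) (metis right_diff_distrib)
    qed
    moreover have "?p 0 1 \<in> R"
      unfolding G2_base_in_iff[OF base] by (simp add: G2_coords_def)
    ultimately have "?p 0 1 \<in> ?L" using gen by blast
    then obtain n :: int where "1 = 2 * n"
      by (auto simp: lattice_point_eq_iff[OF ab])
    then show False by presburger
  qed
  have pt: "?p 1 0 = a" "?p 0 1 = b" "?p 3 (-1) = 3 *\<^sub>R a - b" "?p (-3) 2 = 2 *\<^sub>R b - 3 *\<^sub>R a"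
    "?p 3 (-2) = 2 *\<^sub>R (3 *\<^sub>R a - b) - 3 *\<^sub>R a"
    by (simp_all add: lattice_point_def algebra_simps flip: scaleR_add_left)
  \<comment> \<open>The two sums are the roots \<open>3a - b\<close> and \<open>b\<close>.\<close>
  have excl: "\<not> (?p 0 1 \<in> Q \<and> ?p 3 (-2) \<in> Q)" "\<not> (?p 3 (-1) \<in> Q \<and> ?p (-3) 2 \<in> Q)"
    using sum'[of 0 1 3 "-2"] sum'[of 3 "-1" "-3" 2] by (auto simp: G2_coords_def)
  show ?thesis
  proof (cases "b \<in> Q")
    case True
    then have "Q = {a, b} \<or> Q = {a, b, 3 *\<^sub>R a - b} \<or> Q = {a, b, 2 *\<^sub>R b - 3 *\<^sub>R a}"
      using sub excl aQ unfolding pt by blast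
    then show ?thesis using that base by blast
  next
    case False
    let ?b = "3 *\<^sub>R a - b"
    have "Q = {a, ?b} \<or> Q = {a, ?b, 2 *\<^sub>R ?b - 3 *\<^sub>R a}"
      using False sub excl aQ long unfolding pt by blast
    then show ?thesis using that[of a ?b] G2_base_reflect[OF base] by blast
  qed
qed

lemma admissible_if_base:
  assumes base: "G2_base R a b"
  shows "{a, b} \<in> admissible_sets R" "{a, b, 3 *\<^sub>R a - b} \<in> admissible_sets R"
    "{a, b, 2 *\<^sub>R b - 3 *\<^sub>R a} \<in> admissible_sets R"
proof -
  have ab: "independent {a, b}" "a \<noteq> b" using base by (simp_all add: G2_base_def)
  let ?p = "lattice_point a b"
  have pt: "a = ?p 1 0" "b = ?p 0 1" "3 *\<^sub>R a - b = ?p 3 (-1)" "2 *\<^sub>R b - 3 *\<^sub>R a = ?p (-3) 2"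
    by (simp_all add: lattice_point_def algebra_simps)
  have closure: "?p m n \<in> group_closure Q" if Q: "{a, b} \<subseteq> Q" for m n Q
  proof -
    have mult: "of_int k *\<^sub>R v \<in> group_closure Q" if v: "v \<in> Q" for v k
    proof (induction k rule: int_induct[where k = 0])
      case base
      then show ?case by simp
    next
      case (step1 i)
      then show ?case
        using group_closure_add[OF step1(2) group_closure.base[of v]] v by (simp add: algebra_simps)
    next
      case (step2 i)
      then show ?case
        using group_closure.diff[OF step2(2) group_closure.base[of v]] v by (simp add: algebra_simps)
    qed
    show ?thesis
      unfolding lattice_point_def using Q by (intro group_closure_add mult) auto
  qed
  have gen: "R \<subseteq> group_closure Q" if "{a, b} \<subseteq> Q" for Q
    using closure[OF that] G2_base_cases[OF base] by blast
  \<comment> \<open>Opposites and sums concern coordinates only, so each of the three sets is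
    checked on its list \<open>C\<close> of pairs.\<close>
  have adm: "Q \<in> admissible_sets R"
    if abQ: "{a, b} \<subseteq> Q" and Q: "Q = (\<lambda>(m, n). ?p m n) ` C" "C \<subseteq> G2_coords"
      and C: "\<forall>(m, n)\<in>C. (- m, - n) \<notin> C \<and> (\<forall>(m', n')\<in>C. (m + m', n + n') \<notin> G2_coords)"
    for Q C
  proof -
    have inj: "inj (\<lambda>(m, n). ?p m n)"
      using lattice_point_eq_iff[OF ab] by (auto simp: inj_on_def)
    have in_Q: "?p m n \<in> Q \<longleftrightarrow> (m, n) \<in> C" for m n
      using inj_image_mem_iff[OF inj, of "(m, n)" C] Q(1) by simp
    show ?thesis
      unfolding admissible_sets_def
    proof (intro CollectI conjI ballI)
      show "Q \<subseteq> R" using Q base by (auto simp: G2_base_def)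
      show "R \<subseteq> group_closure Q" using gen abQ by blast
      fix v assume v: "v \<in> Q"
      then obtain m n where mn: "v = ?p m n" "(m, n) \<in> C" using Q(1) by auto
      then show "- v \<notin> Q" using C by (auto simp: lattice_point_minus in_Q)
      fix w assume "w \<in> Q"
      then obtain m' n' where "w = ?p m' n'" "(m', n') \<in> C" using Q(1) by auto
      then show "v + w \<notin> R" using mn C by (auto simp: lattice_point_add G2_base_in_iff[OF base])
    qed
  qed
  show "{a, b} \<in> admissible_sets R"
    by (rule adm[of _ "{(1, 0), (0, 1)}"]) (auto simp: G2_coords_def lattice_point_1_0 lattice_point_0_1)
  show "{a, b, 3 *\<^sub>R a - b} \<in> admissible_sets R"
    by (rule adm[of _ "{(1, 0), (0, 1), (3, -1)}"])
      (auto simp: G2_coords_def lattice_point_1_0 lattice_point_0_1 pt(3))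
  show "{a, b, 2 *\<^sub>R b - 3 *\<^sub>R a} \<in> admissible_sets R"
    by (rule adm[of _ "{(1, 0), (0, 1), (-3, 2)}"])
      (auto simp: G2_coords_def lattice_point_1_0 lattice_point_0_1 pt(4))
qed

text \<open>The linear map that carries one base to the other preserves coordinates, and
  \<open>R\<close> has the coordinates \<open>G2_coords\<close> in every base; hence
  \<open>R\<close> goes onto itself.\<close>

lemma base_automorphism:
  assumes base: "G2_base R a b" and base': "G2_base R a' b'"
  obtains f where "root_automorphism R f" "f a = a'" "f b = b'" "linear f"
proof -
  have ab: "independent {a, b}" "a \<noteq> b" "independent {a', b'}" "a' \<noteq> b'"
    using base base' by (simp_all add: G2_base_def)
  obtain f where f: "linear f" "f a = a'" "f b = b'"
    using linear_independent_extend[OF ab(1), of "\<lambda>v. if v = a then a' else b'"] ab(2) by auto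
  have fp: "f (lattice_point a b m n) = lattice_point a' b' m n" for m n
    using f by (simp add: lattice_point_def linear_add linear_scale)
  have "f ` R = R"
  proof -
    have "f ` R = f ` (\<lambda>(m, n). lattice_point a b m n) ` G2_coords"
      using base by (simp add: G2_base_def)
    also have "\<dots> = (\<lambda>(m, n). lattice_point a' b' m n) ` G2_coords"
      by (simp add: image_image split_def fp)
    also have "\<dots> = R" using base' by (simp add: G2_base_def)
    finally show ?thesis .
  qed
  moreover have "inj_on f (span R)"
  proof -
    have "R \<subseteq> span {a, b}"
    proof
      fix v assume "v \<in> R"
      then obtain m n where "v = lattice_point a b m n" by (rule G2_base_cases[OF base])
      then show "v \<in> span {a, b}"
        by (simp add: lattice_point_def span_add span_scale span_base)
    qed
    then have "span R \<subseteq> span {a, b}" by (intro span_minimal subspace_span)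
    moreover have "inj_on f (span {a, b})"
      using f ab by (intro linear_inj_on_span_independent_image) (auto simp: inj_on_def)
    ultimately show ?thesis by (rule inj_on_subset[rotated])
  qed
  ultimately have "root_automorphism R f"
    using f(1) by (simp add: root_automorphism_def)
  then show ?thesis using that f by blast
qed

lemma isomorphic_if_bases:
  assumes "G2_base R a b" "G2_base R a' b'"
  shows "isomorphic_subsets R {a, b} {a', b'}"
    "isomorphic_subsets R {a, b, 3 *\<^sub>R a - b} {a', b', 3 *\<^sub>R a' - b'}"
    "isomorphic_subsets R {a, b, 2 *\<^sub>R b - 3 *\<^sub>R a} {a', b', 2 *\<^sub>R b' - 3 *\<^sub>R a'}"
proof -
  obtain f where f: "root_automorphism R f" "f a = a'" "f b = b'" "linear f"
    using base_automorphism[OF assms] .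
  show "isomorphic_subsets R {a, b} {a', b'}"
    "isomorphic_subsets R {a, b, 3 *\<^sub>R a - b} {a', b', 3 *\<^sub>R a' - b'}"
    "isomorphic_subsets R {a, b, 2 *\<^sub>R b - 3 *\<^sub>R a} {a', b', 2 *\<^sub>R b' - 3 *\<^sub>R a'}"
    unfolding isomorphic_subsets_def
    by (intro exI[of _ f] conjI; simp add: f linear_diff[OF f(4)] linear_scale[OF f(4)])+
qed

section \<open>The realization in three-dimensional space\<close>

lemma G2_standard_base: "G2_base G2 (ee 1 - ee 3) (2 *\<^sub>R ee 1 - ee 2 - ee 3)" (is "G2_base _ ?a ?b")
proof -
  have ne: "?a \<noteq> ?b"
    by (simp add: vec_eq_iff forall_3 axis_def)
  have ind: "independent {?a, ?b}"
    by (rule independent_pair[OF ne]) (simp add: vec_eq_iff forall_3 axis_def)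
  let ?S = "(\<lambda>(m, n). lattice_point ?a ?b m n) ` G2_coords"
  have S: "x \<in> ?S \<longleftrightarrow> (\<exists>(m, n)\<in>G2_coords. x = lattice_point ?a ?b m n)" for x by auto
  have "G2 \<subseteq> ?S"
  proof
    fix x assume "x \<in> G2"
    then consider i j where "x = ee i - ee j" "i \<noteq> j"
      | i j k where "x = 2 *\<^sub>R ee i - ee j - ee k" "i \<noteq> j" "j \<noteq> k" "i \<noteq> k"
      | i j k where "x = - (2 *\<^sub>R ee i - ee j - ee k)" "i \<noteq> j" "j \<noteq> k" "i \<noteq> k"
      by (auto simp: G2_def)
    then show "x \<in> ?S"
      unfolding S
    proof cases
      case 1
      then show "\<exists>(m, n)\<in>G2_coords. x = lattice_point ?a ?b m n"
        using exhaust_3[of i] exhaust_3[of j]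
        by (auto simp: G2_coords_def lattice_point_def vec_eq_iff forall_3 axis_def)
    next
      case 2
      then show "\<exists>(m, n)\<in>G2_coords. x = lattice_point ?a ?b m n"
        using exhaust_3[of i] exhaust_3[of j] exhaust_3[of k]
        by (auto simp: G2_coords_def lattice_point_def vec_eq_iff forall_3 axis_def)
    next
      case 3
      then show "\<exists>(m, n)\<in>G2_coords. x = lattice_point ?a ?b m n"
        using exhaust_3[of i] exhaust_3[of j] exhaust_3[of k]
        by (auto simp: G2_coords_def lattice_point_def vec_eq_iff forall_3 axis_def)
    qed
  qed
  moreover have "?S \<subseteq> G2"
  proof -
    have short: "ee i - ee j \<in> G2" if "i \<noteq> j" for i j
      using that by (auto simp: G2_def)
    have long: "2 *\<^sub>R ee i - ee j - ee k \<in> G2" "ee j + ee k - 2 *\<^sub>R ee i \<in> G2"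
      if "i \<noteq> j" "j \<noteq> k" "i \<noteq> k" for i j k
    proof -
      show "2 *\<^sub>R ee i - ee j - ee k \<in> G2"
        unfolding G2_def using that by (intro UnI2 CollectI exI[of _ 1] exI[of _ i] exI[of _ j] exI[of _ k]) simp
      show "ee j + ee k - 2 *\<^sub>R ee i \<in> G2"
        unfolding G2_def using that by (intro UnI2 CollectI exI[of _ "-1"] exI[of _ i] exI[of _ j] exI[of _ k]) simp
    qed
    have points:
      "lattice_point ?a ?b 1 0 = ee 1 - ee 3"
      "lattice_point ?a ?b 0 1 = 2 *\<^sub>R ee 1 - ee 2 - ee 3"
      "lattice_point ?a ?b (-1) 1 = ee 1 - ee 2"
      "lattice_point ?a ?b (-2) 1 = ee 3 - ee 2"
      "lattice_point ?a ?b (-3) 1 = 2 *\<^sub>R ee 3 - ee 1 - ee 2"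
      "lattice_point ?a ?b (-3) 2 = ee 1 + ee 3 - 2 *\<^sub>R ee 2"
      "lattice_point ?a ?b (-1) 0 = ee 3 - ee 1"
      "lattice_point ?a ?b 0 (-1) = ee 2 + ee 3 - 2 *\<^sub>R ee 1"
      "lattice_point ?a ?b 1 (-1) = ee 2 - ee 1"
      "lattice_point ?a ?b 2 (-1) = ee 2 - ee 3"
      "lattice_point ?a ?b 3 (-1) = ee 1 + ee 2 - 2 *\<^sub>R ee 3"
      "lattice_point ?a ?b 3 (-2) = 2 *\<^sub>R ee 2 - ee 1 - ee 3"
      by (simp_all add: lattice_point_def vec_eq_iff forall_3 axis_def)
    show ?thesis
      unfolding G2_coords_def by (simp add: points short long)
  qed
  ultimately show ?thesis
    unfolding G2_base_def using ne ind by blast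
qed

lemma maximal_admissible_shape:
  assumes base0: "G2_base R a0 b0" and Q: "maximal_admissible R Q"
  obtains a b where "G2_base R a b" "Q = {a, b, 3 *\<^sub>R a - b} \<or> Q = {a, b, 2 *\<^sub>R b - 3 *\<^sub>R a}"
proof -
  have adm: "Q \<in> admissible_sets R" and max: "\<And>Q'. Q' \<in> admissible_sets R \<Longrightarrow> Q \<subseteq> Q' \<Longrightarrow> Q' = Q"
    using Q by (auto simp: maximal_admissible_def)
  obtain a b where ab: "G2_base R a b"
    "Q = {a, b} \<or> Q = {a, b, 3 *\<^sub>R a - b} \<or> Q = {a, b, 2 *\<^sub>R b - 3 *\<^sub>R a}"
    using admissible_shape[OF base0 adm] .
  \<comment> \<open>If \<open>Q = {a, b}\<close>, maximality itself yields
    \<open>Q = {a, b, 3a - b}\<close>, so this case already has one of the listed forms.\<close>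
  then show ?thesis
    using that[OF ab(1)] max[OF admissible_if_base(2)[OF ab(1)]] by auto
qed

section \<open>Homogeneous CR structures\<close>

context compact_lie
begin

lemma cj_commute_if_real:
  assumes f: "complex_linear f" and real: "\<And>x. x \<in> u0 \<Longrightarrow> f x \<in> u0"
  shows "cj (f z) = f (cj z)"
proof -
  have "f z = f (re z) + \<i> *s f (im z)"
    using f by (metis re_im vec.linear_add vec.linear_scale)
  then have "cj (f z) = f (re z) - \<i> *s f (im z)"
    using cj_eq real by simp
  also have "\<dots> = f (cj z)"
    using f by (simp add: conj_form_def vec.linear_diff vec.linear_scale)
  finally show ?thesis .
qed

lemma real_if_cj_commute:
  assumes "\<And>z. cj (f z) = f (cj z)" "x \<in> u0"
  shows "f x \<in> u0"
  using assms by (metis u0_iff_cj)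

end

context finite_root_data
begin

abbreviation "q \<equiv> q_of br t0 \<rho>"

lemma q_iff:
  assumes Q: "Q \<subseteq> R"
  shows "z \<in> q Q \<longleftrightarrow> (\<forall>v\<in>R - Q. component v z = 0)"
proof
  assume "z \<in> q Q"
  then obtain x y where xy: "z = x + (\<Sum>\<alpha>\<in>Q. y \<alpha>)" "x \<in> h" "\<And>\<alpha>. \<alpha> \<in> Q \<Longrightarrow> y \<alpha> \<in> gs \<alpha>"
    by (auto simp: q_of_def)
  show "\<forall>v\<in>R - Q. component v z = 0"
  proof
    fix v assume v: "v \<in> R - Q"
    then have "v \<noteq> 0" using roots_iff by blast
    then have "component v x = 0"
      using component_gs[of 0 x v] xy(2) gs_zero span_zero by auto
    moreover have "component v (y \<alpha>) = 0" if "\<alpha> \<in> Q" for \<alpha>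
      using component_gs[of \<alpha> "y \<alpha>" v] xy(3)[OF that] that v Q by (auto simp: span_base)
    ultimately show "component v z = 0"
      by (simp add: xy(1) component_add component_sum_arg)
  qed
next
  assume 0: "\<forall>v\<in>R - Q. component v z = 0"
  have "0 \<notin> R" using roots_iff by blast
  then have "z = component 0 z + (\<Sum>v\<in>R. component v z)"
    using component_sum[of z] finite_roots by simp
  also have "(\<Sum>v\<in>R. component v z) = (\<Sum>v\<in>Q. component v z)"
    by (rule sum.mono_neutral_right) (use finite_roots Q 0 in auto)
  finally show "z \<in> q Q"
    unfolding q_of_def using component_in[of 0 z] component_in gs_zero by blast
qed

lemma q_subspace:
  assumes "Q \<subseteq> R"
  shows "vec.subspace (q Q)"
  by (intro vec.subspaceI) (auto simp: q_iff[OF assms] component_add component_scale)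

lemma h_subset_q:
  assumes "Q \<subseteq> R" "z \<in> h"
  shows "z \<in> q Q"
proof -
  have "0 \<notin> R" using roots_iff by blast
  then show ?thesis
    using component_gs[OF span_zero, of z] assms gs_zero by (auto simp: q_iff)
qed

lemma gs_subset_q: "Q \<subseteq> R \<Longrightarrow> v \<in> Q \<Longrightarrow> z \<in> gs v \<Longrightarrow> z \<in> q Q"
  using component_gs[of v z] by (auto simp: q_iff span_base)

lemma q_induct:
  assumes "Q \<subseteq> R" "z \<in> q Q" and P: "vec.subspace P"
    and "\<And>z. z \<in> h \<Longrightarrow> z \<in> P" "\<And>v z. v \<in> Q \<Longrightarrow> z \<in> gs v \<Longrightarrow> z \<in> P"
  shows "z \<in> P"
proof -
  obtain x y where "z = x + (\<Sum>\<alpha>\<in>Q. y \<alpha>)" "x \<in> h" "\<And>\<alpha>. \<alpha> \<in> Q \<Longrightarrow> y \<alpha> \<in> gs \<alpha>"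
    using assms(2) by (auto simp: q_of_def)
  then show ?thesis
    using assms(4,5) by (auto intro!: vec.subspace_add[OF P] vec.subspace_sum[OF P])
qed

lemma component_cj: "component v (cj z) = cj (component (- v) z)"
proof -
  have "z \<in> {z. component v (cj z) = cj (component (- v) z)}"
  proof (rule weight_induct)
    show "vec.subspace {z. component v (cj z) = cj (component (- v) z)}"
      by (intro vec.subspaceI) (auto simp: cj_add cj_scale component_add component_scale)
    fix w assume "w \<in> W"
    then have w: "w \<in> span R" by (rule W_span)
    show "gs w \<subseteq> {z. component v (cj z) = cj (component (- v) z)}"
    proof
      fix z assume z: "z \<in> gs w"
      have "component v (cj z) = (if v = - w then cj z else 0)"
        using w z by (intro component_gs gs_cj span_neg)
      moreover have "component (- v) z = (if - v = w then z else 0)"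
        using w z by (rule component_gs)
      ultimately show "z \<in> {z. component v (cj z) = cj (component (- v) z)}"
        by (auto simp: minus_equation_iff)
    qed
  qed
  then show ?thesis by simp
qed

text \<open>Elements of \<open>t0\<close> take imaginary values on roots, so conjugating
  \<open>exp (\<rho> v t)\<close> gives the eigenvalue for \<open>- v\<close>, the weight of
  \<open>cj z\<close>.\<close>

lemma torus_cj:
  assumes t: "t \<in> t0"
  shows "cj (torus t z) = torus t (cj z)"
proof -
  have "z \<in> {z. cj (torus t z) = torus t (cj z)}"
  proof (rule weight_induct)
    show "vec.subspace {z. cj (torus t z) = torus t (cj z)}"
      using torus_linear[of t]
      by (intro vec.subspaceI) (auto simp: cj_add cj_scale vec.linear_add vec.linear_scale vec.linear_0)
    fix v assume "v \<in> W"
    then have v: "v \<in> span R" by (rule W_span)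
    show "gs v \<subseteq> {z. cj (torus t z) = torus t (cj z)}"
    proof
      fix z assume z: "z \<in> gs v"
      have "cj (torus t z) = exp (- \<rho> v t) *s cj z"
        using v z t by (simp add: torus_gs cj_scale exp_cnj \<rho>_imaginary)
      also have "\<dots> = torus t (cj z)"
        using torus_gs[OF span_neg[OF v] gs_cj[OF v z]] v t by (simp add: \<rho>_minus t0_h)
      finally show "z \<in> {z. cj (torus t z) = torus t (cj z)}" by simp
    qed
  qed
  then show ?thesis by simp
qed

text \<open>The roots occurring in the conjugate of \<open>q\<close> are the negatives of those in
  \<open>Q\<close>, and \<open>Q\<close> contains no opposite pair.\<close>

lemma q_Int_conj_q:
  assumes Q: "Q \<subseteq> R" and asym: "\<forall>v\<in>Q. - v \<notin> Q"
  shows "q Q \<inter> cj ` q Q = h"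
proof
  show "q Q \<inter> cj ` q Q \<subseteq> h"
  proof
    fix z assume "z \<in> q Q \<inter> cj ` q Q"
    then obtain w where w: "z \<in> q Q" "z = cj w" "w \<in> q Q" by blast
    have "component v z = 0" if v: "v \<in> R" for v
    proof (cases "v \<in> Q")
      case True
      then have "component (- v) w = 0"
        using w(3) asym component_outside[of "- v" w] roots_iff v
        by (cases "- v \<in> R") (auto simp: q_iff[OF Q])
      then show ?thesis by (simp add: w(2) component_cj)
    next
      case False
      then show ?thesis using w(1) v by (auto simp: q_iff[OF Q])
    qed
    then have "z \<in> q {}"
      by (simp add: q_iff)
    then show "z \<in> h"
      by (auto simp: q_of_def)
  qed
  show "h \<subseteq> q Q \<inter> cj ` q Q"
  proof
    fix z assume z: "z \<in> h"
    then have "z = cj (cj z)" "cj z \<in> q Q" "z \<in> q Q"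
      using h_subset_q[OF Q] cj_h by auto
    then show "z \<in> q Q \<inter> cj ` q Q" by blast
  qed
qed

text \<open>The condition on real parts amounts to the eigenvalue \<open>- \<i>\<close> on the root spaces in \<open>q\<close>, that is,
  \<open>\<i>\<close> on their conjugates; this lemma and the next ones are the two directions.\<close>

lemma complex_structure_if_eigenvalue:
  assumes Q: "Q \<subseteq> R" and M: "complex_linear M" "\<And>z. cj (M z) = M (cj z)"
    and "\<And>H. H \<in> h \<Longrightarrow> M H \<in> h" and eig: "\<And>v z. v \<in> Q \<Longrightarrow> z \<in> gs v \<Longrightarrow> M z = - \<i> *s z"
    and x: "x \<in> re ` q Q"
  shows "x + \<i> *s M x \<in> q Q"
proof -
  note lin = vec.linear_add[OF M(1)] vec.linear_scale[OF M(1)] vec.linear_0[OF M(1)]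
  note sub = q_subspace[OF Q]
  note q_closed = vec.subspace_0[OF sub] vec.subspace_add[OF sub] vec.subspace_scale[OF sub]
  obtain z where z: "z \<in> q Q" "x = re z" using x by blast
  have 1: "z \<in> {z. z + \<i> *s M z \<in> q Q}"
  proof (rule q_induct[OF Q z(1)])
    have "x + y + \<i> *s M (x + y) = (x + \<i> *s M x) + (y + \<i> *s M y)"
      "c *s x + \<i> *s M (c *s x) = c *s (x + \<i> *s M x)" for x y c
      by (simp_all add: lin vec.scale_right_distrib mult.commute)
    note eq = this
    show "vec.subspace {z. z + \<i> *s M z \<in> q Q}"
    proof (rule vec.subspaceI)
      show "0 \<in> {z. z + \<i> *s M z \<in> q Q}"
        by (simp add: lin q_closed)
    qed (simp_all only: mem_Collect_eq eq q_closed)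
    show "z \<in> {z. z + \<i> *s M z \<in> q Q}" if "z \<in> h" for z
      using assms(4)[OF that] that by (auto intro!: h_subset_q Q h_closed)
    show "z \<in> {z. z + \<i> *s M z \<in> q Q}" if "v \<in> Q" "z \<in> gs v" for v z
    proof -
      have "M z \<in> gs v"
        unfolding eig[OF that] by (rule gs_closed(4)[OF that(2)])
      then show ?thesis
        using that by (auto intro!: gs_subset_q[OF Q that(1)] gs_closed)
    qed
  qed
  \<comment> \<open>For \<open>z\<close> in a root space of \<open>Q\<close> this expression is
    zero, since \<open>M\<close> acts by \<open>\<i>\<close> on \<open>cj z\<close>, while the
    preceding one is \<open>2z\<close>. Their average is the claim for \<open>re z\<close>.\<close>
  have 2: "z \<in> {z. cj z + \<i> *s M (cj z) \<in> q Q}"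
  proof (rule q_induct[OF Q z(1)])
    have "cj (x + y) + \<i> *s M (cj (x + y)) = (cj x + \<i> *s M (cj x)) + (cj y + \<i> *s M (cj y))"
      "cj (c *s x) + \<i> *s M (cj (c *s x)) = cnj c *s (cj x + \<i> *s M (cj x))" for x y c
      by (simp_all add: lin cj_add cj_scale vec.scale_right_distrib mult.commute)
    note eq = this
    show "vec.subspace {z. cj z + \<i> *s M (cj z) \<in> q Q}"
    proof (rule vec.subspaceI)
      show "0 \<in> {z. cj z + \<i> *s M (cj z) \<in> q Q}"
        by (simp add: lin q_closed)
    qed (simp_all only: mem_Collect_eq eq q_closed)
    show "z \<in> {z. cj z + \<i> *s M (cj z) \<in> q Q}" if "z \<in> h" for z
      using assms(4) cj_h[OF that] by (auto intro!: h_subset_q Q h_closed)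
    show "z \<in> {z. cj z + \<i> *s M (cj z) \<in> q Q}" if "v \<in> Q" "z \<in> gs v" for v z
    proof -
      have "M (cj z) = \<i> *s cj z"
        using eig[OF that] M(2)[of z] by (simp add: cj_scale cj_minus)
      then show ?thesis by (simp add: q_closed)
    qed
  qed
  have "x + \<i> *s M x = (1/2) *s ((z + \<i> *s M z) + (cj z + \<i> *s M (cj z)))"
    unfolding z(2) re_eq_cj by (simp add: lin vec.scale_right_distrib)
  also have "\<dots> \<in> q Q"
    using 1 2 by (simp only: mem_Collect_eq q_closed)
  finally show ?thesis .
qed

lemma conj_root_space_if_complex_structure:
  assumes Q: "Q \<subseteq> R" and M: "complex_linear M"
    and J: "\<And>x. x \<in> re ` q Q \<Longrightarrow> x + \<i> *s M x \<in> q Q"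
    and v: "v \<in> Q" "z \<in> gs (- v)"
  shows "z + \<i> *s M z \<in> q Q"
proof -
  note lin = vec.linear_add[OF M] vec.linear_diff[OF M] vec.linear_scale[OF M]
  note sub = q_subspace[OF Q]
  have cz: "cj z \<in> gs v"
    using gs_cj[of "- v" z] v Q by (auto simp: span_neg span_base)
  \<comment> \<open>The hypothesis concerns real parts only. The combination
    \<open>X - \<i> Y\<close> of the real parts of \<open>cj z\<close> and
    \<open>- \<i> cj z\<close> recovers \<open>z\<close>, so complex linearity carries the condition
    over to \<open>z\<close>.\<close>
  let ?X = "re (cj z)" and ?Y = "re (- \<i> *s cj z)"
  have "cj z \<in> q Q" "- \<i> *s cj z \<in> q Q"
    using cz v by (auto intro!: gs_subset_q[OF Q] gs_closed)
  then have in_q: "?X + \<i> *s M ?X \<in> q Q" "?Y + \<i> *s M ?Y \<in> q Q"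
    using J by blast+
  have "?X - \<i> *s ?Y = (1/2 + 1/2) *s z"
    unfolding re_eq_cj vec.scale_left_distrib
    by (simp add: cj_scale cj_minus vec.scale_right_distrib vec.scale_right_diff_distrib)
  then have z: "z = ?X - \<i> *s ?Y" by simp
  have "z + \<i> *s M z = (?X + \<i> *s M ?X) - \<i> *s (?Y + \<i> *s M ?Y)"
    by (subst (1 2) z) (simp add: lin vec.scale_right_distrib vec.scale_right_diff_distrib)
  then show ?thesis
    using in_q by (simp only: vec.subspace_diff[OF sub] vec.subspace_scale[OF sub])
qed

text \<open>\<open>M\<close> is not yet known to preserve weight spaces, so one component of
  \<open>M z\<close> is all that can be computed: as \<open>- v\<close> is not in \<open>Q\<close>,
  the component of \<open>z + \<i> M z\<close> at \<open>- v\<close> vanishes.\<close>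

lemma conj_component_if_complex_structure:
  assumes Q: "Q \<subseteq> R" and asym: "\<forall>v\<in>Q. - v \<notin> Q" and M: "complex_linear M"
    and J: "\<And>x. x \<in> re ` q Q \<Longrightarrow> x + \<i> *s M x \<in> q Q"
    and v: "v \<in> Q" "z \<in> gs (- v)"
  shows "component (- v) (M z) = \<i> *s z"
proof (cases "z = 0")
  case True
  then show ?thesis using vec.linear_0[OF M] by simp
next
  case False
  have sp: "- v \<in> span R" using v Q by (auto simp: span_neg span_base)
  then have "- v \<in> R"
    using gs_trivial[of "- v" z] False v Q roots_iff by auto
  then have "component (- v) (z + \<i> *s M z) = 0"
    using conj_root_space_if_complex_structure[OF Q M J v] asym v by (auto simp: q_iff[OF Q])
  then have "z + \<i> *s component (- v) (M z) = 0"
    using component_gs[OF sp v(2), of "- v"] by (simp add: component_add component_scale)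
  then have "\<i> *s (z + \<i> *s component (- v) (M z)) = 0" by simp
  then show ?thesis by (simp add: vec.scale_right_distrib)
qed

lemma component_eq_self:
  assumes v: "v \<in> R" and 0: "\<And>w. w \<in> W \<Longrightarrow> w \<noteq> v \<Longrightarrow> component w z = 0"
  shows "component v z = z"
proof -
  have "(\<Sum>w\<in>W. component w z) = (\<Sum>w\<in>W. if w = v then component v z else 0)"
    using 0 by (intro sum.cong) auto
  also have "\<dots> = component v z"
    using v finite_roots by (subst sum.delta) auto
  finally show ?thesis using component_sum by simp
qed

end

section \<open>Exponentials of derivations\<close>

context compact_lie
begin

lemma derivation_skew:
  assumes "complex_linear D" "\<And>x y. D (br x y) = br (D x) y + br x (D y)" "\<And>z. cj (D z) = D (cj z)"
  shows "\<kappa> (D x) (cj y) = - \<kappa> x (cj (D y))"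
  using killing_derivation[OF assms(1,2), of x "cj y"] assms(3) by simp

lemma scaled_power_eigenvector:
  fixes \<mu> :: complex
  assumes "complex_linear D" "D z = \<mu> *s z"
  shows "((\<lambda>x. (pi/2) *\<^sub>R D x) ^^ n) z /\<^sub>R fact n = ((pi/2 * \<mu>) ^ n /\<^sub>R fact n) *s z"
proof -
  have "((\<lambda>x. (pi/2) *\<^sub>R D x) ^^ n) z = (pi/2 * \<mu>) ^ n *s z"
    by (induction n) (simp_all add: assms vec.linear_scale[OF assms(1)] scaleR_eq_scale mult_ac)
  then show ?thesis
    by (simp add: scaleR_eq_scale scaleR_conv_of_real)
qed

text \<open>A derivation that commutes with \<open>cj\<close> is skew for the definite form, hence
  diagonalizable. On an eigenvector the series is a scalar exponential series, so convergence and
  compatibility with brackets have to be checked only there.\<close>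

lemma derivation_exponential:
  assumes D: "complex_linear D" and der: "\<And>x y. D (br x y) = br (D x) y + br x (D y)"
    and real: "\<And>z. cj (D z) = D (cj z)"
  shows "\<exists>E. complex_linear E \<and> (\<forall>x y. E (br x y) = br (E x) (E y)) \<and> (\<forall>z. cj (E z) = E (cj z))
    \<and> (\<forall>z. E z = exp_map (\<lambda>x. (pi/2) *\<^sub>R D x) z)
    \<and> (\<forall>z. \<forall>\<mu> :: complex. D z = \<mu> *s z \<longrightarrow> E z = exp (pi/2 * \<mu>) *s z)"
proof -
  let ?A = "\<lambda>x. (pi/2) *\<^sub>R D x"
  let ?s = "\<lambda>z n. (?A ^^ n) z /\<^sub>R fact n"
  define E where "E = exp_map ?A"
  note linD = vec.linear_add[OF D] vec.linear_scale[OF D] vec.linear_0[OF D]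
  have A_add: "(?A ^^ n) (x + y) = (?A ^^ n) x + (?A ^^ n) y"
    and A_scale: "(?A ^^ n) (c *s x) = c *s (?A ^^ n) x"
    and A_zero: "(?A ^^ n) 0 = 0" for n x y c
    by (induction n; simp add: linD scaleR_eq_scale vec.scale_right_distrib mult.commute)+
  have "linear (\<lambda>c. c *s z)" "linear (\<lambda>z :: complex^'n. c *s z)" for z :: "complex^'n" and c
    by (rule linearI; simp add: vec.scale_left_distrib vec.scale_right_distrib scaleR_eq_scale
        mult.commute scaleR_conv_of_real[where 'a = complex])+
  then have scale_bl: "bounded_linear (\<lambda>c. c *s z)" "bounded_linear (\<lambda>z :: complex^'n. c *s z)"
    for z :: "complex^'n" and c
    by (simp_all only: linear_conv_bounded_linear)
  have eig: "?s z sums (exp (pi/2 * \<mu>) *s z)" if "D z = \<mu> *s z" for z and \<mu> :: complex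
    unfolding scaled_power_eigenvector[OF D that]
    by (rule bounded_linear.sums[OF scale_bl(1) exp_converges])
  have add: "?s (x + y) sums (a + b)" if "?s x sums a" "?s y sums b" for x y a b
    using sums_add[OF that] by (simp add: A_add scaleR_add_right)
  have scale: "?s (c *s x) sums (c *s a)" if "?s x sums a" for x a c
  proof -
    have "?s (c *s x) n = c *s ?s x n" for n
      unfolding A_scale by (simp add: scaleR_eq_scale[of "inverse (fact n)"] mult.commute)
    then show ?thesis
      using bounded_linear.sums[OF scale_bl(2) that, of c] by simp
  qed
  let ?B = "{z. \<exists>\<mu>. D z = \<mu> *s z}"
  have "vec.span {v. \<forall>T\<in>{D}. \<exists>c. T v = c *s v} = UNIV"
    using derivation_skew[OF D der real] by (intro herm.commuting_skew_diagonalizable) (auto simp: D)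
  then have span: "vec.span ?B = UNIV" by simp
  have "z \<in> {z. summable (?s z)}" for z
  proof -
    have "vec.subspace {z. summable (?s z)}"
      by (intro vec.subspaceI CollectI sums_summable[OF add] sums_summable[OF scale] summable_sums)
        (auto simp: A_zero)
    moreover have "?B \<subseteq> {z. summable (?s z)}"
      using eig sums_summable by blast
    ultimately show ?thesis using vec.span_minimal[of ?B] span by blast
  qed
  then have sums: "?s z sums E z" for z
    unfolding E_def exp_map_def by (simp add: summable_sums)
  have E: "E z = a" if "?s z sums a" for z a
    using sums_unique2[OF sums that] .
  have linE: "complex_linear E"
    by (intro complex_linearI E add scale sums)
  have Eeig: "E z = exp (pi/2 * \<mu>) *s z" if "D z = \<mu> *s z" for z and \<mu> :: complex
    by (rule E[OF eig[OF that]])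
  have brE: "E (br x y) = br (E x) (E y)" for x y
  proof (rule bracket_preserving_if_spanning[OF linE span])
    fix x y assume "x \<in> ?B" "y \<in> ?B"
    then obtain \<mu> \<nu> where *: "D x = \<mu> *s x" "D y = \<nu> *s y" by blast
    have "D (br x y) = (\<mu> + \<nu>) *s br x y"
      by (simp add: der * br_simps vec.scale_left_distrib)
    then have "E (br x y) = exp (pi/2 * (\<mu> + \<nu>)) *s br x y"
      by (rule Eeig)
    also have "\<dots> = br (E x) (E y)"
      by (simp add: Eeig[OF *(1)] Eeig[OF *(2)] br_simps exp_add distrib_left add_divide_distrib mult.commute)
    finally show "E (br x y) = br (E x) (E y)" .
  qed
  \<comment> \<open>The partial sums lie in \<open>u0\<close>, and a subspace of a
    finite-dimensional space is closed.\<close>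
  have "E x \<in> u0" if x: "x \<in> u0" for x
  proof -
    have "?A y \<in> u0" if "y \<in> u0" for y
      using real_if_cj_commute[of D, OF real that] by (rule u0_scaleR)
    then have "(?A ^^ n) x \<in> u0" for n
      using x by (induction n) auto
    then have "(\<Sum>n<N. ?s x n) \<in> u0" for N
      by (intro subspace_sum[OF u0_subspace] u0_scaleR)
    moreover have "(\<lambda>N. \<Sum>n<N. ?s x n) \<longlonglongrightarrow> E x"
      using sums[of x] by (simp only: sums_def)
    ultimately show ?thesis
      by (rule closed_sequentially[OF closed_subspace[OF u0_subspace]])
  qed
  then have cjE: "cj (E z) = E (cj z)" for z
    by (rule cj_commute_if_real[OF linE])
  have "E z = exp_map ?A z" for z
    by (simp only: E_def)
  then show ?thesis
    by (intro exI[of _ E] conjI allI impI linE brE cjE Eeig)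
qed

lemma exp_map_extend:
  assumes J: "derivation br u0 J" and D: "\<And>x. x \<in> u0 \<Longrightarrow> D x = J x" and x: "x \<in> u0"
  shows "exp_map (\<lambda>x. (pi/2) *\<^sub>R J x) x = exp_map (\<lambda>x. (pi/2) *\<^sub>R D x) x"
proof -
  have "((\<lambda>x. (pi/2) *\<^sub>R J x) ^^ n) x = ((\<lambda>x. (pi/2) *\<^sub>R D x) ^^ n) x
      \<and> ((\<lambda>x. (pi/2) *\<^sub>R D x) ^^ n) x \<in> u0" for n
  proof (induction n)
    case (Suc n)
    have "J y \<in> u0" if "y \<in> u0" for y
      using J that by (auto simp: derivation_def)
    then show ?case
      using Suc by (auto simp: D intro!: u0_scaleR)
  qed (simp add: x)
  then show ?thesis by (simp add: exp_map_def)
qed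

end

section \<open>CR structures of type \<open>G2\<close>\<close>

lemma G2_base_finite: "G2_base R a b \<Longrightarrow> finite R"
  by (simp add: G2_base_def G2_coords_def)

lemma G2_coords_double: "(m, n) \<in> G2_coords \<Longrightarrow> (2 * m, 2 * n) \<notin> G2_coords"
  unfolding G2_coords_def by (elim insertE) simp_all

text \<open>The base is a parameter so that the results apply to whatever base the classification of
  admissible sets yields.\<close>

locale G2_data = finite_root_data br u0 t0 R \<rho>
  for br :: "complex^'n \<Rightarrow> complex^'n \<Rightarrow> complex^'n" and u0 t0
    and R :: "'v::real_vector set" and \<rho> +
  fixes a b :: 'v
  assumes base: "G2_base R a b"
begin

abbreviation "p \<equiv> lattice_point a b"

lemma p_in_R: "p m n \<in> R \<longleftrightarrow> (m, n) \<in> G2_coords"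
  by (rule G2_base_in_iff[OF base])

lemma p_in_W: "p m n \<in> W \<longleftrightarrow> (m, n) \<in> insert (0, 0) G2_coords"
  using base lattice_point_eq_iff[of a b m n 0 0] p_in_R by (auto simp: G2_base_def lattice_point_0_0)

lemma a_in_R: "a \<in> R" and b_in_R: "b \<in> R"
  using p_in_R[of 1 0] p_in_R[of 0 1] by (simp_all add: G2_coords_def lattice_point_1_0 lattice_point_0_1)

lemma obtuse_in_R: "2 *\<^sub>R b - 3 *\<^sub>R a \<in> R" and acute_in_R: "3 *\<^sub>R a - b \<in> R"
  using p_in_R[of "-3" 2] p_in_R[of 3 "-1"] by (simp_all add: G2_coords_def lattice_point_def)

lemma a_span: "a \<in> span R" and b_span: "b \<in> span R"
  using a_in_R b_in_R by (simp_all add: span_base)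

lemma \<rho>_p: "H \<in> h \<Longrightarrow> \<rho> (p m n) H = of_int m * \<rho> a H + of_int n * \<rho> b H"
  using a_span b_span by (simp add: lattice_point_def \<rho>_add \<rho>_scale span_scale)

lemma \<rho>_obtuse: "H \<in> h \<Longrightarrow> \<rho> (2 *\<^sub>R b - 3 *\<^sub>R a) H = 2 * \<rho> b H - 3 * \<rho> a H"
  and \<rho>_acute: "H \<in> h \<Longrightarrow> \<rho> (3 *\<^sub>R a - b) H = 3 * \<rho> a H - \<rho> b H"
  using a_span b_span by (simp_all add: \<rho>_diff \<rho>_scale span_scale)

lemma cartan_eqI:
  assumes "H \<in> h" "K \<in> h" "\<rho> a H = \<rho> a K" "\<rho> b H = \<rho> b K"
  shows "H = K"
proof -
  have "H - K = 0"
  proof (rule zero_if_roots_vanish)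
    fix v assume "v \<in> R"
    then obtain m n where "v = p m n" by (rule G2_base_cases[OF base])
    then show "\<rho> v (H - K) = 0"
      using assms a_span b_span by (simp add: \<rho>_p h_closed \<rho>_arg_diff)
  qed (use assms in \<open>simp add: h_closed\<close>)
  then show ?thesis by simp
qed

section \<open>Generators of the algebra and elements of the torus\<close>

lemma p_string: "p m n - real k *\<^sub>R p m' n' = p (m - int k * m') (n - int k * n')"
  using lattice_point_scale[of "int k" a b m' n'] by (simp add: lattice_point_diff)

lemma p_double: "(m, n) \<in> G2_coords \<Longrightarrow> 2 *\<^sub>R p m n \<notin> R"
  using lattice_point_scale[of 2 a b m n] p_in_R G2_coords_double by simp

lemma string_in_subalgebra:
  assumes "complex_lie_subalgebra br s" "gs (p (- m') (- n')) \<subseteq> s" "gs (p m n) \<subseteq> s"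
    and "(m', n') \<in> G2_coords" "(m, n) \<in> G2_coords"
    and "(m + m', n + n') \<notin> insert (0, 0) G2_coords" "(m - int N * m', n - int N * n') \<in> G2_coords"
    and "(m - int (Suc N) * m', n - int (Suc N) * n') \<notin> insert (0, 0) G2_coords"
    and "k \<le> N" "(m - int k * m', n - int k * n') \<in> G2_coords"
  shows "gs (p (m - int k * m') (n - int k * n')) \<subseteq> s"
proof -
  have "gs (p m n - real k *\<^sub>R p m' n') \<subseteq> s"
    by (rule subalgebra_contains_string[of s "p m' n'" "p m n" N k])
      (use assms p_double in \<open>simp_all only: p_string lattice_point_minus lattice_point_add p_in_R p_in_W not_False_eq_True\<close>)
  then show ?thesis by (simp add: p_string)
qed

text \<open>For \<open>\<epsilon> = 1\<close>, the \<open>a\<close>-string of \<open>b\<close> runs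
  down through \<open>b - a\<close> and \<open>b - 2a\<close> to \<open>b - 3a\<close>, and one step
  by \<open>b\<close> leads from there to \<open>2b - 3a\<close>. The sign
  \<open>\<epsilon> = -1\<close> gives the opposite roots.\<close>

lemma half_in_subalgebra:
  fixes \<epsilon> :: int
  assumes s: "complex_lie_subalgebra br s" and \<epsilon>: "\<epsilon> = 1 \<or> \<epsilon> = -1"
    and g: "gs (p (- \<epsilon>) 0) \<subseteq> s" "gs (p 0 \<epsilon>) \<subseteq> s" "gs (p 0 (- \<epsilon>)) \<subseteq> s"
    and c: "c \<in> {(0, 1), (-1, 1), (-2, 1), (-3, 1), (-3, 2)}"
  shows "gs (p (\<epsilon> * fst c) (\<epsilon> * snd c)) \<subseteq> s"
proof -
  have short: "gs (p (0 - int k * \<epsilon>) (\<epsilon> - int k * 0)) \<subseteq> s" if "k = 0 \<or> k = 1 \<or> k = 2 \<or> k = 3" for k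
  proof (rule string_in_subalgebra[OF s _ g(2), where N = 3])
    show "gs (p (- \<epsilon>) (- 0)) \<subseteq> s" using g(1) by simp
    show "k \<le> 3" using that by auto
    show "(0 - int k * \<epsilon>, \<epsilon> - int k * 0) \<in> G2_coords"
      using that \<epsilon> by (elim disjE) (simp_all add: G2_coords_def)
  qed (use \<epsilon> in \<open>elim disjE; simp add: G2_coords_def\<close>)+
  have low: "gs (p (- 3 * \<epsilon>) \<epsilon>) \<subseteq> s"
    using short[of 3] by simp
  \<comment> \<open>The string is taken for the root \<open>- \<epsilon> b\<close>, so that lowering
    adds \<open>\<epsilon> b\<close>.\<close>
  have "gs (p (- 3 * \<epsilon> - int 1 * 0) (\<epsilon> - int 1 * (- \<epsilon>))) \<subseteq> s"
  proof (rule string_in_subalgebra[OF s _ low, where N = 1])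
    show "gs (p (- 0) (- (- \<epsilon>))) \<subseteq> s" using g(2) by simp
  qed (use \<epsilon> in \<open>elim disjE; simp add: G2_coords_def\<close>)+
  then show ?thesis
    using c short[of 0] short[of 1] short[of 2] short[of 3] by (auto simp: mult.commute)
qed

lemma generated:
  assumes s: "complex_lie_subalgebra br s" and "h \<subseteq> s"
    and g: "gs a \<subseteq> s" "gs (- a) \<subseteq> s" "gs b \<subseteq> s" "gs (- b) \<subseteq> s"
  shows "z \<in> s"
proof (rule weight_induct)
  show "vec.subspace s" using s by (simp add: complex_lie_subalgebra_def)
  fix v assume v: "v \<in> W"
  have g': "gs (p 1 0) \<subseteq> s" "gs (p (-1) 0) \<subseteq> s" "gs (p 0 1) \<subseteq> s" "gs (p 0 (-1)) \<subseteq> s"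
    using g by (simp_all add: lattice_point_def)
  show "gs v \<subseteq> s"
  proof (cases "v = 0")
    case True
    then show ?thesis using assms(2) gs_zero by simp
  next
    case False
    then have "v \<in> R" using v by simp
    then obtain m n where mn: "v = p m n" "(m, n) \<in> G2_coords" by (rule G2_base_cases[OF base])
    have pos: "gs (p (fst c) (snd c)) \<subseteq> s" and neg: "gs (p (- fst c) (- snd c)) \<subseteq> s"
      if "c \<in> {(0, 1), (-1, 1), (-2, 1), (-3, 1), (-3, 2)}" for c
      using half_in_subalgebra[OF s, of 1 c] half_in_subalgebra[OF s, of "-1" c] g' that
      by simp_all
    show ?thesis
      using mn(2) g' pos[of "(-1, 1)"] pos[of "(-2, 1)"] pos[of "(-3, 1)"] pos[of "(-3, 2)"]
        neg[of "(-1, 1)"] neg[of "(-2, 1)"] neg[of "(-3, 1)"] neg[of "(-3, 2)"]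
      unfolding mn(1) G2_coords_def by (elim insertE) simp_all
  qed
qed

text \<open>\<open>\<rho> b H = 3\<close> and \<open>\<rho> a H' = 1\<close> are the lengths of the
  strings \<open>b, b - a, b - 2a, b - 3a\<close> and \<open>a, a - b\<close>. The matrix with rows
  \<open>(2, 1)\<close> and \<open>(3, 2)\<close> has determinant 1, and its inverse supplies the
  coefficients \<open>2x - y\<close> and \<open>2y - 3x\<close>.\<close>

lemma cartan_element_exists: "\<exists>t\<in>h. \<rho> a t = x \<and> \<rho> b t = y"
proof -
  have string: "b - real k *\<^sub>R a = p (- int k) 1" "a - real k *\<^sub>R b = p 1 (- int k)"
    "b + a = p 1 1" "a + b = p 1 1" for k
    using p_string[of 0 1 k 1 0] p_string[of 1 0 k 0 1] by (simp_all add: lattice_point_def)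
  have double: "2 *\<^sub>R a \<notin> R" "2 *\<^sub>R b \<notin> R"
    using p_double[of 1 0] p_double[of 0 1] by (simp_all add: G2_coords_def lattice_point_1_0 lattice_point_0_1)
  obtain e f H where tr: "sl2_triple a e f H"
    using sl2_triple_exists[OF a_in_R double(1)] by blast
  obtain e' f' H' where tr': "sl2_triple b e' f' H'"
    using sl2_triple_exists[OF b_in_R double(2)] by blast
  obtain z z' where z: "z \<in> gs b" "z \<noteq> 0" "z' \<in> gs a" "z' \<noteq> 0"
    using a_in_R b_in_R roots_iff[of a] roots_iff[of b] gs_closed(1)[of a] gs_closed(1)[of b] by blast
  have "\<rho> b H = of_nat 3"
    by (rule root_string(1)[OF tr b_span z(1,2)])
      (simp_all only: string p_in_R p_in_W, simp_all add: G2_coords_def)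
  moreover have "\<rho> a H' = of_nat 1"
    by (rule root_string(1)[OF tr' a_span z(3,4)])
      (simp_all only: string p_in_R p_in_W, simp_all add: G2_coords_def)
  moreover have "H \<in> h" "H' \<in> h" "\<rho> a H = 2" "\<rho> b H' = 2"
    using tr tr' by (simp_all add: sl2_triple_def)
  ultimately have "\<rho> v ((2 * x - y) *s H + (2 * y - 3 * x) *s H') = (2 * x - y) * \<rho> v H + (2 * y - 3 * x) * \<rho> v H'"
    "(2 * x - y) *s H + (2 * y - 3 * x) *s H' \<in> h" "\<rho> a H = 2" "\<rho> b H' = 2" "\<rho> b H = 3" "\<rho> a H' = 1"
    if "v \<in> span R" for v
    using that by (simp_all only: \<rho>_arg_linear h_closed of_nat_numeral of_nat_1)
  from this[OF a_span] this[OF b_span] show ?thesis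
    by (intro bexI[of _ "(2 * x - y) *s H + (2 * y - 3 * x) *s H'"]) (simp_all only:, simp add: algebra_simps)
qed

text \<open>Since \<open>\<rho> v (cj t) = - cnj (\<rho> v t)\<close>, passing to the real part
  keeps an imaginary value and moves \<open>t\<close> into \<open>t0\<close>. One value serves both
  roots because the maps to be compared have the same eigenvalue on both root spaces.\<close>

lemma imaginary_cartan_element:
  obtains t where "t \<in> t0" "\<rho> a t = \<i> * of_real x" "\<rho> b t = \<i> * of_real x"
proof -
  obtain t where t: "t \<in> h" "\<rho> a t = \<i> * of_real x" "\<rho> b t = \<i> * of_real x"
    using cartan_element_exists by blast
  have "\<rho> v (re t) = \<i> * of_real x" if "v \<in> span R" "\<rho> v t = \<i> * of_real x" for v
    using that t(1) cj_h[OF t(1)] unfolding re_eq_cj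
    by (simp add: \<rho>_arg_scale \<rho>_arg_add \<rho>_cj h_closed)
  then show ?thesis
    using that[of "re t"] t a_span b_span re_h by blast
qed

section \<open>Automorphisms that fix the Cartan subalgebra\<close>

lemma bracket_preserving_eqI:
  assumes f: "complex_linear f" "\<And>x y. f (br x y) = br (f x) (f y)"
    and g: "complex_linear g" "\<And>x y. g (br x y) = br (g x) (g y)"
    and eq: "\<And>z. z \<in> h \<Longrightarrow> f z = g z" "\<And>v z. v \<in> {a, - a, b, - b} \<Longrightarrow> z \<in> gs v \<Longrightarrow> f z = g z"
  shows "f z = g z"
proof -
  have "z \<in> {z. f z = g z}"
    by (rule generated[OF complex_subalgebra_equalizer[OF f g]]) (use eq in auto)
  then show ?thesis by simp
qed

text \<open>The root spaces of \<open>- a\<close> and \<open>- b\<close> consist of conjugates of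
  vectors for \<open>a\<close> and \<open>b\<close>, and both maps commute with \<open>cj\<close>,
  the torus element because \<open>t\<close> is in \<open>t0\<close>.\<close>

lemma eq_torus:
  assumes f: "complex_linear f" "\<And>x y. f (br x y) = br (f x) (f y)" "\<And>z. cj (f z) = f (cj z)"
    and fix_h: "\<And>H. H \<in> h \<Longrightarrow> f H = H"
    and eig: "\<And>v z. v \<in> {a, b} \<Longrightarrow> z \<in> gs v \<Longrightarrow> f z = exp (\<rho> v t) *s z"
    and t: "t \<in> t0"
  shows "f z = torus t z"
proof (rule bracket_preserving_eqI[OF f(1,2) torus_linear torus_br[OF t0_h[OF t]]])
  show "f z = torus t z" if "z \<in> h" for z
    using that torus_gs[OF span_zero, of z t] gs_zero fix_h \<rho>_zero t0_h[OF t] by simp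
  have pos: "f z = torus t z" if "v \<in> {a, b}" "z \<in> gs v" for v z
    using eig[OF that] torus_gs[of v z t] that a_span b_span by auto
  show "f z = torus t z" if "v \<in> {a, - a, b, - b}" "z \<in> gs v" for v z
  proof (cases "v \<in> {a, b}")
    case False
    then have "- v \<in> {a, b}" "v \<in> span R"
      using that a_span b_span by (auto simp: span_neg)
    then have "f (cj z) = torus t (cj z)"
      using pos gs_cj that(2) by blast
    then have "cj (f (cj z)) = cj (torus t (cj z))" by simp
    then show ?thesis by (simp add: f(3) torus_cj[OF t])
  qed (use pos that in blast)
qed

lemma torus_eigenvalue_unique:
  assumes "v \<in> R" "\<And>z. z \<in> gs v \<Longrightarrow> torus t z = c *s z"
  shows "exp (\<rho> v t) = c"
proof -
  obtain z where "z \<in> gs v" "z \<noteq> 0"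
    using assms(1) roots_iff gs_closed(1) by blast
  then show ?thesis
    using assms torus_gs[of v z t] by (auto simp: span_base)
qed

text \<open>The involution is \<open>exp (ad t)\<close> with \<open>t\<close> taking the value
  \<open>\<i>\<pi>\<close> on \<open>a\<close> and \<open>b\<close>. The condition on its fixed
  points holds because \<open>q\<close> and its conjugate generate the whole algebra.\<close>

lemma CR_symmetric_obtuse: "CR_symmetric br u0 (q {a, b, 2 *\<^sub>R b - 3 *\<^sub>R a})" (is "CR_symmetric _ _ (q ?Q)")
proof -
  obtain t where t: "t \<in> t0" "\<rho> a t = \<i> * of_real pi" "\<rho> b t = \<i> * of_real pi"
    by (rule imaginary_cartan_element)
  note th = t0_h[OF t(1)]
  have Q: "?Q \<subseteq> R"
    using a_in_R b_in_R obtuse_in_R by blast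
  have asym: "\<forall>v\<in>?Q. - v \<notin> ?Q"
    using admissible_if_base(3)[OF base] by (simp add: admissible_sets_def)
  note lin = vec.linear_add[OF torus_linear] vec.linear_scale[OF torus_linear] vec.linear_0[OF torus_linear]
  have exp_ab: "exp (\<rho> a t) = -1" "exp (\<rho> b t) = -1" "exp (- \<rho> a t) = -1" "exp (- \<rho> b t) = -1"
    by (simp_all add: t exp_minus)
  have "\<rho> (2 *\<^sub>R b - 3 *\<^sub>R a) t = - (\<i> * of_real pi)"
    by (simp add: \<rho>_obtuse[OF th] t)
  then have exp_c: "exp (\<rho> (2 *\<^sub>R b - 3 *\<^sub>R a) t) = -1"
    by (simp add: exp_minus)
  have on_h: "torus t z = z" if "z \<in> h" for z
    using that torus_gs[OF span_zero, of z t] gs_zero \<rho>_zero th by simp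
  have on_Q: "torus t z = - z" if "v \<in> ?Q" "z \<in> gs v" for v z
    using that torus_gs[of v z t] Q exp_ab exp_c by (auto simp: span_base)
  have on_neg: "torus t z = - z" if "v \<in> {- a, - b}" "z \<in> gs v" for v z
    using that torus_gs[of v z t] exp_ab a_span b_span \<rho>_minus[OF _ th] by (auto simp: span_neg)
  \<comment> \<open>Comparing the square with the identity on generators avoids the eigenvalues on
    the other root spaces.\<close>
  have invol: "torus t (torus t z) = z" for z
  proof (rule bracket_preserving_eqI)
    show "complex_linear (\<lambda>z. torus t (torus t z))"
      by (intro complex_linearI) (simp_all add: lin)
    show "complex_linear (\<lambda>z :: complex^'n. z)"
      by (intro complex_linearI) simp_all
    show "torus t (torus t z) = z" if "v \<in> {a, - a, b, - b}" "z \<in> gs v" for v z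
      using that on_Q[of v] on_neg[of v] by (auto simp: gs_closed)
  qed (simp_all add: torus_br th on_h)
  have in_q: "torus t z \<in> q ?Q" if "z \<in> q ?Q" for z
  proof -
    have "z \<in> {z. torus t z \<in> q ?Q}"
    proof (rule q_induct[OF Q that])
      show "vec.subspace {z. torus t z \<in> q ?Q}"
        using q_subspace[OF Q] by (auto simp: vec.subspace_def lin)
    qed (auto simp: on_h on_Q h_subset_q[OF Q] intro!: gs_subset_q[OF Q] gs_closed)
    then show ?thesis by simp
  qed
  have sum_h: "z + torus t z \<in> h" if "z \<in> q ?Q" for z
  proof -
    have "z \<in> {z. z + torus t z \<in> h}"
    proof (rule q_induct[OF Q that])
      have eq: "x + y + torus t (x + y) = (x + torus t x) + (y + torus t y)"
        "c *s x + torus t (c *s x) = c *s (x + torus t x)" for x y c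
        by (simp_all add: lin vec.scale_right_distrib)
      show "vec.subspace {z. z + torus t z \<in> h}"
      proof (rule vec.subspaceI)
        show "0 \<in> {z. z + torus t z \<in> h}" by (simp add: lin h_closed)
      qed (simp_all only: mem_Collect_eq eq h_closed)
      show "z \<in> {z. z + torus t z \<in> h}" if "z \<in> h" for z
        using h_closed(2)[OF that that] on_h[OF that] by (simp only: mem_Collect_eq)
      show "z \<in> {z. z + torus t z \<in> h}" if "v \<in> ?Q" "z \<in> gs v" for v z
        using on_Q[OF that] h_closed(1) by simp
    qed
    then show ?thesis by simp
  qed
  have in_u0: "torus t x \<in> u0" if "x \<in> u0" for x
    using real_if_cj_commute[of "torus t", OF torus_cj[OF t(1)] that] .
  have everything: "z \<in> complex_lie_subalgebra br hull {z + cj w | z w. z \<in> q ?Q \<and> w \<in> q ?Q}" for z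
    unfolding hull_def
  proof (intro InterI)
    fix s assume s: "s \<in> {s. complex_lie_subalgebra br s \<and> {z + cj w | z w. z \<in> q ?Q \<and> w \<in> q ?Q} \<subseteq> s}"
    \<comment> \<open>Putting zero in one summand shows that \<open>s\<close> contains both
      \<open>q\<close> and its conjugate.\<close>
    have q0: "0 \<in> q ?Q" using h_subset_q[OF Q] h_closed(1) by blast
    have sum: "x + cj w \<in> s" if "x \<in> q ?Q" "w \<in> q ?Q" for x w
      using s that by blast
    have q_s: "x \<in> s" if "x \<in> q ?Q" for x
      using sum[OF that q0] by simp
    have cj_q_s: "x \<in> s" if "cj x \<in> q ?Q" for x
      using sum[OF q0 that] by simp
    have root: "gs v \<subseteq> s" if "v \<in> ?Q" for v
      using q_s gs_subset_q[OF Q that] by blast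
    have neg_root: "gs (- v) \<subseteq> s" if "v \<in> ?Q" for v
    proof
      fix x assume "x \<in> gs (- v)"
      moreover have "- v \<in> span R" using that Q by (auto intro: span_neg span_base)
      ultimately have "cj x \<in> gs v" using gs_cj[of "- v" x] by simp
      then show "x \<in> s" using cj_q_s gs_subset_q[OF Q that] by blast
    qed
    show "z \<in> s"
    proof (rule generated)
      show "complex_lie_subalgebra br s" using s by blast
      show "h \<subseteq> s" using q_s h_subset_q[OF Q] by blast
    qed (simp_all add: root neg_root)
  qed
  show ?thesis
    unfolding CR_symmetric_def
  proof (intro exI[of _ "torus t"] conjI)
    show "complex_linear (torus t)" by (rule torus_linear)
    show "\<forall>x y. torus t (br x y) = br (torus t x) (torus t y)" by (simp add: torus_br th)
    show "torus t \<circ> torus t = id" by (auto simp: invol)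
    show "torus t ` u0 = u0"
      using in_u0 invol by (metis image_eqI image_subsetI subsetI subset_antisym)
    show "torus t ` q ?Q = q ?Q"
      using in_q invol by (metis image_eqI image_subsetI subsetI subset_antisym)
    show "{z. torus t z = z} \<subseteq> complex_lie_subalgebra br hull {z + cj w | z w. z \<in> q ?Q \<and> w \<in> q ?Q}"
      using everything by blast
    show "\<forall>z\<in>q ?Q. z + torus t z \<in> q ?Q \<inter> cj ` q ?Q"
      using sum_h q_Int_conj_q[OF Q asym] by blast
  qed
qed

lemma not_CR_symmetric_acute: "\<not> CR_symmetric br u0 (q {a, b, 3 *\<^sub>R a - b})" (is "\<not> CR_symmetric _ _ (q ?Q)")
proof
  assume "CR_symmetric br u0 (q ?Q)"
  then obtain l where l: "complex_linear l" "\<And>x y. l (br x y) = br (l x) (l y)" "l \<circ> l = id"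
    "l ` u0 = u0" "l ` q ?Q = q ?Q" "\<And>z. z \<in> q ?Q \<Longrightarrow> z + l z \<in> q ?Q \<inter> cj ` q ?Q"
    unfolding CR_symmetric_def by auto
  have Q: "?Q \<subseteq> R"
    using a_in_R b_in_R acute_in_R by blast
  have asym: "\<forall>v\<in>?Q. - v \<notin> ?Q"
    using admissible_if_base(2)[OF base] by (simp add: admissible_sets_def)
  note qh = q_Int_conj_q[OF Q asym]
  have l_cj: "cj (l z) = l (cj z)" for z
    using l(4) by (intro cj_commute_if_real[OF l(1)]) blast
  \<comment> \<open>\<open>l\<close> preserves \<open>q\<close> and commutes with conjugation, so it
    preserves the intersection of \<open>q\<close> with its conjugate, which is
    \<open>h\<close>.\<close>
  have l_h: "l H \<in> h" if H: "H \<in> h" for H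
  proof -
    have "l H \<in> q ?Q" "l (cj H) \<in> q ?Q"
      using H cj_h[OF H] h_subset_q[OF Q] l(5) by blast+
    moreover have "l H = cj (l (cj H))" using l_cj by simp
    ultimately show ?thesis unfolding qh[symmetric] by blast
  qed
  have on_Q: "l z = - z \<and> (z \<noteq> 0 \<longrightarrow> (\<forall>H\<in>h. \<rho> v (l H) = \<rho> v H))" if v: "v \<in> ?Q" "z \<in> gs v" for v z
  proof -
    have vR: "v \<in> R" "v \<in> span R" "v \<noteq> 0" using v(1) Q roots_iff by blast+
    \<comment> \<open>At first \<open>l z = K - z\<close> with \<open>K\<close> in \<open>h\<close>
      is all that is known. The bracket of \<open>l H\<close> with \<open>l z\<close> has no
      component in \<open>h\<close>, yet it equals \<open>\<rho> v H\<close> times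
      \<open>l z\<close>; an \<open>H\<close> with \<open>\<rho> v H\<close> nonzero gives
      \<open>K = 0\<close>.\<close>
    define K where "K = z + l z"
    have K: "K \<in> h"
      using l(6)[of z] gs_subset_q[OF Q v] qh unfolding K_def by blast
    have lz: "l z = K - z" by (simp add: K_def)
    have eq: "br (l H) (l z) = \<rho> v H *s l z" if "H \<in> h" for H
      using l(2)[of H z] v(2) that vec.linear_scale[OF l(1)] by (simp add: gs_iff)
    obtain H where H: "H \<in> h" "\<rho> v H \<noteq> 0"
      using \<rho>_separates[of v 0] vR \<rho>_zero span_zero by fastforce
    have "component 0 (l z) = K"
      using component_gs[OF span_zero, of K 0] component_gs[OF vR(2) v(2), of 0] K gs_zero vR(3)
      by (simp add: lz component_diff)
    moreover have "component 0 (br (l H) (l z)) = 0"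
      using component_br[OF l_h[OF H(1)]] \<rho>_zero[OF l_h[OF H(1)]] by simp
    ultimately have "\<rho> v H *s K = 0"
      using eq[OF H(1)] by (simp add: component_scale)
    then have lz: "l z = - z" using H lz by simp
    moreover have "\<rho> v (l H) = \<rho> v H" if "z \<noteq> 0" "H \<in> h" for H
    proof -
      have "\<rho> v (l H) *s z = \<rho> v H *s z"
        using eq[OF that(2)] v(2) l_h[OF that(2)] unfolding lz by (simp add: gs_iff br_simps)
      then show ?thesis using that(1) by simp
    qed
    ultimately show ?thesis by blast
  qed
  have \<rho>_l: "\<rho> v (l H) = \<rho> v H" if "v \<in> ?Q" "H \<in> h" for v H
    using on_Q[OF that(1)] that roots_iff[of v] Q gs_closed(1)[of v] by blast
  have fix_h: "l H = H" if "H \<in> h" for H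
    using that \<rho>_l by (intro cartan_eqI l_h) auto
  obtain t where t: "t \<in> t0" "\<rho> a t = \<i> * of_real pi" "\<rho> b t = \<i> * of_real pi"
    by (rule imaginary_cartan_element)
  have l_torus: "l z = torus t z" for z
  proof (rule eq_torus[OF l(1,2) l_cj fix_h _ t(1)])
    fix v z assume "v \<in> {a, b}" "z \<in> gs v"
    then show "l z = exp (\<rho> v t) *s z"
      using on_Q[of v z] t by auto
  qed
  have "exp (\<rho> (3 *\<^sub>R a - b) t) = -1"
    by (rule torus_eigenvalue_unique) (use Q on_Q[of "3 *\<^sub>R a - b"] l_torus in auto)
  moreover have "\<rho> (3 *\<^sub>R a - b) t = 2 * of_real pi * \<i>"
    by (simp add: \<rho>_acute[OF t0_h[OF t(1)]] t)
  ultimately show False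
    using exp_two_pi_i by simp
qed

text \<open>The exponential of the extended derivation is an automorphism \<open>E\<close>, and the
  value of \<open>t\<close> is chosen so that \<open>exp (ad t)\<close> has eigenvalue
  \<open>- \<i>\<close> on the spaces of \<open>a\<close> and \<open>b\<close>. Once
  \<open>E\<close> is seen to fix \<open>h\<close>, the two maps coincide, and the eigenvalue on any
  root space of \<open>Q\<close> can be read off in two ways.\<close>

lemma weak_J_eigenvalues:
  assumes Q: "Q \<subseteq> R" "\<forall>v\<in>Q. - v \<notin> Q" "a \<in> Q" "b \<in> Q" and J: "weak_J_property br u0 t0 (q Q)"
    and t: "t \<in> t0" "\<rho> a t = \<i> * of_real (- pi/2)" "\<rho> b t = \<i> * of_real (- pi/2)" and v: "v \<in> Q"
  shows "exp (\<rho> v t) = - \<i>"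
proof -
  obtain J where J: "derivation br u0 J" and
    weak: "exp_map (\<lambda>x. (pi/2) *\<^sub>R J x) ` t0 = t0"
    "\<And>x. x \<in> re ` q Q \<Longrightarrow> x + \<i> *s exp_map (\<lambda>x. (pi/2) *\<^sub>R J x) x \<in> q Q"
    using J by (auto simp: weak_J_property_def Let_def)
  obtain D where D: "complex_linear D" "\<And>x. x \<in> u0 \<Longrightarrow> D x = J x" "\<And>z. cj (D z) = D (cj z)"
    "\<And>x y. D (br x y) = br (D x) y + br x (D y)"
    using derivation_extend[OF J] by blast
  obtain E where E: "complex_linear E" "\<And>x y. E (br x y) = br (E x) (E y)" "\<And>z. cj (E z) = E (cj z)"
    "\<And>z. E z = exp_map (\<lambda>x. (pi/2) *\<^sub>R D x) z"
    "\<And>z (\<mu> :: complex). D z = \<mu> *s z \<Longrightarrow> E z = exp (pi/2 * \<mu>) *s z"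
    using derivation_exponential[of D, OF D(1,4,3)] by blast
  have ex: "exp_map (\<lambda>x. (pi/2) *\<^sub>R J x) x = E x" if "x \<in> u0" for x
    unfolding E(4) by (rule exp_map_extend[OF J(1) _ that]) (rule D(2))
  have E_t0: "E ` t0 = t0"
    using weak(1) ex t0_in_u0 by (metis (no_types, lifting) image_cong)
  have E_q: "x + \<i> *s E x \<in> q Q" if "x \<in> re ` q Q" for x
    using weak(2)[OF that] ex[of x] that by auto
  have E_h: "E H \<in> h" if "H \<in> h" for H
  proof -
    have "E H = E (re H) + \<i> *s E (im H)"
      using E(1) by (metis re_im vec.linear_add vec.linear_scale)
    then show ?thesis
      using E_t0 re_h[OF that] im_h[OF that] t0_h by (auto intro!: h_closed)
  qed
  have E_h_onto: "\<exists>H\<in>h. K = E H" if K: "K \<in> h" for K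
  proof -
    obtain x y where xy: "x \<in> t0" "y \<in> t0" "re K = E x" "im K = E y"
      using E_t0 re_h[OF K] im_h[OF K] by (metis imageE)
    then have "K = E (x + \<i> *s y)"
      using re_im[of K] E(1) by (simp add: vec.linear_add vec.linear_scale)
    then show ?thesis using xy t0_h by (auto intro!: h_closed)
  qed
  have neg: "E z = \<i> *s z \<and> (z \<noteq> 0 \<longrightarrow> (\<forall>H\<in>h. \<rho> v (E H) = \<rho> v H))"
    if v: "v \<in> Q" "z \<in> gs (- v)" for v z
  proof (cases "z = 0")
    case True
    then show ?thesis using vec.linear_0[OF E(1)] by simp
  next
    case False
    have sp: "v \<in> span R" "- v \<in> span R" using v(1) Q(1) by (auto simp: span_base span_neg)
    have mv: "- v \<in> R"
      using sp False v roots_iff[of "- v"] roots_iff[of v] Q(1) by auto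
    have comp: "component (- v) (E z) = \<i> *s z"
      by (rule conj_component_if_complex_structure[OF Q(1,2) E(1) E_q v])
    \<comment> \<open>As \<open>E\<close> respects brackets, a nonzero component of
      \<open>E z\<close> at \<open>w\<close> forces \<open>\<rho> w (E H) = \<rho> (- v) H\<close>.
      The component at \<open>- v\<close> is nonzero, which settles \<open>w = - v\<close>; since
      \<open>E\<close> maps \<open>h\<close> onto itself, any other such \<open>w\<close> would
      agree with \<open>- v\<close> on all of \<open>h\<close>.\<close>
    have shift: "\<rho> w (E H) *s component w (E z) = \<rho> (- v) H *s component w (E z)" if "H \<in> h" for w H
    proof -
      have "br (E H) (E z) = \<rho> (- v) H *s E z"
        using E(2)[of H z] v(2) that vec.linear_scale[OF E(1)] by (simp add: gs_iff)
      then show ?thesis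
        using component_br[OF E_h[OF that], of w "E z"] by (simp only: component_scale)
    qed
    have inv: "\<rho> (- v) (E H) = \<rho> (- v) H" if "H \<in> h" for H
      using shift[OF that, of "- v"] False comp by simp
    have "component w (E z) = 0" if w: "w \<in> W" "w \<noteq> - v" for w
    proof -
      obtain K where K: "K \<in> h" "\<rho> w K \<noteq> \<rho> (- v) K"
        using \<rho>_separates[OF W_span[OF w(1)] sp(2) w(2)] by blast
      then obtain H where H: "H \<in> h" "K = E H" using E_h_onto by blast
      show ?thesis
        using shift[OF H(1), of w] K(2) inv[OF H(1)] H(2) by auto
    qed
    then have "E z = \<i> *s z"
      using component_eq_self[OF mv, of "E z"] comp by auto
    moreover have "\<rho> v (E H) = \<rho> v H" if "H \<in> h" for H
      using inv[OF that] \<rho>_minus[OF sp(1)] E_h that by simp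
    ultimately show ?thesis by blast
  qed
  have pos: "E z = - \<i> *s z" if v: "v \<in> Q" "z \<in> gs v" for v z
  proof -
    have "E (cj z) = \<i> *s cj z"
      using neg[OF v(1), of "cj z"] gs_cj[of v z] v Q(1) by (auto simp: span_base)
    then have "cj (E (cj z)) = - \<i> *s z"
      by (simp add: cj_scale)
    then show ?thesis by (simp add: E(3))
  qed
  have \<rho>_E: "\<rho> v (E H) = \<rho> v H" if v: "v \<in> Q" and H: "H \<in> h" for v H
  proof -
    obtain z where "z \<in> gs v" "z \<noteq> 0"
      using v Q(1) roots_iff gs_closed(1) by blast
    moreover have "cj z \<noteq> 0" using \<open>z \<noteq> 0\<close> by (metis cj_cj cj_zero)
    ultimately show ?thesis
      using neg[OF v, of "cj z"] gs_cj[of v z] v Q(1) H by (auto simp: span_base)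
  qed
  have fix_h: "E H = H" if "H \<in> h" for H
    using that \<rho>_E Q(3,4) by (intro cartan_eqI E_h) auto
  have exp_ab: "exp (\<i> * of_real (- pi/2)) = - \<i>"
    using cis_conv_exp[of "- pi/2"] by (simp add: complex_eq_iff)
  have E_torus: "E z = torus t z" for z
  proof (rule eq_torus[OF E(1-3) fix_h _ t(1)])
    fix v z assume "v \<in> {a, b}" "z \<in> gs v"
    then show "E z = exp (\<rho> v t) *s z"
      using pos[of v z] t exp_ab Q(3,4) by auto
  qed
  show ?thesis
    by (rule torus_eigenvalue_unique) (use v Q(1) pos[OF v] E_torus in auto)
qed

lemma not_weak_J: "\<not> weak_J_property br u0 t0 (q {a, b, 2 *\<^sub>R b - 3 *\<^sub>R a})"
    "\<not> weak_J_property br u0 t0 (q {a, b, 3 *\<^sub>R a - b})"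
proof -
  obtain t where t: "t \<in> t0" "\<rho> a t = \<i> * of_real (- pi/2)" "\<rho> b t = \<i> * of_real (- pi/2)"
    by (rule imaginary_cartan_element)
  note in_R = a_in_R b_in_R obtuse_in_R acute_in_R
  have val: "\<rho> (2 *\<^sub>R b - 3 *\<^sub>R a) t = \<i> * of_real (pi/2)" "\<rho> (3 *\<^sub>R a - b) t = \<i> * of_real (- pi)"
    by (simp_all add: \<rho>_obtuse[OF t0_h[OF t(1)]] \<rho>_acute[OF t0_h[OF t(1)]] t field_simps)
  have "exp (\<i> * of_real (pi/2)) \<noteq> - \<i>" "exp (\<i> * of_real (- pi)) \<noteq> - \<i>"
    using cis_conv_exp[of "pi/2"] cis_conv_exp[of "- pi"] by (auto simp: complex_eq_iff)
  then show "\<not> weak_J_property br u0 t0 (q {a, b, 2 *\<^sub>R b - 3 *\<^sub>R a})"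
    "\<not> weak_J_property br u0 t0 (q {a, b, 3 *\<^sub>R a - b})"
    using weak_J_eigenvalues[of "{a, b, 2 *\<^sub>R b - 3 *\<^sub>R a}" t "2 *\<^sub>R b - 3 *\<^sub>R a"]
      weak_J_eigenvalues[of "{a, b, 3 *\<^sub>R a - b}" t "3 *\<^sub>R a - b"] t in_R val
      admissible_if_base[OF base] by (auto simp: admissible_sets_def)
qed

text \<open>The infinitesimal counterpart of the preceding argument: \<open>D\<close> vanishes on
  \<open>h\<close> and is \<open>- \<i>\<close> on the root spaces of \<open>Q\<close>. Its
  exponential then fixes \<open>h\<close> and has the same eigenvalue
  \<open>exp (- \<i>\<pi>/2) = - \<i>\<close>, as the weak property asks.\<close>

lemma weak_J_if_J:
  assumes Q: "Q \<subseteq> R" "\<forall>v\<in>Q. - v \<notin> Q" "a \<in> Q" "b \<in> Q" and J: "J_property br u0 t0 (q Q)"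
  shows "weak_J_property br u0 t0 (q Q)"
proof -
  obtain J where J: "derivation br u0 J" "J ` t0 \<subseteq> t0" "\<And>x. x \<in> re ` q Q \<Longrightarrow> x + \<i> *s J x \<in> q Q"
    using J by (auto simp: J_property_def)
  obtain D where D: "complex_linear D" "\<And>x. x \<in> u0 \<Longrightarrow> D x = J x" "\<And>z. cj (D z) = D (cj z)"
    "\<And>x y. D (br x y) = br (D x) y + br x (D y)"
    using derivation_extend[OF J(1)] by blast
  obtain E where E: "complex_linear E" "\<And>x y. E (br x y) = br (E x) (E y)" "\<And>z. cj (E z) = E (cj z)"
    "\<And>z. E z = exp_map (\<lambda>x. (pi/2) *\<^sub>R D x) z"
    "\<And>z (\<mu> :: complex). D z = \<mu> *s z \<Longrightarrow> E z = exp (pi/2 * \<mu>) *s z"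
    using derivation_exponential[of D, OF D(1,4,3)] by blast
  have ex: "exp_map (\<lambda>x. (pi/2) *\<^sub>R J x) x = E x" if "x \<in> u0" for x
    unfolding E(4) by (rule exp_map_extend[OF J(1) _ that]) (rule D(2))
  have D_q: "x + \<i> *s D x \<in> q Q" if "x \<in> re ` q Q" for x
    using J(3)[OF that] D(2)[of x] that by auto
  have D_h: "D H \<in> h" if "H \<in> h" for H
  proof -
    have "D H = D (re H) + \<i> *s D (im H)"
      using D(1) by (metis re_im vec.linear_add vec.linear_scale)
    moreover have "D (re H) \<in> t0" "D (im H) \<in> t0"
      using J(2) D(2) re_h[OF that] im_h[OF that] by auto
    ultimately show ?thesis
      by (simp only: h_closed t0_h)
  qed
  have neg: "D z = \<i> *s z \<and> (z \<noteq> 0 \<longrightarrow> (\<forall>H\<in>h. \<rho> v (D H) = 0))"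
    if v: "v \<in> Q" "z \<in> gs (- v)" for v z
  proof (cases "z = 0")
    case True
    then show ?thesis using vec.linear_0[OF D(1)] by simp
  next
    case False
    have sp: "v \<in> span R" "- v \<in> span R" using v(1) Q(1) by (auto simp: span_base span_neg)
    have mv: "- v \<in> R"
      using sp False v roots_iff[of "- v"] roots_iff[of v] Q(1) by auto
    have comp: "component (- v) (D z) = \<i> *s z"
      by (rule conj_component_if_complex_structure[OF Q(1,2) D(1) D_q v])
    \<comment> \<open>The components of the derivation rule for \<open>[H, z]\<close>. At
      \<open>w = - v\<close> it gives \<open>\<rho> (- v) (D H) = 0\<close>; at any other weight
      \<open>z\<close> has no component, and an \<open>H\<close> separating \<open>w\<close> from
      \<open>- v\<close> removes that of \<open>D z\<close>.\<close>
    have shift: "\<rho> (- v) H *s component w (D z) = \<rho> (- v) (D H) *s component w z + \<rho> w H *s component w (D z)"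
      if "H \<in> h" for w H
    proof -
      have "\<rho> (- v) H *s D z = \<rho> (- v) (D H) *s z + br H (D z)"
        using D(4)[of H z] v(2) that D_h[OF that] vec.linear_scale[OF D(1)] by (simp add: gs_iff)
      then have "component w (\<rho> (- v) H *s D z) = component w (\<rho> (- v) (D H) *s z + br H (D z))"
        by simp
      then show ?thesis
        by (simp add: component_add component_scale component_br[OF that])
    qed
    have "\<rho> (- v) (D H) = 0" if "H \<in> h" for H
      using shift[OF that, of "- v"] False component_gs[OF sp(2) v(2), of "- v"] by simp
    then have inv: "\<rho> v (D H) = 0" if "H \<in> h" for H
      using \<rho>_minus[OF sp(1)] D_h that by simp
    have "component w (D z) = 0" if w: "w \<in> W" "w \<noteq> - v" for w
    proof -
      obtain H where H: "H \<in> h" "\<rho> w H \<noteq> \<rho> (- v) H"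
        using \<rho>_separates[OF W_span[OF w(1)] sp(2) w(2)] by blast
      have "component w z = 0"
        using component_gs[OF sp(2) v(2), of w] w(2) by simp
      then show ?thesis
        using shift[OF H(1), of w] H(2) by simp
    qed
    then have "D z = \<i> *s z"
      using component_eq_self[OF mv, of "D z"] comp by auto
    then show ?thesis using inv by blast
  qed
  have pos: "D z = - \<i> *s z" if v: "v \<in> Q" "z \<in> gs v" for v z
  proof -
    have "D (cj z) = \<i> *s cj z"
      using neg[OF v(1), of "cj z"] gs_cj[of v z] v Q(1) by (auto simp: span_base)
    then have "cj (D (cj z)) = - \<i> *s z"
      by (simp add: cj_scale)
    then show ?thesis by (simp add: D(3))
  qed
  have \<rho>_D: "\<rho> v (D H) = 0" if v: "v \<in> Q" and H: "H \<in> h" for v H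
  proof -
    obtain z where "z \<in> gs v" "z \<noteq> 0"
      using v Q(1) roots_iff gs_closed(1) by blast
    moreover have "cj z \<noteq> 0" using \<open>z \<noteq> 0\<close> by (metis cj_cj cj_zero)
    ultimately show ?thesis
      using neg[OF v, of "cj z"] gs_cj[of v z] v Q(1) H by (auto simp: span_base)
  qed
  have D0: "D H = 0" if H: "H \<in> h" for H
  proof (rule cartan_eqI[OF D_h[OF H] h_closed(1)])
    have "\<rho> v 0 = 0" if "v \<in> span R" for v
      using \<rho>_arg_scale[OF that h_closed(1), of 0] by simp
    then show "\<rho> a (D H) = \<rho> a 0" "\<rho> b (D H) = \<rho> b 0"
      using \<rho>_D H Q(3,4) a_span b_span by auto
  qed
  have E_h: "E H = H" if "H \<in> h" for H
    using E(5)[of H 0] D0[OF that] by simp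
  have E_Q: "E z = - \<i> *s z" if "v \<in> Q" "z \<in> gs v" for v z
  proof -
    have "exp (of_real (pi/2) * - \<i>) = - \<i>"
      using cis_conv_exp[of "- pi/2"] by (simp add: complex_eq_iff mult.commute)
    then show ?thesis using E(5)[OF pos[OF that]] by simp
  qed
  have "x + \<i> *s E x \<in> q Q" if "x \<in> re ` q Q" for x
    by (rule complex_structure_if_eigenvalue[OF Q(1) E(1,3) _ E_Q that]) (simp_all add: E_h)
  then have "\<forall>x\<in>re ` q Q. x + \<i> *s exp_map (\<lambda>x. (pi/2) *\<^sub>R J x) x \<in> q Q"
    using ex by auto
  moreover have "exp_map (\<lambda>x. (pi/2) *\<^sub>R J x) ` t0 = t0"
    using ex E_h t0_in_u0 t0_h by force
  ultimately show ?thesis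
    using J(1) unfolding weak_J_property_def Let_def by blast
qed

text \<open>An inner derivation suffices: \<open>ad t\<close> vanishes on \<open>h\<close>, and
  since \<open>a\<close> and \<open>b\<close> are independent its eigenvalues on both root spaces
  can be made \<open>- \<i>\<close>.\<close>

lemma J_property_base: "J_property br u0 t0 (q {a, b})"
proof -
  obtain t where t: "t \<in> t0" "\<rho> a t = \<i> * of_real (-1)" "\<rho> b t = \<i> * of_real (-1)"
    by (rule imaginary_cartan_element)
  have u: "t \<in> u0" by (rule t0_in_u0[OF t(1)])
  have Q: "{a, b} \<subseteq> R" using a_in_R b_in_R by blast
  have "derivation br u0 (br t)"
    using u u0_br jacobi'[of t] by (auto simp: derivation_def br_simps scaleR_eq_scale)
  moreover have "br t ` t0 \<subseteq> t0"
    using t0_abelian[OF t(1)] subspace_0[OF t0_subspace] by auto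
  moreover have "x + \<i> *s br t x \<in> q {a, b}" if "x \<in> re ` q {a, b}" for x
  proof (rule complex_structure_if_eigenvalue[OF Q linear_right _ _ _ that])
    show "cj (br t z) = br t (cj z)" for z by (simp add: cj_br cj_u0[OF u])
    show "br t H \<in> h" if "H \<in> h" for H using h_abelian[OF t0_h[OF t(1)] that] h_closed(1) by simp
    show "br t z = - \<i> *s z" if "v \<in> {a, b}" "z \<in> gs v" for v z
      using that t t0_h[OF t(1)] by (auto simp: gs_iff)
  qed
  ultimately show ?thesis
    unfolding J_property_def by blast
qed

end

theorem proposition6p13:
  fixes br :: "complex^'n \<Rightarrow> complex^'n \<Rightarrow> complex^'n"
    and u0 t0 :: "(complex^'n) set"
    and \<rho> :: "real^3 \<Rightarrow> complex^'n \<Rightarrow> complex"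
  shows "(\<forall>Q. maximal_admissible G2 Q \<longrightarrow> isomorphic_subsets G2 Q Q41 \<or> isomorphic_subsets G2 Q Q42)
    \<and> (simple_lie_with_roots br u0 t0 G2 \<rho> \<longrightarrow>
          (Q41 \<in> Q_sym br u0 t0 G2 \<rho> \<and> Q42 \<notin> Q_sym br u0 t0 G2 \<rho>)
        \<and> Q_weak_J br u0 t0 G2 \<rho> = Q_J br u0 t0 G2 \<rho>
        \<and> (\<forall>Q \<in> Q_weak_J br u0 t0 G2 \<rho>. isomorphic_subsets G2 Q Q40))"
proof -
  let ?a = "ee 1 - ee 3" and ?b = "2 *\<^sub>R ee 1 - ee 2 - ee 3"
  note base = G2_standard_base
  \<comment> \<open>The third elements of \<open>Q41\<close> and \<open>Q42\<close> are orthogonal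
    to \<open>a\<close> and at 30 degrees to \<open>a\<close>, respectively.\<close>
  have "2 *\<^sub>R ?b - 3 *\<^sub>R ?a = ee 1 + ee 3 - 2 *\<^sub>R ee 2" "3 *\<^sub>R ?a - ?b = ee 1 + ee 2 - 2 *\<^sub>R ee 3"
    by (simp_all add: vec_eq_iff forall_3 axis_def)
  then have Q: "Q41 = {?a, ?b, 2 *\<^sub>R ?b - 3 *\<^sub>R ?a}" "Q42 = {?a, ?b, 3 *\<^sub>R ?a - ?b}" "Q40 = {?a, ?b}"
    by (simp_all only: Q41_def Q42_def Q40_def)
  have 1: "isomorphic_subsets G2 Q Q41 \<or> isomorphic_subsets G2 Q Q42" if max: "maximal_admissible G2 Q" for Q
  proof -
    obtain a b where "G2_base G2 a b" "Q = {a, b, 3 *\<^sub>R a - b} \<or> Q = {a, b, 2 *\<^sub>R b - 3 *\<^sub>R a}"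
      using maximal_admissible_shape[OF base max] .
    then show ?thesis
      using isomorphic_if_bases(2,3)[OF _ base] unfolding Q by blast
  qed
  have 2: "(Q41 \<in> Q_sym br u0 t0 G2 \<rho> \<and> Q42 \<notin> Q_sym br u0 t0 G2 \<rho>)
        \<and> Q_weak_J br u0 t0 G2 \<rho> = Q_J br u0 t0 G2 \<rho>
        \<and> (\<forall>Q \<in> Q_weak_J br u0 t0 G2 \<rho>. isomorphic_subsets G2 Q Q40)"
    if lie: "simple_lie_with_roots br u0 t0 G2 \<rho>"
  proof -
    have data: "G2_data br u0 t0 G2 \<rho> a b" if "G2_base G2 a b" for a b
      using lie that G2_base_finite[OF that]
      by (simp add: G2_data_def G2_data_axioms_def finite_root_data_def finite_root_data_axioms_def)
    have weak: "\<exists>a b. G2_base G2 a b \<and> Q = {a, b}" if "Q \<in> Q_weak_J br u0 t0 G2 \<rho>" for Q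
    proof -
      have Q: "Q \<in> admissible_sets G2" "weak_J_property br u0 t0 (q_of br t0 \<rho> Q)"
        using that by (simp_all add: Q_weak_J_def)
      obtain a b where ab: "G2_base G2 a b"
        "Q = {a, b} \<or> Q = {a, b, 3 *\<^sub>R a - b} \<or> Q = {a, b, 2 *\<^sub>R b - 3 *\<^sub>R a}"
        using admissible_shape[OF base Q(1)] .
      then show ?thesis
        using G2_data.not_weak_J[OF data[OF ab(1)]] Q(2) by blast
    qed
    have "Q \<in> Q_J br u0 t0 G2 \<rho>" if "Q \<in> Q_weak_J br u0 t0 G2 \<rho>" for Q
      using weak[OF that] G2_data.J_property_base[OF data] admissible_if_base(1) by (auto simp: Q_J_def)
    moreover have "Q \<in> Q_weak_J br u0 t0 G2 \<rho>" if "Q \<in> Q_J br u0 t0 G2 \<rho>" for Q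
    proof -
      have Q: "Q \<in> admissible_sets G2" "J_property br u0 t0 (q_of br t0 \<rho> Q)"
        using that by (simp_all add: Q_J_def)
      obtain a b where ab: "G2_base G2 a b"
        "Q = {a, b} \<or> Q = {a, b, 3 *\<^sub>R a - b} \<or> Q = {a, b, 2 *\<^sub>R b - 3 *\<^sub>R a}"
        using admissible_shape[OF base Q(1)] .
      \<comment> \<open>All three shapes contain \<open>a\<close> and \<open>b\<close>, so they can
        be treated together.\<close>
      then show ?thesis
        using G2_data.weak_J_if_J[OF data[OF ab(1)], of Q] Q
        unfolding admissible_sets_def Q_weak_J_def by blast
    qed
    moreover have "isomorphic_subsets G2 Q Q40" if "Q \<in> Q_weak_J br u0 t0 G2 \<rho>" for Q
      using weak[OF that] isomorphic_if_bases(1)[OF _ base] unfolding Q by blast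
    moreover have "Q41 \<in> Q_sym br u0 t0 G2 \<rho>"
      using G2_data.CR_symmetric_obtuse[OF data[OF base]] admissible_if_base(3)[OF base]
      unfolding Q Q_sym_def by blast
    moreover have "Q42 \<notin> Q_sym br u0 t0 G2 \<rho>"
      using G2_data.not_CR_symmetric_acute[OF data[OF base]] unfolding Q Q_sym_def by blast
    ultimately show ?thesis by blast
  qed
  show ?thesis using 1 2 by blast
qed

end
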